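(* Let $(H,\delta)$ be a sequence of spaces and maps such that $R(\delta_p\delta_{p+1})$ is finite dimensional for each $p\in\mathbb{Z}$. Then the following statements are equivalent: (i) $(H,\delta)$ is a Fredholm chain; (ii) $\bigoplus_{p=2k}(\delta_p+\delta_{p+1}^* )\colon \bigoplus_{p\text{ even}}H_p\to\bigoplus_{p\text{ odd}}H_p$ is a Fredholm operator; (iii) $\bigoplus_{p=2k+1}(\delta_p+\delta_{p+1}^* )\colon \bigoplus_{p\text{ odd}}H_p\to\bigoplus_{p\text{ even}}H_p$ is a Fredholm operator. Furthermore, in this case $$\operatorname{ind}(H,\delta)=\operatorname{ind}\Big(\bigoplus_{p=2k}(\delta_p+\delta_{p+1}^* )\Big)=-\operatorname{ind}\Big(\bigoplus_{p=2k+1}(\delta_p+\delta_{p+1}^* )\Big).$$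
   Context: $L(X,Y)$ denotes the bounded linear maps between Hilbert spaces $X$ and $Y$; $N(\cdot)$ and $R(\cdot)$ denote null space and range; $*$ is the Hilbert space adjoint; direct sums of Hilbert spaces are orthogonal. A sequence of spaces and maps $(H,\delta)$ consists of Hilbert spaces $H_p$ and operators $\delta_p\in L(H_p,H_{p-1})$, $p\in\mathbb{Z}$, for which there is $n\in\mathbb{N}$ such that $H_p=0$ and $\delta_p=0$ for $p<0$ and for $p\ge n+1$; i.e. $0\to H_n\xrightarrow{\delta_n}H_{n-1}\to\cdots\to H_1\xrightarrow{\delta_1}H_0\to 0$ (with no requirement that $\delta_p\delta_{p+1}=0$). It is called a Fredholm chain if $N(\delta_p)/(N(\delta_p)\cap R(\delta_{p+1}))$ and $R(\delta_{p+1})/(N(\delta_p)\cap R(\delta_{p+1}))$ are finite dimensional for every $p=0,\dots,n$. The index of a Fredholm chain is $\operatorname{ind}(H,\delta)=\sum_{p=0}^n(-1)^p\big(\dim N(\delta_p)/(N(\delta_p)\cap R(\delta_{p+1}))-\dim R(\delta_{p+1})/(N(\delta_p)\cap R(\delta_{p+1}))\big)$. The operator $\bigoplus_{p=2k}(\delta_p+\delta_{p+1}^* )$ (sum over all even $p$) sends $(x_p)_{p\text{ even}}$ to $\sum_{p\text{ even}}(\delta_p x_p+\delta_{p+1}^*x_p)$, where $\delta_px_p\in H_{p-1}$ and $\delta_{p+1}^*x_p\in H_{p+1}$; similarly for odd $p$. The index of a Fredholm operator $A\in L(X,Y)$ is $\dim N(A)-\dim Y/R(A)$. *)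

theory Defs
  imports "HOL-Analysis.Analysis" "HOL-Algebra.AbelCoset" "Jordan_Normal_Form.Missing_VectorSpace"
begin

section \<open>Hilbert spaces with explicit carriers\<close>

text \<open>
  A sequence of Hilbert spaces is indexed by an integer variable, so its members cannot be
  types. They are records with a carrier set, extending the modules of HOL-Algebra by an inner
  product, and linear algebra (finite dimension, dimension) is that of the locale
  \<^locale>\<open>vectorspace\<close>.

  Real and complex Hilbert spaces are treated at once: the field of scalars is a set \<open>K\<close> of
  complex numbers, required to be either \<open>\<real>\<close> or \<open>UNIV\<close>, and inner products take
  values in \<open>K\<close>.
\<close>

definition scalars :: "complex set \<Rightarrow> complex ring"
  where "scalars K = \<lparr>carrier = K, mult = (*), one = 1, zero = 0, add = (+)\<rparr>"

record 'a ipspace = "(complex, 'a) module" +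
  iprod :: "'a \<Rightarrow> 'a \<Rightarrow> complex"

definition hnorm :: "'a ipspace \<Rightarrow> 'a \<Rightarrow> real"
  where "hnorm X x = sqrt (Re (iprod X x x))"

locale hilbert_space = vectorspace "scalars K" X
  for K :: "complex set" and X :: "'a ipspace" +
  assumes real_or_complex: "K = \<real> \<or> K = UNIV"
    and iprod_closed: "\<lbrakk>x \<in> carrier X; y \<in> carrier X\<rbrakk> \<Longrightarrow> iprod X x y \<in> K"
    and iprod_add_left:
      "\<lbrakk>x \<in> carrier X; y \<in> carrier X; z \<in> carrier X\<rbrakk>
        \<Longrightarrow> iprod X (x \<oplus>\<^bsub>X\<^esub> y) z = iprod X x z + iprod X y z"
    and iprod_smult_left:
      "\<lbrakk>a \<in> K; x \<in> carrier X; y \<in> carrier X\<rbrakk>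
        \<Longrightarrow> iprod X (a \<odot>\<^bsub>X\<^esub> x) y = a * iprod X x y"
    and iprod_cnj: "\<lbrakk>x \<in> carrier X; y \<in> carrier X\<rbrakk> \<Longrightarrow> iprod X y x = cnj (iprod X x y)"
    and iprod_pos: "\<lbrakk>x \<in> carrier X; x \<noteq> \<zero>\<^bsub>X\<^esub>\<rbrakk> \<Longrightarrow> 0 < Re (iprod X x x)"
    and complete:
      "\<lbrakk>\<forall>i. f i \<in> carrier X;
        \<forall>e>0. \<exists>N. \<forall>i\<ge>N. \<forall>j\<ge>N. hnorm X (f i \<ominus>\<^bsub>X\<^esub> f j) < e\<rbrakk>
        \<Longrightarrow> \<exists>l\<in>carrier X. (\<lambda>i::nat. hnorm X (f i \<ominus>\<^bsub>X\<^esub> l)) \<longlonglongrightarrow> 0"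

text \<open>The space \<open>L(X,Y)\<close>; values outside the carrier of \<open>X\<close> are irrelevant.\<close>

definition bounded_maps ::
    "complex set \<Rightarrow> 'a ipspace \<Rightarrow> 'b ipspace \<Rightarrow> ('a \<Rightarrow> 'b) set"
  where "bounded_maps K X Y =
    {A \<in> module_hom (scalars K) X Y.
      \<exists>C. \<forall>x\<in>carrier X. hnorm Y (A x) \<le> C * hnorm X x}"

text \<open>
  For bounded \<open>A\<close> between Hilbert spaces, existence and uniqueness of the described vector is
  the Riesz representation theorem.
\<close>

definition hadjoint :: "'a ipspace \<Rightarrow> 'b ipspace \<Rightarrow> ('a \<Rightarrow> 'b) \<Rightarrow> 'b \<Rightarrow> 'a"
  where "hadjoint X Y A y =
    (THE x. x \<in> carrier X \<and> (\<forall>u\<in>carrier X. iprod Y (A u) y = iprod X u x))"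

text \<open>
  The orthogonal (Hilbert) direct sum: square summable families. The fields \<open>mult\<close> and
  \<open>one\<close>, which modules inherit from the record type of rings, carry no meaning here or in
  the quotient below.
\<close>

definition hilbert_sum :: "'i set \<Rightarrow> ('i \<Rightarrow> 'a ipspace) \<Rightarrow> ('i \<Rightarrow> 'a) ipspace"
  where "hilbert_sum S H =
    \<lparr>carrier = {x \<in> (\<Pi>\<^sub>E p\<in>S. carrier (H p)).
                  (\<lambda>p. (hnorm (H p) (x p))\<^sup>2) summable_on S},
     mult = (\<lambda>x y. \<lambda>p\<in>S. \<zero>\<^bsub>H p\<^esub>),
     one = (\<lambda>p\<in>S. \<zero>\<^bsub>H p\<^esub>),
     zero = (\<lambda>p\<in>S. \<zero>\<^bsub>H p\<^esub>),
     add = (\<lambda>x y. \<lambda>p\<in>S. x p \<oplus>\<^bsub>H p\<^esub> y p),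
     smult = (\<lambda>a x. \<lambda>p\<in>S. a \<odot>\<^bsub>H p\<^esub> x p),
     iprod = (\<lambda>x y. \<Sum>\<^sub>\<infinity>p\<in>S. iprod (H p) (x p) (y p))\<rparr>"


section \<open>Quotients and dimensions\<close>

definition quotient_space ::
    "('k, 'a, 'm) module_scheme \<Rightarrow> 'a set \<Rightarrow> ('k, 'a set) module"
  where "quotient_space V W =
    \<lparr>carrier = a_rcosets\<^bsub>V\<^esub> W,
     mult = (\<lambda>A B. W),
     one = W,
     zero = W,
     add = (\<lambda>A B. A <+>\<^bsub>V\<^esub> B),
     smult = (\<lambda>a A. \<Union>x\<in>A. W +>\<^bsub>V\<^esub> (a \<odot>\<^bsub>V\<^esub> x))\<rparr>"

abbreviation subspace_of :: "('k, 'a, 'm) module_scheme \<Rightarrow> 'a set \<Rightarrow> ('k, 'a, 'm) module_scheme"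
  where "subspace_of V U \<equiv> V\<lparr>carrier := U\<rparr>"

abbreviation findim :: "complex set \<Rightarrow> (complex, 'a, 'm) module_scheme \<Rightarrow> bool"
  where "findim K V \<equiv> vectorspace.fin_dim (scalars K) V"

abbreviation vdim :: "complex set \<Rightarrow> (complex, 'a, 'm) module_scheme \<Rightarrow> nat"
  where "vdim K V \<equiv> vectorspace.dim (scalars K) V"


section \<open>Fredholm operators\<close>

text \<open>\<^const>\<open>a_kernel\<close> is the null space.\<close>

definition fredholm :: "complex set \<Rightarrow> 'a ipspace \<Rightarrow> 'b ipspace \<Rightarrow> ('a \<Rightarrow> 'b) \<Rightarrow> bool"
  where "fredholm K X Y A \<longleftrightarrow>
    A \<in> bounded_maps K X Y \<and>
    findim K (subspace_of X (a_kernel X Y A)) \<and>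
    findim K (quotient_space Y (A ` carrier X))"

definition fredholm_index ::
    "complex set \<Rightarrow> 'a ipspace \<Rightarrow> 'b ipspace \<Rightarrow> ('a \<Rightarrow> 'b) \<Rightarrow> int"
  where "fredholm_index K X Y A =
    int (vdim K (subspace_of X (a_kernel X Y A))) - int (vdim K (quotient_space Y (A ` carrier X)))"


section \<open>Sequences of spaces and maps\<close>

definition spaces_and_maps ::
    "complex set \<Rightarrow> nat \<Rightarrow> (int \<Rightarrow> 'a ipspace) \<Rightarrow> (int \<Rightarrow> 'a \<Rightarrow> 'a) \<Rightarrow> bool"
  where "spaces_and_maps K n H \<delta> \<longleftrightarrow>
    (\<forall>p. hilbert_space K (H p)) \<and>
    (\<forall>p. \<delta> p \<in> bounded_maps K (H p) (H (p - 1))) \<and>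
    (\<forall>p. p < 0 \<or> p \<ge> int n + 1 \<longrightarrow>
      carrier (H p) = {\<zero>\<^bsub>H p\<^esub>} \<and> (\<forall>x\<in>carrier (H p). \<delta> p x = \<zero>\<^bsub>H (p - 1)\<^esub>))"

definition nullsp :: "(int \<Rightarrow> 'a ipspace) \<Rightarrow> (int \<Rightarrow> 'a \<Rightarrow> 'a) \<Rightarrow> int \<Rightarrow> 'a set"
  where "nullsp H \<delta> p = a_kernel (H p) (H (p - 1)) (\<delta> p)"

definition rangesp :: "(int \<Rightarrow> 'a ipspace) \<Rightarrow> (int \<Rightarrow> 'a \<Rightarrow> 'a) \<Rightarrow> int \<Rightarrow> 'a set"
  where "rangesp H \<delta> p = \<delta> p ` carrier (H p)"

text \<open>
  \<open>N(\<delta>\<^sub>p) / (N(\<delta>\<^sub>p) \<inter> R(\<delta>\<^sub>p\<^sub>+\<^sub>1))\<close> and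
  \<open>R(\<delta>\<^sub>p\<^sub>+\<^sub>1) / (N(\<delta>\<^sub>p) \<inter> R(\<delta>\<^sub>p\<^sub>+\<^sub>1))\<close>
\<close>

definition null_quotient ::
    "(int \<Rightarrow> 'a ipspace) \<Rightarrow> (int \<Rightarrow> 'a \<Rightarrow> 'a) \<Rightarrow> int \<Rightarrow> (complex, 'a set) module"
  where "null_quotient H \<delta> p =
    quotient_space (subspace_of (H p) (nullsp H \<delta> p)) (nullsp H \<delta> p \<inter> rangesp H \<delta> (p + 1))"

definition range_quotient ::
    "(int \<Rightarrow> 'a ipspace) \<Rightarrow> (int \<Rightarrow> 'a \<Rightarrow> 'a) \<Rightarrow> int \<Rightarrow> (complex, 'a set) module"
  where "range_quotient H \<delta> p =
    quotient_space (subspace_of (H p) (rangesp H \<delta> (p + 1)))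
      (nullsp H \<delta> p \<inter> rangesp H \<delta> (p + 1))"

definition fredholm_chain ::
    "complex set \<Rightarrow> nat \<Rightarrow> (int \<Rightarrow> 'a ipspace) \<Rightarrow> (int \<Rightarrow> 'a \<Rightarrow> 'a) \<Rightarrow> bool"
  where "fredholm_chain K n H \<delta> \<longleftrightarrow>
    spaces_and_maps K n H \<delta> \<and>
    (\<forall>p\<in>{0..int n}. findim K (null_quotient H \<delta> p) \<and> findim K (range_quotient H \<delta> p))"

definition chain_index ::
    "complex set \<Rightarrow> nat \<Rightarrow> (int \<Rightarrow> 'a ipspace) \<Rightarrow> (int \<Rightarrow> 'a \<Rightarrow> 'a) \<Rightarrow> int"
  where "chain_index K n H \<delta> =
    (\<Sum>p\<in>{0..int n}. (-1) ^ nat p *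
      (int (vdim K (null_quotient H \<delta> p)) - int (vdim K (range_quotient H \<delta> p))))"

abbreviation even_sum :: "(int \<Rightarrow> 'a ipspace) \<Rightarrow> (int \<Rightarrow> 'a) ipspace"
  where "even_sum H \<equiv> hilbert_sum {p. even p} H"

abbreviation odd_sum :: "(int \<Rightarrow> 'a ipspace) \<Rightarrow> (int \<Rightarrow> 'a) ipspace"
  where "odd_sum H \<equiv> hilbert_sum {p. odd p} H"

text \<open>
  The operators
  \<open>(x\<^sub>p) \<mapsto> \<Sum>\<^sub>p (\<delta>\<^sub>p x\<^sub>p + \<delta>\<^sub>p\<^sub>+\<^sub>1\<^sup>* x\<^sub>p)\<close>,
  written by components. A summand contributes to \<open>H\<^sub>q\<close> only through
  \<open>\<delta>\<^sub>p x\<^sub>p\<close> for \<open>p = q + 1\<close> and through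
  \<open>\<delta>\<^sub>p\<^sub>+\<^sub>1\<^sup>* x\<^sub>p\<close> for \<open>p = q - 1\<close>.
  The set \<open>T\<close> collects the indices \<open>q\<close> of the target, whose parity is opposite to that
  of the source.
\<close>

definition delta_plus_adjoint ::
    "int set \<Rightarrow> (int \<Rightarrow> 'a ipspace) \<Rightarrow> (int \<Rightarrow> 'a \<Rightarrow> 'a) \<Rightarrow> (int \<Rightarrow> 'a) \<Rightarrow> (int \<Rightarrow> 'a)"
  where "delta_plus_adjoint T H \<delta> x =
    (\<lambda>q\<in>T. \<delta> (q + 1) (x (q + 1)) \<oplus>\<^bsub>H q\<^esub> hadjoint (H q) (H (q - 1)) (\<delta> q) (x (q - 1)))"

abbreviation even_op ::
    "(int \<Rightarrow> 'a ipspace) \<Rightarrow> (int \<Rightarrow> 'a \<Rightarrow> 'a) \<Rightarrow> (int \<Rightarrow> 'a) \<Rightarrow> (int \<Rightarrow> 'a)"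
  where "even_op H \<delta> \<equiv> delta_plus_adjoint {q. odd q} H \<delta>"

abbreviation odd_op ::
    "(int \<Rightarrow> 'a ipspace) \<Rightarrow> (int \<Rightarrow> 'a \<Rightarrow> 'a) \<Rightarrow> (int \<Rightarrow> 'a) \<Rightarrow> (int \<Rightarrow> 'a)"
  where "odd_op H \<delta> \<equiv> delta_plus_adjoint {q. even q} H \<delta>"

end

theory Submission
  imports Defs "HOL-Library.Function_Algebras"
begin

text \<open>
  Collecting the even and the odd degrees turns the sequence into two Hilbert spaces \<open>X\<close>, \<open>Y\<close>
  with maps \<open>d0 : X \<rightarrow> Y\<close> and \<open>d1 : Y \<rightarrow> X\<close> (the sums of the \<open>\<delta>\<close>'s) whose products
  \<open>d1 d0\<close> and \<open>d0 d1\<close> have finite rank. With their adjoints \<open>e0\<close>, \<open>e1\<close> the two operators are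
  \<open>d0 + e1\<close> and \<open>d1 + e0\<close>, each the adjoint of the other. Their equivalence, with opposite
  indices, is the statement that the adjoint of a Fredholm operator is Fredholm of opposite
  index (\<open>adjoint_fredholm\<close>).

  For the comparison with the chain, split \<open>X = N0 \<oplus> M0\<close> and \<open>Y = N1 \<oplus> M1\<close> into the null spaces
  of \<open>d0\<close>, \<open>d1\<close> and their orthogonal complements. Since \<open>d0\<close> is injective on \<open>M0\<close> and
  \<open>d0 d1\<close> has finite rank, the \<open>M0\<close>-component of \<open>d1\<close> has finite rank, and likewise for \<open>d0\<close>.
  Up to finite rank, \<open>d0 + e1\<close> is therefore block diagonal, with blocks \<open>M0 \<rightarrow> N1\<close> (the
  compression of \<open>d0\<close>) and \<open>e1 : N0 \<rightarrow> M1\<close> (\<open>fredholm_iff_blocks\<close>). Each block is, directly or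
  through its adjoint, a compression such as \<open>M1 \<rightarrow> N0\<close> of \<open>d1\<close>. As \<open>d1\<close> maps \<open>M1\<close> bijectively onto
  its range \<open>R\<close>, this compression becomes, on a subspace of finite codimension identified with
  \<open>N0 \<inter> R\<close>, the inclusion of \<open>N0 \<inter> R\<close> into \<open>N0\<close>; so it is Fredholm exactly when \<open>N0/(N0 \<inter> R)\<close> is finite dimensional, and
  its index is \<open>dim R/(N0 \<inter> R) - dim N0/(N0 \<inter> R)\<close> (\<open>e1_fredholm\<close>). Adding the two blocks gives
  the index of the chain, because null spaces and ranges of \<open>d0\<close> and \<open>d1\<close> are the direct sums
  of those of the \<open>\<delta>\<close>'s (\<open>family_findim\<close>).

  This part of the argument takes place in subspaces of real vector spaces. Real and complex
  scalars are covered together: orthogonality, adjoints and finiteness of dimension only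
  depend on the underlying real structure, and passing to it multiplies all dimensions, hence
  both sides of the index formula, by the same factor \<open>1\<close> or \<open>2\<close>. A Hilbert space given by a
  carrier set becomes such a subspace through \<open>x \<mapsto> \<langle>x, \<cdot>\<rangle>\<close> (\<open>riesz_embedding\<close>).

  Boundedness enters in this form: a linear map between Hilbert spaces is bounded as soon as it
  has an everywhere defined adjoint (\<open>adjoint_bounded\<close>). So adjoint pairs of linear maps are
  carried along instead of norms.
\<close>

section \<open>Relative dimension of real subspaces\<close>

text \<open>
  The plain names denote notions of modules with explicit carriers; these abbreviations refer
  to subspaces and spans in a real vector space type.
\<close>

abbreviation rsub :: "'b::real_vector set \<Rightarrow> bool" where
  "rsub \<equiv> Real_Vector_Spaces.subspace"

abbreviation rspan :: "'b::real_vector set \<Rightarrow> 'b set" where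
  "rspan \<equiv> Real_Vector_Spaces.span"

abbreviation nullset :: "('b::real_vector \<Rightarrow> 'c::real_vector) \<Rightarrow> 'b set \<Rightarrow> 'b set" where
  "nullset T V \<equiv> {x\<in>V. T x = 0}"

definition ssum :: "'b::real_vector set \<Rightarrow> 'b set \<Rightarrow> 'b set" where
  "ssum A B = {a + b | a b. a \<in> A \<and> b \<in> B}"

text \<open>
  \<open>fincodim U W n\<close> says that \<open>W/U\<close> has finite dimension \<open>n\<close>: it takes \<open>n\<close> vectors, added one at
  a time, to get from \<open>U\<close> to \<open>W\<close>. In this form additivity is immediate and facts about linear
  maps follow by treating one additional vector.
\<close>

inductive fincodim :: "'b::real_vector set \<Rightarrow> 'b set \<Rightarrow> nat \<Rightarrow> bool" where
  refl: "fincodim U U 0"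
| step: "fincodim U W n \<Longrightarrow> x \<notin> W \<Longrightarrow> fincodim U (rspan (insert x W)) (Suc n)"

lemmas rsub_simps = real_vector.subspace_0 real_vector.subspace_add real_vector.subspace_diff
  real_vector.subspace_scale real_vector.subspace_neg

lemma span_insert_subspace:
  assumes "rsub W" shows "rspan (insert x W) = {w + r *\<^sub>R x | w r. w \<in> W}"
proof -
  have eq: "rspan W = W" using assms by simp
  have "rspan (insert x W) = {y. \<exists>k. y - k *\<^sub>R x \<in> W}"
    unfolding real_vector.span_insert eq by (rule HOL.refl)
  also have "\<dots> = {w + r *\<^sub>R x | w r. w \<in> W}"
    by (auto, metis diff_add_cancel, metis add_diff_cancel_right')
  finally show ?thesis .
qed

lemma fincodim_subspace: "fincodim U W n \<Longrightarrow> rsub U \<Longrightarrow> rsub W"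
  by (induction rule: fincodim.induct) auto

lemma fincodim_subset: "fincodim U W n \<Longrightarrow> U \<subseteq> W"
proof (induction rule: fincodim.induct)
  case (step U W n x)
  then show ?case using real_vector.span_superset[of "insert x W"] by blast
qed simp

lemma fincodim_trans: "fincodim V W n \<Longrightarrow> fincodim U V m \<Longrightarrow> fincodim U W (m + n)"
  by (induction rule: fincodim.induct) (auto intro: fincodim.step)

lemma rsub_nullset: "linear T \<Longrightarrow> rsub V \<Longrightarrow> rsub (nullset T V)"
  by (auto simp: real_vector.subspace_def linear_add linear_scale linear_0)

lemma rsub_image: "linear T \<Longrightarrow> rsub V \<Longrightarrow> rsub (T ` V)"
  by (rule linear_subspace_image)

lemma rsub_ssum: "rsub A \<Longrightarrow> rsub B \<Longrightarrow> rsub (ssum A B)"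
  unfolding ssum_def by (rule real_vector.subspace_sums)

lemma image_zero:
  assumes "rsub U" "\<And>x. x \<in> U \<Longrightarrow> q x = 0" shows "q ` U = {0}"
  using assms real_vector.subspace_0[OF assms(1)] by force

lemma ssumI: "a \<in> A \<Longrightarrow> b \<in> B \<Longrightarrow> a + b \<in> ssum A B"
  unfolding ssum_def by blast

lemma ssumE: assumes "x \<in> ssum A B" obtains a b where "a \<in> A" "b \<in> B" "x = a + b"
  using assms unfolding ssum_def by blast

lemma ssum_left: "rsub B \<Longrightarrow> A \<subseteq> ssum A B"
  using ssumI[of _ A 0 B] real_vector.subspace_0 by fastforce

lemma ssum_right: "rsub A \<Longrightarrow> B \<subseteq> ssum A B"
  using ssumI[of 0 A _ B] real_vector.subspace_0 by fastforce

lemma ssum_commute: "ssum A B = ssum B A"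
  unfolding ssum_def by (metis add.commute)

lemma ssum_zero: "ssum A {0} = A"
  unfolding ssum_def by auto

lemma ssum_subset: "rsub W \<Longrightarrow> A \<subseteq> W \<Longrightarrow> B \<subseteq> W \<Longrightarrow> ssum A B \<subseteq> W"
  unfolding ssum_def by (auto intro: real_vector.subspace_add)

lemma image_ssum: "linear T \<Longrightarrow> T ` ssum A B = ssum (T ` A) (T ` B)"
  unfolding ssum_def by (auto simp: linear_add image_iff) (metis linear_add)+

text \<open>
  Rank and nullity, relative to \<open>U\<close>. An additional vector \<open>x\<close> enlarges the image if \<open>T x\<close> is new,
  and otherwise the null space: if \<open>T x = T v\<close>, then \<open>x - v\<close> is a new vector of it.
\<close>

lemma fincodim_image:
  assumes T: "linear T" and U: "rsub U" and "fincodim U V n"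
  shows "\<exists>j k. j + k = n \<and> fincodim (T ` U) (T ` V) j \<and> fincodim (nullset T U) (nullset T V) k"
  using assms(3) U
proof (induction rule: fincodim.induct)
  case (refl U)
  show ?case by (intro exI[of _ 0]) (auto intro: fincodim.refl)
next
  case (step U V n x)
  then obtain j k where jk: "j + k = n" "fincodim (T ` U) (T ` V) j"
    "fincodim (nullset T U) (nullset T V) k" by blast
  have V: "rsub V" using step fincodim_subspace by blast
  note V' = span_insert_subspace[OF V, of x]
  show ?case
  proof (cases "T x \<in> T ` V")
    case True
    then obtain v where v: "v \<in> V" "T x = T v" by blast
    have y: "x - v \<notin> nullset T V"
      using step.hyps(2) v(1) V real_vector.subspace_add[OF V, of "x - v" v] by auto
    have im: "T ` rspan (insert x V) = T ` V"
    proof -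
      have "T (w + r *\<^sub>R x) \<in> T ` V" if "w \<in> V" for w r
      proof -
        have "T (w + r *\<^sub>R x) = T (w + r *\<^sub>R v)" using T v by (simp add: linear_add linear_scale)
        then show ?thesis using that v V by (simp add: rsub_simps)
      qed
      then show ?thesis unfolding V' by (auto, metis (mono_tags, lifting) add.right_neutral image_eqI mem_Collect_eq scaleR_zero_left)
    qed
    have ker: "nullset T (rspan (insert x V)) = rspan (insert (x - v) (nullset T V))"
    proof -
      have "(\<exists>w r. z = w + r *\<^sub>R x \<and> w \<in> V) \<and> T z = 0 \<longleftrightarrow>
        (\<exists>w r. z = w + r *\<^sub>R (x - v) \<and> w \<in> V \<and> T w = 0)" (is "?L \<longleftrightarrow> ?R") for z
      proof
        assume ?L
        then obtain w r where w: "z = w + r *\<^sub>R x" "w \<in> V" "T z = 0" by blast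
        then have "T (w + r *\<^sub>R v) = 0" using T v by (simp add: linear_add linear_scale)
        moreover have "z = (w + r *\<^sub>R v) + r *\<^sub>R (x - v)" using w by (simp add: algebra_simps)
        moreover have "w + r *\<^sub>R v \<in> V" using w v V by (simp add: rsub_simps)
        ultimately show ?R by blast
      next
        assume ?R
        then obtain w r where w: "z = w + r *\<^sub>R (x - v)" "w \<in> V" "T w = 0" by blast
        then have "T z = 0" using T v by (simp add: linear_add linear_scale linear_diff)
        moreover have "z = (w - r *\<^sub>R v) + r *\<^sub>R x" using w by (simp add: algebra_simps)
        moreover have "w - r *\<^sub>R v \<in> V" using w v V by (simp add: rsub_simps)
        ultimately show ?L by blast
      qed
      then show ?thesis unfolding V' span_insert_subspace[OF rsub_nullset[OF T V]] by auto
    qed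
    show ?thesis
      unfolding im ker using jk fincodim.step[OF jk(3) y]
      by (intro exI[of _ j] exI[of _ "Suc k"]) simp
  next
    case False
    have TV: "rsub (T ` V)" using rsub_image[OF T V] .
    have im: "T ` rspan (insert x V) = rspan (insert (T x) (T ` V))"
      using linear_span_image[OF T, of "insert x V"] by simp
    have ker: "nullset T (rspan (insert x V)) = nullset T V"
    proof -
      have "r = 0" if "w \<in> V" "T (w + r *\<^sub>R x) = 0" for w r
      proof (rule ccontr)
        assume "r \<noteq> 0"
        have "T w + r *\<^sub>R T x = 0" using that T by (simp add: linear_add linear_scale)
        then have "r *\<^sub>R T x = - T w" by (simp add: eq_neg_iff_add_eq_0 add.commute)
        then have "T x = (1/r) *\<^sub>R (- T w)" using \<open>r \<noteq> 0\<close>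
          by (metis divide_inverse mult_1 real_vector_affinity_eq scaleR_one scaleR_scaleR left_inverse mult.commute)
        then have "T x = T ((-1/r) *\<^sub>R w)" using T by (simp add: linear_scale linear_neg)
        moreover have "(-1/r) *\<^sub>R w \<in> V" using V that by (simp add: rsub_simps)
        ultimately show False using False by blast
      qed
      then have "nullset T (rspan (insert x V)) \<subseteq> V" unfolding V' by fastforce
      then show ?thesis using real_vector.span_superset[of "insert x V"] by blast
    qed
    show ?thesis
      unfolding im ker using jk fincodim.step[OF jk(2) False]
      by (intro exI[of _ "Suc j"] exI[of _ k]) simp
  qed
qed

lemma fincodim_zero_basis:
  assumes "fincodim {0} W n"
  shows "\<exists>B. independent B \<and> finite B \<and> card B = n \<and> rspan B = W"
proof -
  have "fincodim U W n \<Longrightarrow> U = {0} \<Longrightarrow> ?thesis" for U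
  proof (induction rule: fincodim.induct)
    case (refl U)
    then show ?case by (intro exI[of _ "{}"]) (simp add: real_vector.independent_empty)
  next
    case (step U W n x)
    then obtain B where B: "independent B" "finite B" "card B = n" "rspan B = W" by blast
    have "x \<notin> B" using step.hyps B real_vector.span_base by blast
    show ?case
      by (rule exI[of _ "insert x B"])
        (use B step.hyps \<open>x \<notin> B\<close> in
          \<open>auto simp: real_vector.independent_insert real_vector.span_insert real_vector.span_span\<close>)
  qed
  then show ?thesis using assms by blast
qed

lemma fincodim_zero_unique:
  assumes "fincodim {0} W n" "fincodim {0} W m" shows "n = m"
  using fincodim_zero_basis[OF assms(1)] fincodim_zero_basis[OF assms(2)]
  by (metis real_vector.dim_span_eq_card_independent)

text \<open>
  Maps between subspaces may thus be taken linear on the whole type, where composition and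
  addition preserve linearity without side conditions.
\<close>

lemma linear_extension:
  fixes f :: "'b::real_vector \<Rightarrow> 'c::real_vector"
  assumes V: "rsub V" and add: "\<And>x y. x \<in> V \<Longrightarrow> y \<in> V \<Longrightarrow> f (x + y) = f x + f y"
    and scale: "\<And>r x. x \<in> V \<Longrightarrow> f (r *\<^sub>R x) = r *\<^sub>R f x"
  shows "\<exists>g. linear g \<and> (\<forall>x\<in>V. g x = f x)"
proof -
  obtain B where B: "B \<subseteq> V" "independent B" "V \<subseteq> rspan B"
    by (meson real_vector.basis_exists)
  obtain g where g: "linear g" "\<forall>x\<in>B. g x = f x"
    using real_vector.linear_independent_extend[OF B(2), of f] linear_independent_extend[OF B(2)] by blast
  have "x \<in> V \<and> g x = f x" if "x \<in> rspan B" for x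
    using that
  proof (induction rule: real_vector.span_induct_alt)
    case base
    then show ?case using g V add[of 0 0] by (simp add: linear_0 rsub_simps)
  next
    case (step c x y)
    then show ?case using g B V
      by (auto simp: add scale linear_add linear_scale rsub_simps subset_iff)
  qed
  then show ?thesis using g B by blast
qed

text \<open>
  A complement of \<open>U\<close> serves as a concrete quotient by \<open>U\<close>, and \<open>q\<close> as the quotient map.
\<close>

lemma quotient_map_exists:
  fixes U :: "'b::real_vector set"
  assumes "rsub U"
  obtains q :: "'b \<Rightarrow> 'b" where "linear q" "\<And>x. q x = 0 \<longleftrightarrow> x \<in> U" "\<And>x. x - q x \<in> U"
proof -
  have "linear (id :: 'b \<Rightarrow> 'b)" by (simp add: linear_id)
  from linear_exists_left_inverse_on[OF this assms]
  obtain g where g: "range g \<subseteq> U" "linear g" "\<And>v. v \<in> U \<Longrightarrow> g v = v"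
    by auto
  show ?thesis
  proof (rule that[of "\<lambda>x. x - g x"])
    show "linear (\<lambda>x. x - g x)" using g linear_compose_sub[OF linear_ident] by blast
    show "x - g x = 0 \<longleftrightarrow> x \<in> U" for x using g by (metis eq_iff_diff_eq_0 rangeI subsetD)
    show "x - (x - g x) \<in> U" for x using g by auto
  qed
qed

lemma fincodim_self: assumes "fincodim U U n" shows "n = 0"
  using assms
proof cases
  case (step W n x)
  have "W \<subseteq> U" using step(1) real_vector.span_superset by blast
  then show ?thesis using step fincodim_subset real_vector.span_base by blast
qed auto

lemma fincodim_vimage:
  assumes T: "linear T" and V: "rsub V" and "fincodim Y W n" and Y: "rsub Y" and WV: "W \<subseteq> T ` V"
  shows "fincodim {x\<in>V. T x \<in> Y} {x\<in>V. T x \<in> W} n"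
  using assms(3,4,5)
proof (induction rule: fincodim.induct)
  case (refl U)
  show ?case by (rule fincodim.refl)
next
  case (step Y W n y)
  have W: "rsub W" using step fincodim_subspace by blast
  have sub: "insert y W \<subseteq> rspan (insert y W)" using real_vector.span_superset by blast
  then obtain x where x: "x \<in> V" "T x = y" using step.prems by blast
  have V1: "rsub {x\<in>V. T x \<in> W}"
    using V W T by (auto simp: real_vector.subspace_def linear_add linear_scale linear_0)
  have "{x\<in>V. T x \<in> rspan (insert y W)} = rspan (insert x {x\<in>V. T x \<in> W})" (is "?L = ?R")
  proof (intro equalityI subsetI)
    fix z assume "z \<in> ?L"
    then obtain w r where w: "w \<in> W" "T z = w + r *\<^sub>R y" "z \<in> V"
      unfolding span_insert_subspace[OF W] by auto
    have "T (z - r *\<^sub>R x) = w" using w x T by (simp add: linear_diff linear_scale)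
    moreover have "z - r *\<^sub>R x \<in> V" using w x V by (simp add: rsub_simps)
    moreover have "z = (z - r *\<^sub>R x) + r *\<^sub>R x" by simp
    ultimately show "z \<in> ?R" unfolding span_insert_subspace[OF V1] using w by blast
  next
    fix z assume "z \<in> ?R"
    then obtain w r where "z = w + r *\<^sub>R x" "w \<in> V" "T w \<in> W"
      unfolding span_insert_subspace[OF V1] by auto
    then show "z \<in> ?L" unfolding span_insert_subspace[OF W] using x T V
      by (auto simp: linear_add linear_scale rsub_simps)
  qed
  moreover have "x \<notin> {x\<in>V. T x \<in> W}" using x step by auto
  moreover have "fincodim {x\<in>V. T x \<in> Y} {x\<in>V. T x \<in> W} n" using step.IH step.prems sub by blast
  ultimately show ?case using fincodim.step by metis
qed

lemma fincodim_preimage: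
  assumes T: "linear T" and U: "rsub U" and V: "rsub V" and UV: "U \<subseteq> V"
    and ker: "nullset T V \<subseteq> U" and "fincodim (T ` U) (T ` V) n"
  shows "fincodim U V n"
proof -
  have "{x\<in>V. T x \<in> T ` U} = U"
  proof (intro equalityI subsetI)
    fix x assume "x \<in> {x\<in>V. T x \<in> T ` U}"
    then obtain u where u: "x \<in> V" "u \<in> U" "T x = T u" by blast
    then have "x - u \<in> nullset T V" using T V UV by (auto simp: linear_diff rsub_simps subset_iff)
    then have "(x - u) + u \<in> U" using ker u U real_vector.subspace_add by blast
    then show "x \<in> U" by simp
  qed (use UV in auto)
  moreover have "{x\<in>V. T x \<in> T ` V} = V" by auto
  ultimately show ?thesis
    using fincodim_vimage[OF T V assms(6) rsub_image[OF T U] subset_refl] by simp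
qed

lemma fincodim_quotient_map:
  assumes q: "linear q" "\<And>x. q x = 0 \<longleftrightarrow> x \<in> U" and U: "rsub U" and W: "rsub W" and UW: "U \<subseteq> W"
  shows "fincodim U W n \<longleftrightarrow> fincodim {0} (q ` W) n"
proof -
  have qU: "q ` U = {0}" using q(2) by (intro image_zero[OF U]) auto
  show ?thesis
  proof
    assume W': "fincodim U W n"
    obtain j l where jl: "j + l = n" "fincodim (q ` U) (q ` W) j" "fincodim (nullset q U) (nullset q W) l"
      using fincodim_image[OF q(1) U W'] by blast
    have "nullset q U = U" "nullset q W = U" using q(2) UW by auto
    then have "l = 0" using jl fincodim_self by simp
    then show "fincodim {0} (q ` W) n" using jl qU by simp
  next
    assume "fincodim {0} (q ` W) n"
    then show "fincodim U W n" using fincodim_preimage[OF q(1) U W UW] q(2) by (auto simp: qU)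
  qed
qed

lemma fincodim_unique:
  assumes U: "rsub U" and n: "fincodim U W n" and m: "fincodim U W m" shows "n = m"
proof -
  obtain q where q: "linear q" "\<And>x. q x = 0 \<longleftrightarrow> x \<in> U" "\<And>x. x - q x \<in> U"
    using quotient_map_exists[OF U] by blast
  have "fincodim {0} (q ` W) k" if "fincodim U W k" for k
    using fincodim_quotient_map[OF q(1,2) U fincodim_subspace[OF n U] fincodim_subset[OF n]] that by blast
  then show ?thesis using n m fincodim_zero_unique by blast
qed

text \<open>
  Enlarging both spaces by \<open>V\<close> keeps the relative dimension as long as \<open>V\<close> meets \<open>B\<close> only
  inside \<open>A\<close>.
\<close>

lemma fincodim_ssum:
  assumes "fincodim A B k" and V: "rsub V" and A: "rsub A" and "B \<inter> V \<subseteq> A"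
  shows "fincodim (ssum V A) (ssum V B) k"
  using assms(1,3,4)
proof (induction rule: fincodim.induct)
  case (refl U)
  show ?case by (rule fincodim.refl)
next
  case (step A B n x)
  have B: "rsub B" using step fincodim_subspace by blast
  have sub: "B \<subseteq> rspan (insert x B)" using real_vector.span_superset by blast
  have IH: "fincodim (ssum V A) (ssum V B) n" using step sub by blast
  have "x \<notin> ssum V B"
  proof
    assume "x \<in> ssum V B"
    then obtain v b where vb: "v \<in> V" "b \<in> B" "x = v + b" by (rule ssumE)
    have "x \<in> rspan (insert x B)" "b \<in> rspan (insert x B)" using vb by (auto intro: real_vector.span_base)
    then have "x - b \<in> rspan (insert x B)" by (rule real_vector.span_diff)
    then have "v \<in> A" using vb step.prems by auto
    then have "v \<in> B" using step fincodim_subset by blast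
    then show False using vb B step.hyps by (simp add: rsub_simps)
  qed
  moreover have "ssum V (rspan (insert x B)) = rspan (insert x (ssum V B))"
  proof (intro equalityI subsetI)
    fix z assume "z \<in> ssum V (rspan (insert x B))"
    then obtain v b r where "v \<in> V" "b \<in> B" "z = v + (b + r *\<^sub>R x)"
      unfolding span_insert_subspace[OF B] ssum_def by blast
    then have "z = (v + b) + r *\<^sub>R x" "v + b \<in> ssum V B" by (auto intro: ssumI)
    then show "z \<in> rspan (insert x (ssum V B))"
      unfolding span_insert_subspace[OF rsub_ssum[OF V B]] by blast
  next
    fix z assume "z \<in> rspan (insert x (ssum V B))"
    then obtain v b r where "v \<in> V" "b \<in> B" "z = (v + b) + r *\<^sub>R x"
      unfolding span_insert_subspace[OF rsub_ssum[OF V B]] by (auto elim!: ssumE)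
    then have "z = v + (b + r *\<^sub>R x)" "v \<in> V" "b + r *\<^sub>R x \<in> rspan (insert x B)"
      unfolding span_insert_subspace[OF B] by auto
    then show "z \<in> ssum V (rspan (insert x B))" by (auto intro: ssumI)
  qed
  ultimately show ?case using fincodim.step[OF IH] by metis
qed

lemma fincodim_complement:
  assumes "rsub U" "rsub C" "fincodim {0} C n" "C \<inter> U \<subseteq> {0}"
  shows "fincodim U (ssum U C) n"
  using fincodim_ssum[OF assms(3,1) real_vector.subspace_single_0 assms(4)] unfolding ssum_zero .

lemma complement_exists:
  assumes U: "rsub U" and W: "rsub W" and UW: "U \<subseteq> W"
  obtains C where "rsub C" "C \<inter> U \<subseteq> {0}" "ssum U C = W"
    "\<And>n. fincodim U W n \<longleftrightarrow> fincodim {0} C n"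
proof -
  obtain q where q: "linear q" "\<And>x. q x = 0 \<longleftrightarrow> x \<in> U" "\<And>x. x - q x \<in> U"
    using quotient_map_exists[OF U] by blast
  have qW: "q x \<in> W" if "x \<in> W" for x
    using real_vector.subspace_diff[OF W that, of "x - q x"] q(3) UW by auto
  have 1: "q ` W \<inter> U \<subseteq> {0}"
  proof clarify
    fix x assume "q x \<in> U"
    then have "(x - q x) + q x \<in> U" using q(3) U real_vector.subspace_add by blast
    then show "q x = 0" using q(2) by simp
  qed
  have 2: "ssum U (q ` W) = W"
  proof
    show "ssum U (q ` W) \<subseteq> W" using ssum_subset[OF W UW] qW by blast
    show "W \<subseteq> ssum U (q ` W)"
    proof
      fix x assume "x \<in> W"
      then have "(x - q x) + q x \<in> ssum U (q ` W)" using q(3) by (intro ssumI) auto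
      then show "x \<in> ssum U (q ` W)" by simp
    qed
  qed
  show ?thesis
    by (rule that[OF rsub_image[OF q(1) W] 1 2 fincodim_quotient_map[OF q(1,2) U W UW]])
qed

text \<open>
  Subspaces and quotients of a finite-dimensional quotient are finite dimensional; the
  quotient map by \<open>V\<close> separates the two parts.
\<close>

lemma fincodim_between:
  assumes n: "fincodim U W n" and U: "rsub U" and V: "rsub V" and UV: "U \<subseteq> V" and VW: "V \<subseteq> W"
  shows "\<exists>i j. i + j = n \<and> fincodim U V i \<and> fincodim V W j"
proof -
  have W: "rsub W" using n U fincodim_subspace by blast
  obtain q where q: "linear q" "\<And>x. q x = 0 \<longleftrightarrow> x \<in> V" "\<And>x. x - q x \<in> V"
    using quotient_map_exists[OF V] by blast
  obtain j i where ij: "j + i = n" "fincodim (q ` U) (q ` W) j" "fincodim (nullset q U) (nullset q W) i"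
    using fincodim_image[OF q(1) U n] by blast
  have "q ` U = {0}" using q(2) UV by (intro image_zero[OF U]) auto
  moreover have "nullset q U = U" "nullset q W = V" using q(2) UV VW by auto
  ultimately show ?thesis
    using ij fincodim_quotient_map[OF q(1,2) V W VW] by (metis add.commute)
qed

section \<open>Fredholm maps between subspaces\<close>

text \<open>
  \<open>T : V \<rightarrow> W\<close> has finite-dimensional null space and cokernel, and index \<open>i\<close>. The index is
  part of the relation, so one equivalence of such relations settles both that a map is
  Fredholm and what its index is.
\<close>

definition fredholm_pair :: "('b::real_vector \<Rightarrow> 'c::real_vector) \<Rightarrow> 'b set \<Rightarrow> 'c set \<Rightarrow> int \<Rightarrow> bool" where
  "fredholm_pair T V W i \<longleftrightarrow> (\<exists>k c. fincodim {0} (nullset T V) k \<and> fincodim (T ` V) W c \<and> i = int k - int c)"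

lemma fredholm_pairI: "fincodim {0} (nullset T V) k \<Longrightarrow> fincodim (T ` V) W c \<Longrightarrow> i = int k - int c
  \<Longrightarrow> fredholm_pair T V W i"
  unfolding fredholm_pair_def by blast

lemma fredholm_pairE: assumes "fredholm_pair T V W i"
  obtains k c where "fincodim {0} (nullset T V) k" "fincodim (T ` V) W c" "i = int k - int c"
  using assms unfolding fredholm_pair_def by blast

lemma fredholm_pair_unique:
  "linear T \<Longrightarrow> rsub V \<Longrightarrow> fredholm_pair T V W i \<Longrightarrow> fredholm_pair T V W j \<Longrightarrow> i = j"
  unfolding fredholm_pair_def using fincodim_unique rsub_image fincodim_zero_unique by metis

lemma fredholm_pair_cong:
  "(\<And>x. x \<in> V \<Longrightarrow> T x = S x) \<Longrightarrow> fredholm_pair T V W i = fredholm_pair S V W i"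
proof -
  assume *: "\<And>x. x \<in> V \<Longrightarrow> T x = S x"
  have "nullset T V = nullset S V" "T ` V = S ` V" using * by auto
  then show ?thesis unfolding fredholm_pair_def by simp
qed

text \<open>
  Passing to a subspace of codimension \<open>n\<close> removes \<open>l\<close> dimensions from the null space and
  \<open>n - l\<close> from the range, so the index drops by \<open>n\<close>.
\<close>

lemma fredholm_pair_restrict:
  assumes T: "linear T" and Z: "rsub Z" and Zn: "fincodim Z V n" and W: "rsub W" and TW: "T ` V \<subseteq> W"
  shows "fredholm_pair T V W i \<longleftrightarrow> fredholm_pair T Z W (i - int n)"
proof -
  have V: "rsub V" using fincodim_subspace Z Zn by blast
  have ZV: "Z \<subseteq> V" using fincodim_subset Zn by blast
  obtain j l where jl: "j + l = n" "fincodim (T ` Z) (T ` V) j" "fincodim (nullset T Z) (nullset T V) l"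
    using fincodim_image[OF T Z Zn] by blast
  have n0: "0 \<in> nullset T Z" using rsub_nullset[OF T Z] real_vector.subspace_0 by blast
  show ?thesis
  proof
    assume "fredholm_pair T V W i"
    then obtain k c where kc: "fincodim {0} (nullset T V) k" "fincodim (T ` V) W c" "i = int k - int c"
      by (rule fredholm_pairE)
    obtain a b where ab: "a + b = k" "fincodim {0} (nullset T Z) a" "fincodim (nullset T Z) (nullset T V) b"
      using fincodim_between[OF kc(1) _ rsub_nullset[OF T Z]] n0 ZV by (auto simp: real_vector.subspace_single_0)
    have "b = l" using fincodim_unique[OF rsub_nullset[OF T Z] ab(3) jl(3)] .
    then show "fredholm_pair T Z W (i - int n)"
      by (intro fredholm_pairI[OF ab(2) fincodim_trans[OF kc(2) jl(2)]]) (use ab jl kc in simp)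
  next
    assume "fredholm_pair T Z W (i - int n)"
    then obtain k c where kc: "fincodim {0} (nullset T Z) k" "fincodim (T ` Z) W c" "i - int n = int k - int c"
      by (rule fredholm_pairE)
    obtain a b where ab: "a + b = c" "fincodim (T ` Z) (T ` V) a" "fincodim (T ` V) W b"
      using fincodim_between[OF kc(2) rsub_image[OF T Z] rsub_image[OF T V]] TW ZV by blast
    have "a = j" using fincodim_unique[OF rsub_image[OF T Z] ab(2) jl(2)] .
    then show "fredholm_pair T V W i"
      by (intro fredholm_pairI[OF fincodim_trans[OF jl(3) kc(1)] ab(3)]) (use ab jl kc in simp)
  qed
qed

text \<open>
  \<open>T\<close> and \<open>S\<close> agree on the null space of \<open>T - S\<close>, which has finite codimension.
\<close>

lemma fredholm_pair_perturb:
  assumes T: "linear T" and S: "linear S" and V: "rsub V" and W: "rsub W"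
    and TW: "T ` V \<subseteq> W" and SW: "S ` V \<subseteq> W"
    and fin: "fincodim {0} ((\<lambda>x. T x - S x) ` V) r"
  shows "fredholm_pair T V W i \<longleftrightarrow> fredholm_pair S V W i"
proof -
  define D where "D = (\<lambda>x. T x - S x)"
  have D: "linear D" unfolding D_def using T S by (rule linear_compose_sub)
  define Z where "Z = nullset D V"
  have Z: "rsub Z" unfolding Z_def using rsub_nullset[OF D V] .
  have "D ` Z = {0}" using Z by (intro image_zero) (auto simp: Z_def)
  then have Zn: "fincodim Z V r"
    using fincodim_preimage[OF D Z V] fin unfolding D_def[symmetric] Z_def by auto
  have "fredholm_pair T Z W = fredholm_pair S Z W"
    by (intro ext fredholm_pair_cong) (auto simp: Z_def D_def)
  then show ?thesis
    using fredholm_pair_restrict[OF T Z Zn W TW] fredholm_pair_restrict[OF S Z Zn W SW] by simp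
qed

lemma projection_exists:
  assumes V1: "rsub V1" and V2: "rsub V2" and int: "V1 \<inter> V2 \<subseteq> {0}"
  obtains P where "linear P" "\<And>x. x \<in> V1 \<Longrightarrow> P x = x" "\<And>x. x \<in> V2 \<Longrightarrow> P x = 0"
proof -
  obtain q where q: "linear q" "\<And>x. q x = 0 \<longleftrightarrow> x \<in> V2" "\<And>x. x - q x \<in> V2"
    using quotient_map_exists[OF V2] by blast
  have "inj_on q V1"
    unfolding linear_inj_on_iff_eq_0[OF q(1) V1] using q int by auto
  then obtain g where g: "linear g" "\<And>v. v \<in> V1 \<Longrightarrow> g (q v) = v"
    using linear_exists_left_inverse_on[OF q(1) V1] by blast
  show ?thesis
    by (rule that[of "g \<circ> q"]) (use g q linear_0[OF g(1)] in \<open>auto intro: linear_compose simp: q(2)[THEN iffD2]\<close>)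
qed

lemma fredholm_pair_block:
  assumes T: "linear T" and V1: "rsub V1" and V2: "rsub V2" and W1: "rsub W1" and W2: "rsub W2"
    and V0: "V1 \<inter> V2 \<subseteq> {0}" and W0: "W1 \<inter> W2 \<subseteq> {0}"
    and T1: "T ` V1 \<subseteq> W1" and T2: "T ` V2 \<subseteq> W2"
  shows "fredholm_pair T (ssum V1 V2) (ssum W1 W2) i \<longleftrightarrow>
    (\<exists>i1 i2. fredholm_pair T V1 W1 i1 \<and> fredholm_pair T V2 W2 i2 \<and> i = i1 + i2)"
proof -
  have z: "rsub {0}" by (simp add: real_vector.subspace_single_0)
  have TV1: "rsub (T ` V1)" and TV2: "rsub (T ` V2)" using rsub_image[OF T] V1 V2 by auto
  have N1: "rsub (nullset T V1)" and N2: "rsub (nullset T V2)" using rsub_nullset[OF T] V1 V2 by auto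
  have im: "T ` ssum V1 V2 = ssum (T ` V1) (T ` V2)" using T by (rule image_ssum)
  have ker: "nullset T (ssum V1 V2) = ssum (nullset T V1) (nullset T V2)"
  proof (intro equalityI subsetI)
    fix x assume "x \<in> nullset T (ssum V1 V2)"
    then obtain a b where ab: "a \<in> V1" "b \<in> V2" "x = a + b" "T x = 0" by (auto elim: ssumE)
    have "T a = T (- b)" using ab T by (simp add: linear_add linear_neg eq_neg_iff_add_eq_0)
    moreover have "T (- b) \<in> W2" using ab T2 V2 by (auto simp: rsub_simps image_subset_iff)
    ultimately have "T a \<in> W1 \<inter> W2" using ab T1 by (auto simp: image_subset_iff)
    then have "T a = 0" using W0 by blast
    then have "T b = 0" using ab T by (simp add: linear_add)
    then show "x \<in> ssum (nullset T V1) (nullset T V2)" using ab \<open>T a = 0\<close> by (auto intro: ssumI)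
  next
    fix x assume "x \<in> ssum (nullset T V1) (nullset T V2)"
    then show "x \<in> nullset T (ssum V1 V2)" using T by (auto elim!: ssumE intro: ssumI simp: linear_add)
  qed
  have zz: "W1 \<inter> T ` V2 \<subseteq> T ` V1" "W1 \<inter> T ` V2 \<subseteq> {0}" "W2 \<inter> W1 \<subseteq> T ` V2"
  proof -
    show 0: "W1 \<inter> T ` V2 \<subseteq> {0}" by (rule order.trans[OF Int_mono[OF subset_refl T2] W0])
    have "{0} \<subseteq> T ` V1" "{0} \<subseteq> T ` V2" using real_vector.subspace_0 TV1 TV2 by auto
    then show "W1 \<inter> T ` V2 \<subseteq> T ` V1" "W2 \<inter> W1 \<subseteq> T ` V2"
      using 0 W0 by (simp_all only: Int_commute[of W2])
  qed
  have sum: "fredholm_pair T (ssum V1 V2) (ssum W1 W2) (i1 + i2)"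
    if f1: "fredholm_pair T V1 W1 i1" and f2: "fredholm_pair T V2 W2 i2" for i1 i2
  proof -
    obtain k1 c1 where kc1: "fincodim {0} (nullset T V1) k1" "fincodim (T ` V1) W1 c1" "i1 = int k1 - int c1"
      using f1 by (rule fredholm_pairE)
    obtain k2 c2 where kc2: "fincodim {0} (nullset T V2) k2" "fincodim (T ` V2) W2 c2" "i2 = int k2 - int c2"
      using f2 by (rule fredholm_pairE)
    have "fincodim (nullset T V1) (ssum (nullset T V1) (nullset T V2)) k2"
      using fincodim_complement[OF N1 N2 kc2(1)] V0 by auto
    then have 1: "fincodim {0} (ssum (nullset T V1) (nullset T V2)) (k1 + k2)"
      using fincodim_trans kc1(1) by blast
    have "fincodim (ssum (T ` V2) (T ` V1)) (ssum (T ` V2) W1) c1"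
      by (rule fincodim_ssum[OF kc1(2) TV2 TV1 zz(1)])
    moreover have "fincodim (ssum W1 (T ` V2)) (ssum W1 W2) c2"
      by (rule fincodim_ssum[OF kc2(2) W1 TV2 zz(3)])
    ultimately have "fincodim (ssum (T ` V1) (T ` V2)) (ssum W1 W2) (c1 + c2)"
      using fincodim_trans by (metis ssum_commute)
    then show ?thesis
      unfolding fredholm_pair_def im ker using 1 kc1(3) kc2(3)
      by (intro exI[of _ "k1 + k2"] exI[of _ "c1 + c2"]) simp
  qed
  show ?thesis
  proof
    assume "\<exists>i1 i2. fredholm_pair T V1 W1 i1 \<and> fredholm_pair T V2 W2 i2 \<and> i = i1 + i2"
    then show "fredholm_pair T (ssum V1 V2) (ssum W1 W2) i" using sum by blast
  next
    assume "fredholm_pair T (ssum V1 V2) (ssum W1 W2) i"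
    note fi = this
    then obtain k c where kc: "fincodim {0} (ssum (nullset T V1) (nullset T V2)) k"
      "fincodim (ssum (T ` V1) (T ` V2)) (ssum W1 W2) c"
      unfolding fredholm_pair_def im ker by blast
    \<comment> \<open>Projecting \<open>W\<close> onto one summand splits the cokernel.\<close>
    have pr: "\<exists>c. fincodim (T ` A) B c" if
      A: "rsub A" and A': "rsub A'" and B: "rsub B" and B': "rsub B'" and BB: "B \<inter> B' \<subseteq> {0}"
      and TA: "T ` A \<subseteq> B" and TA': "T ` A' \<subseteq> B'"
      and c: "fincodim (ssum (T ` A) (T ` A')) (ssum B B') c" for A A' B B' c
    proof -
      obtain P where P: "linear P" "\<And>x. x \<in> B \<Longrightarrow> P x = x" "\<And>x. x \<in> B' \<Longrightarrow> P x = 0"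
        using projection_exists[OF B B' BB] by blast
      have i1: "P ` X = X" if "X \<subseteq> B" for X using P(2) that by force
      have i2: "P ` X = {0}" if "rsub X" "X \<subseteq> B'" for X
        using P(3) that by (intro image_zero) auto
      have "\<exists>j. fincodim (P ` ssum (T ` A) (T ` A')) (P ` ssum B B') j"
        using fincodim_image[OF P(1) rsub_ssum[OF rsub_image[OF T A] rsub_image[OF T A']] c] by blast
      then show ?thesis
        unfolding image_ssum[OF P(1)] i1[OF TA] i1[OF subset_refl] i2[OF rsub_image[OF T A'] TA']
          i2[OF B' subset_refl] ssum_zero .
    qed
    obtain c1 where c1: "fincodim (T ` V1) W1 c1" using pr[OF V1 V2 W1 W2 W0 T1 T2 kc(2)] by blast
    have "W2 \<inter> W1 \<subseteq> {0}" using W0 by blast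
    then obtain c2 where c2: "fincodim (T ` V2) W2 c2"
      using pr[OF V2 V1 W2 W1 _ T2 T1] kc(2) by (metis ssum_commute)
    have n12: "{0} \<subseteq> nullset T V1" "{0} \<subseteq> nullset T V2"
      using N1 N2 real_vector.subspace_0 by auto
    obtain k1 where k1: "fincodim {0} (nullset T V1) k1"
      using fincodim_between[OF kc(1) z N1 n12(1) ssum_left[OF N2]] by blast
    obtain k2 where k2: "fincodim {0} (nullset T V2) k2"
      using fincodim_between[OF kc(1) z N2 n12(2) ssum_right[OF N1]] by blast
    have f: "fredholm_pair T V1 W1 (int k1 - int c1)" "fredholm_pair T V2 W2 (int k2 - int c2)"
      using fredholm_pairI[OF k1 c1 HOL.refl] fredholm_pairI[OF k2 c2 HOL.refl] .
    then show "\<exists>i1 i2. fredholm_pair T V1 W1 i1 \<and> fredholm_pair T V2 W2 i2 \<and> i = i1 + i2"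
      using fredholm_pair_unique[OF T rsub_ssum[OF V1 V2] fi sum[OF f]] by blast
  qed
qed

section \<open>Real Hilbert spaces\<close>

text \<open>
  A subspace of a real vector space with an inner product in which it is complete; \<open>ip\<close> is
  arbitrary outside \<open>X\<close>. Squared norms avoid square roots.
\<close>

locale real_hilbert =
  fixes X :: "'b::real_vector set" and ip :: "'b \<Rightarrow> 'b \<Rightarrow> real"
  assumes sub: "rsub X"
    and add_left: "\<lbrakk>x \<in> X; y \<in> X; z \<in> X\<rbrakk> \<Longrightarrow> ip (x + y) z = ip x z + ip y z"
    and scale_left: "\<lbrakk>x \<in> X; y \<in> X\<rbrakk> \<Longrightarrow> ip (r *\<^sub>R x) y = r * ip x y"
    and sym: "\<lbrakk>x \<in> X; y \<in> X\<rbrakk> \<Longrightarrow> ip x y = ip y x"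
    and pos: "\<lbrakk>x \<in> X; x \<noteq> 0\<rbrakk> \<Longrightarrow> 0 < ip x x"
    and complete: "\<lbrakk>\<forall>i. f i \<in> X; \<forall>e>0. \<exists>N. \<forall>i\<ge>N. \<forall>j\<ge>N. ip (f i - f j) (f i - f j) < e\<rbrakk>
        \<Longrightarrow> \<exists>l\<in>X. (\<lambda>i::nat. ip (f i - l) (f i - l)) \<longlonglongrightarrow> 0"
begin

lemma mem [simp, intro]:
  "0 \<in> X" "\<lbrakk>x \<in> X; y \<in> X\<rbrakk> \<Longrightarrow> x + y \<in> X" "\<lbrakk>x \<in> X; y \<in> X\<rbrakk> \<Longrightarrow> x - y \<in> X"
  "x \<in> X \<Longrightarrow> r *\<^sub>R x \<in> X" "x \<in> X \<Longrightarrow> - x \<in> X"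
  using sub by (auto intro: rsub_simps)

lemma add_right: "\<lbrakk>x \<in> X; y \<in> X; z \<in> X\<rbrakk> \<Longrightarrow> ip z (x + y) = ip z x + ip z y"
  by (metis add_left sym mem(2))

lemma scale_right: "\<lbrakk>x \<in> X; y \<in> X\<rbrakk> \<Longrightarrow> ip y (r *\<^sub>R x) = r * ip y x"
  by (metis scale_left sym mem(4))

lemma zero_left [simp]: "x \<in> X \<Longrightarrow> ip 0 x = 0"
  using scale_left[of 0 x 0] by simp

lemma zero_right [simp]: "x \<in> X \<Longrightarrow> ip x 0 = 0"
  using scale_right[of 0 x 0] by simp

lemma neg_left: "\<lbrakk>x \<in> X; y \<in> X\<rbrakk> \<Longrightarrow> ip (- x) y = - ip x y"
  using scale_left[of x y "-1"] by simp

lemma neg_right: "\<lbrakk>x \<in> X; y \<in> X\<rbrakk> \<Longrightarrow> ip x (- y) = - ip x y"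
  using scale_right[of y x "-1"] by simp

lemma diff_left: "\<lbrakk>x \<in> X; y \<in> X; z \<in> X\<rbrakk> \<Longrightarrow> ip (x - y) z = ip x z - ip y z"
  using add_left[of x "- y" z] neg_left[of y z] by simp

lemma diff_right: "\<lbrakk>x \<in> X; y \<in> X; z \<in> X\<rbrakk> \<Longrightarrow> ip z (x - y) = ip z x - ip z y"
  using add_right[of x "- y" z] neg_right[of z y] by simp

lemmas ip_simps = add_left add_right diff_left diff_right scale_left scale_right

lemma nonneg: "x \<in> X \<Longrightarrow> 0 \<le> ip x x"
  using pos[of x] by (cases "x = 0") auto

lemma eq_0: "x \<in> X \<Longrightarrow> ip x x = 0 \<longleftrightarrow> x = 0"
  using pos[of x] by (metis order.irrefl zero_left)

lemma Cauchy_Schwarz: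
  assumes x: "x \<in> X" and y: "y \<in> X" shows "(ip x y)\<^sup>2 \<le> ip x x * ip y y"
proof (cases "y = 0")
  case False
  then have p: "0 < ip y y" using pos y by simp
  define t where "t = ip x y / ip y y"
  have "0 \<le> ip (x - t *\<^sub>R y) (x - t *\<^sub>R y)" using nonneg x y by simp
  also have "\<dots> = ip x x - t * ip x y - t * (ip x y - t * ip y y)"
    using x y sym[of y x] by (simp add: ip_simps)
  also have "\<dots> = ip x x - (ip x y)\<^sup>2 / ip y y"
    using p by (simp add: t_def power2_eq_square)
  finally show ?thesis using p by (simp add: field_simps)
qed (use x in simp)

lemma sq_add: "\<lbrakk>a \<in> X; b \<in> X\<rbrakk> \<Longrightarrow> ip (a + b) (a + b) = ip a a + 2 * ip a b + ip b b"
  using sym[of b a] by (simp add: ip_simps)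

lemma sq_diff: "\<lbrakk>a \<in> X; b \<in> X\<rbrakk> \<Longrightarrow> ip (a - b) (a - b) = ip a a - 2 * ip a b + ip b b"
  using sym[of b a] by (simp add: ip_simps)

lemma sq_scale: "a \<in> X \<Longrightarrow> ip (r *\<^sub>R a) (r *\<^sub>R a) = r\<^sup>2 * ip a a"
  by (simp add: ip_simps power2_eq_square)

lemma parallelogram:
  "\<lbrakk>a \<in> X; b \<in> X\<rbrakk> \<Longrightarrow>
    ip (b - a) (b - a) + 4 * ip ((1/2) *\<^sub>R (a + b)) ((1/2) *\<^sub>R (a + b)) = 2 * ip a a + 2 * ip b b"
  using sym[of b a] sq_scale[of "a + b" "1/2"] sq_add[of a b] sq_diff[of b a]
  by (simp add: power2_eq_square del: scaleR_add_right)

definition nrm :: "'b \<Rightarrow> real" where "nrm x = sqrt (ip x x)"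

lemma nrm_nonneg [simp]: "x \<in> X \<Longrightarrow> 0 \<le> nrm x"
  unfolding nrm_def using nonneg by simp

lemma nrm_sq: "x \<in> X \<Longrightarrow> (nrm x)\<^sup>2 = ip x x"
  unfolding nrm_def using nonneg by simp

lemma ip_le: "\<lbrakk>x \<in> X; y \<in> X\<rbrakk> \<Longrightarrow> \<bar>ip x y\<bar> \<le> nrm x * nrm y"
  unfolding nrm_def using Cauchy_Schwarz[of x y]
  by (metis real_sqrt_abs real_sqrt_le_iff real_sqrt_mult)

lemma nrm_triangle: "\<lbrakk>x \<in> X; y \<in> X\<rbrakk> \<Longrightarrow> nrm (x + y) \<le> nrm x + nrm y"
proof -
  assume x: "x \<in> X" and y: "y \<in> X"
  have "ip (x + y) (x + y) = ip x x + 2 * ip x y + ip y y"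
    using x y by (rule sq_add)
  also have "\<dots> \<le> (nrm x + nrm y)\<^sup>2"
    using ip_le[OF x y] nrm_sq[OF x] nrm_sq[OF y] by (simp add: power2_sum abs_le_iff)
  finally show ?thesis unfolding nrm_def[of "x + y"] using x y by (intro real_le_lsqrt) auto
qed

lemma nrm_scale: "x \<in> X \<Longrightarrow> nrm (r *\<^sub>R x) = \<bar>r\<bar> * nrm x"
  unfolding nrm_def by (simp add: ip_simps real_sqrt_mult flip: power2_eq_square mult.assoc)

lemma nrm_minus_commute: "\<lbrakk>x \<in> X; y \<in> X\<rbrakk> \<Longrightarrow> nrm (x - y) = nrm (y - x)"
  unfolding nrm_def using sym[of y x] by (simp add: ip_simps)

lemma tendsto_nrm: "(\<lambda>i. ip (f i - l) (f i - l)) \<longlonglongrightarrow> 0 \<Longrightarrow> (\<lambda>i. nrm (f i - l)) \<longlonglongrightarrow> 0"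
  unfolding nrm_def using tendsto_real_sqrt by fastforce

lemma tendsto_ip:
  assumes f: "\<And>i. f i \<in> X" and l: "l \<in> X" and y: "y \<in> X"
    and lim: "(\<lambda>i. ip (f i - l) (f i - l)) \<longlonglongrightarrow> 0"
  shows "(\<lambda>i. ip (f i) y) \<longlonglongrightarrow> ip l y"
proof -
  have "(\<lambda>i. nrm (f i - l) * nrm y) \<longlonglongrightarrow> 0 * nrm y"
    by (intro tendsto_mult_right tendsto_nrm lim)
  then have "(\<lambda>i. nrm (f i - l) * nrm y) \<longlonglongrightarrow> 0" by simp
  then have "(\<lambda>i. ip (f i) y - ip l y) \<longlonglongrightarrow> 0"
  proof (rule Lim_null_comparison[rotated])
    show "\<forall>\<^sub>F i in sequentially. norm (ip (f i) y - ip l y) \<le> nrm (f i - l) * nrm y"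
      using ip_le[of "f _ - l" y] f l y by (intro always_eventually) (simp add: diff_left)
  qed
  then show ?thesis by (simp add: LIM_zero_iff)
qed

definition perp :: "'b set \<Rightarrow> 'b set" where
  "perp M = {x\<in>X. \<forall>m\<in>M. ip x m = 0}"

lemma rsub_perp: "M \<subseteq> X \<Longrightarrow> rsub (perp M)"
  unfolding perp_def by (auto simp: real_vector.subspace_def ip_simps subset_iff)

lemma perp_subset: "perp M \<subseteq> X"
  unfolding perp_def by blast

lemma perp_Int: "M \<subseteq> X \<Longrightarrow> M \<inter> perp M \<subseteq> {0}"
  unfolding perp_def using eq_0 by blast

lemma eq_if_ip:
  assumes "x \<in> X" "y \<in> X" "\<And>z. z \<in> X \<Longrightarrow> ip x z = ip y z" shows "x = y"
  using assms(3)[of "x - y"] eq_0[of "x - y"] assms(1,2) by (simp add: diff_left)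

lemma closed_subspace:
  assumes "rsub M" "M \<subseteq> X"
    and cl: "\<And>f l. \<lbrakk>\<And>i. f i \<in> M; l \<in> X; (\<lambda>i. ip (f i - l) (f i - l)) \<longlonglongrightarrow> 0\<rbrakk> \<Longrightarrow> l \<in> M"
  shows "real_hilbert M ip"
proof
  fix f :: "nat \<Rightarrow> 'b"
  assume f: "\<forall>i. f i \<in> M" and c: "\<forall>e>0. \<exists>N. \<forall>i\<ge>N. \<forall>j\<ge>N. ip (f i - f j) (f i - f j) < e"
  then have fX: "\<forall>i. f i \<in> X" using assms(2) by blast
  obtain l where l: "l \<in> X" "(\<lambda>i. ip (f i - l) (f i - l)) \<longlonglongrightarrow> 0" using complete[OF fX c] by blast
  have "l \<in> M" using cl[OF _ l] f by blast
  then show "\<exists>l\<in>M. (\<lambda>i. ip (f i - l) (f i - l)) \<longlonglongrightarrow> 0" using l by blast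
qed (use assms(1,2) in \<open>auto simp: subset_iff ip_simps sym pos\<close>)

lemma real_hilbert_perp: assumes "M \<subseteq> X" shows "real_hilbert (perp M) ip"
proof (rule closed_subspace[OF rsub_perp[OF assms] perp_subset])
  fix f l assume f: "\<And>i. f i \<in> perp M" "l \<in> X" "(\<lambda>i. ip (f i - l) (f i - l)) \<longlonglongrightarrow> 0"
  have "ip l m = 0" if "m \<in> M" for m
  proof -
    have 0: "ip (f i) m = 0" for i using f that unfolding perp_def by blast
    have "(\<lambda>i. ip (f i) m) \<longlonglongrightarrow> ip l m" using f(1) perp_subset that assms by (intro tendsto_ip f(2,3)) blast+
    then have "(\<lambda>i. 0) \<longlonglongrightarrow> ip l m" unfolding 0 .
    then show ?thesis using LIMSEQ_unique tendsto_const by blast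
  qed
  then show "l \<in> perp M" using f unfolding perp_def by blast
qed

text \<open>
  The component in \<open>M\<close> of a vector is the point of \<open>M\<close> closest to it.
\<close>

lemma orthogonal_decomposition:
  assumes M: "real_hilbert M ip" and MX: "M \<subseteq> X"
  shows "ssum M (perp M) = X"
proof
  interpret M: real_hilbert M ip by fact
  show "ssum M (perp M) \<subseteq> X" using ssum_subset[OF sub MX perp_subset] .
  show "X \<subseteq> ssum M (perp M)"
  proof
    fix x assume x: "x \<in> X"
    define q where "q m = ip (x - m) (x - m)" for m
    define d where "d = Inf (q ` M)"
    have q0: "0 \<le> q m" if "m \<in> M" for m unfolding q_def using nonneg x MX that by auto
    then have bdd: "bdd_below (q ` M)" by (intro bdd_belowI[of _ 0]) auto
    have dq: "d \<le> q m" if "m \<in> M" for m unfolding d_def using bdd that by (simp add: cINF_lower)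
    have "\<exists>m\<in>M. q m < d + 1 / real (Suc i)" for i
    proof -
      have "q ` M \<noteq> {}" using M.mem(1) by blast
      then show ?thesis using cInf_lessD[of "q ` M" "d + 1 / real (Suc i)"] unfolding d_def by auto
    qed
    then obtain f where f: "\<And>i. f i \<in> M" "\<And>i. q (f i) < d + 1 / real (Suc i)" by metis
    have fX: "f i \<in> X" for i using f MX by blast
    \<comment> \<open>The parallelogram law makes a minimizing sequence Cauchy.\<close>
    have par: "ip (f i - f j) (f i - f j) \<le> 2 / real (Suc i) + 2 / real (Suc j)" for i j
    proof -
      define c where "c = (1/2) *\<^sub>R (f i + f j)"
      have c: "c \<in> M" "c \<in> X" unfolding c_def using f fX by auto
      have "ip (f i - f j) (f i - f j) + 4 * q c = 2 * q (f i) + 2 * q (f j)"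
      proof -
        have "(x - f j) - (x - f i) = f i - f j" by simp
        moreover have "(1/2) *\<^sub>R ((x - f i) + (x - f j)) = x - c"
          unfolding c_def by (simp add: algebra_simps flip: scaleR_2)
        ultimately show ?thesis
          unfolding q_def using parallelogram[of "x - f i" "x - f j"] x fX[of i] fX[of j] by simp
      qed
      then show ?thesis using dq[OF c(1)] f(2)[of i] f(2)[of j] by simp
    qed
    have "\<forall>e>0. \<exists>N. \<forall>i\<ge>N. \<forall>j\<ge>N. ip (f i - f j) (f i - f j) < e"
    proof (intro allI impI)
      fix e :: real assume "0 < e"
      then obtain N where N: "1 / real (Suc N) < e / 4"
        using nat_approx_posE[of "e/4"] by auto
      have "ip (f i - f j) (f i - f j) < e" if "i \<ge> N" "j \<ge> N" for i j
      proof -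
        have "1 / real (Suc i) \<le> 1 / real (Suc N)" "1 / real (Suc j) \<le> 1 / real (Suc N)"
          using that by (auto intro!: divide_left_mono)
        then show ?thesis using par[of i j] N by simp
      qed
      then show "\<exists>N. \<forall>i\<ge>N. \<forall>j\<ge>N. ip (f i - f j) (f i - f j) < e" by blast
    qed
    then obtain l where l: "l \<in> M" "(\<lambda>i. ip (f i - l) (f i - l)) \<longlonglongrightarrow> 0"
      using M.complete f by blast
    have lX: "l \<in> X" using l MX by blast
    have "(\<lambda>i. q (f i)) \<longlonglongrightarrow> d"
    proof (rule tendsto_sandwich[of "\<lambda>_. d" _ _ "\<lambda>i. d + 1 / real (Suc i)"])
      show "(\<lambda>i. d + 1 / real (Suc i)) \<longlonglongrightarrow> d"
        using tendsto_add[OF tendsto_const[of d] LIMSEQ_inverse_real_of_nat] by (simp add: divide_inverse)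
    qed (auto intro!: always_eventually dq f(1) less_imp_le[OF f(2)] simp del: of_nat_Suc)
    moreover have "(\<lambda>i. q (f i)) \<longlonglongrightarrow> q l"
    proof -
      have "q (f i) = q l - 2 * (ip (f i) (x - l) - ip l (x - l)) + ip (f i - l) (f i - l)" for i
        using sq_diff[of "x - l" "f i - l"] x fX[of i] lX sym[of "f i - l" "x - l"]
        unfolding q_def by (simp add: diff_left)
      moreover have "(\<lambda>i. q l - 2 * (ip (f i) (x - l) - ip l (x - l)) + ip (f i - l) (f i - l))
        \<longlonglongrightarrow> q l - 2 * (ip l (x - l) - ip l (x - l)) + 0"
        by (intro tendsto_intros tendsto_ip l(2) fX lX) (use x lX in auto)
      ultimately show ?thesis by simp
    qed
    ultimately have dl: "q l = d" using LIMSEQ_unique by blast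
    have "x - l \<in> perp M"
      unfolding perp_def
    proof (intro CollectI conjI ballI)
      show "x - l \<in> X" using x lX by blast
      fix u assume u: "u \<in> M"
      then have uX: "u \<in> X" using MX by blast
      show "ip (x - l) u = 0"
      proof (cases "u = 0")
        case False
        then have p: "0 < ip u u" using pos uX by blast
        \<comment> \<open>Moving \<open>l\<close> in the direction \<open>u\<close> by this optimal amount would bring it closer to \<open>x\<close>.\<close>
        define t where "t = ip (x - l) u / ip u u"
        have "q l \<le> q (l + t *\<^sub>R u)" using dq dl l(1) u by simp
        also have "\<dots> = q l - 2 * t * ip (x - l) u + t * t * ip u u"
          using sq_diff[of "x - l" "t *\<^sub>R u"] x lX uX
          unfolding q_def by (simp add: scale_right scale_left sq_scale power2_eq_square diff_diff_eq)
        also have "\<dots> = q l - (ip (x - l) u)\<^sup>2 / ip u u"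
          unfolding t_def using p by (simp add: power2_eq_square field_simps)
        finally have "(ip (x - l) u)\<^sup>2 / ip u u \<le> 0" by simp
        then show ?thesis using p by (simp add: divide_le_0_iff)
      qed (use x lX in auto)
    qed
    then have "l + (x - l) \<in> ssum M (perp M)" using l by (intro ssumI)
    then show "x \<in> ssum M (perp M)" by simp
  qed
qed

text \<open>
  The representing vector is orthogonal to the null space of \<open>f\<close>, which has codimension at
  most one.
\<close>

lemma Riesz:
  assumes add: "\<And>x y. \<lbrakk>x \<in> X; y \<in> X\<rbrakk> \<Longrightarrow> f (x + y) = f x + f y"
    and scale: "\<And>r x. x \<in> X \<Longrightarrow> f (r *\<^sub>R x) = r * f x"
    and bounded: "\<And>x. x \<in> X \<Longrightarrow> \<bar>f x\<bar> \<le> C * nrm x"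
  shows "\<exists>z\<in>X. \<forall>x\<in>X. f x = ip x z"
proof (cases "\<forall>x\<in>X. f x = 0")
  case True
  then show ?thesis by (intro bexI[of _ 0]) auto
next
  case False
  then obtain x0 where x0: "x0 \<in> X" "f x0 \<noteq> 0" by blast
  define M where "M = {x\<in>X. f x = 0}"
  have f0: "f 0 = 0" using scale[of 0 0] by simp
  have diff: "f (x - y) = f x - f y" if "x \<in> X" "y \<in> X" for x y
    using add[of x "- y"] scale[of y "-1"] that by simp
  have Ms: "rsub M" unfolding M_def using f0 add scale by (auto simp: real_vector.subspace_def)
  have MX: "M \<subseteq> X" unfolding M_def by blast
  have "real_hilbert M ip"
  proof (rule closed_subspace[OF Ms MX])
    fix g l assume g: "\<And>i. g i \<in> M" and l: "l \<in> X" "(\<lambda>i. ip (g i - l) (g i - l)) \<longlonglongrightarrow> 0"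
    have gX: "g i \<in> X" for i using g MX by blast
    have "(\<lambda>i. C * nrm (g i - l)) \<longlonglongrightarrow> C * 0" by (intro tendsto_intros tendsto_nrm l)
    then have "(\<lambda>i. C * nrm (g i - l)) \<longlonglongrightarrow> 0" by simp
    then have "(\<lambda>i. f (g i - l)) \<longlonglongrightarrow> 0"
      by (rule Lim_null_comparison[rotated]) (use bounded gX l in \<open>auto intro!: always_eventually\<close>)
    moreover have "f (g i - l) = - f l" for i using g gX l diff unfolding M_def by simp
    ultimately have "(\<lambda>i. - f l) \<longlonglongrightarrow> 0" by simp
    then have "- f l = 0" using LIMSEQ_unique tendsto_const by blast
    then show "l \<in> M" unfolding M_def using l by simp
  qed
  from orthogonal_decomposition[OF this MX] have "x0 \<in> ssum M (perp M)" using x0 by simp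
  then obtain m w where mw: "m \<in> M" "w \<in> perp M" "x0 = m + w" by (rule ssumE)
  have wX: "w \<in> X" and fm: "m \<in> X" "f m = 0" using mw perp_subset unfolding M_def by auto
  have fw: "f w \<noteq> 0" using x0 mw fm add wX by simp
  then have w0: "w \<noteq> 0" using f0 by auto
  then have p: "0 < ip w w" using pos wX by simp
  show ?thesis
  proof (intro bexI[of _ "(f w / ip w w) *\<^sub>R w"] ballI)
    fix x assume x: "x \<in> X"
    define k where "k = x - (f x / f w) *\<^sub>R w"
    have "f k = 0" unfolding k_def using x wX fw by (simp add: diff scale)
    then have "k \<in> M" unfolding M_def k_def using x wX by simp
    then have "ip w k = 0" using mw unfolding perp_def by blast
    then have "ip w x = (f x / f w) * ip w w" unfolding k_def using x wX by (simp add: ip_simps)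
    then show "f x = ip x ((f w / ip w w) *\<^sub>R w)"
      using x wX p fw sym[of x w] by (simp add: ip_simps)
  qed (use wX in simp)
qed

end

section \<open>Uniform boundedness and adjoints of Fredholm maps\<close>

context real_hilbert
begin

text \<open>
  A gliding hump. If \<open>B\<close> is unbounded, take \<open>Y n \<in> B\<close> with \<open>\<parallel>Y n\<parallel> > 8^n\<close> and move from \<open>x n\<close> by a
  step of length \<open>4^-n\<close> along \<open>Y n\<close>, with the sign for which \<open>\<bar>\<langle>Y n, x (n+1)\<rangle>\<bar> \<ge> 4^-n \<parallel>Y n\<parallel>\<close>. The
  later steps have total length at most \<open>4^-n / 3\<close> and cannot undo this, so the limit \<open>l\<close>
  satisfies \<open>\<bar>\<langle>Y n, l\<rangle>\<bar> \<ge> (2/3) 2^n\<close>.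
\<close>

lemma uniform_boundedness:
  assumes BX: "B \<subseteq> X" and bd: "\<And>z. z \<in> X \<Longrightarrow> \<exists>K. \<forall>y\<in>B. \<bar>ip y z\<bar> \<le> K"
  shows "\<exists>K. \<forall>y\<in>B. ip y y \<le> K"
proof (rule ccontr)
  assume "\<not> ?thesis"
  then have "\<exists>y\<in>B. (8 ^ n)\<^sup>2 < ip y y" for n :: nat by (auto simp: not_le)
  then obtain Y where Y: "\<And>n. Y n \<in> B" "\<And>n. (8 ^ n)\<^sup>2 < ip (Y n) (Y n)" by metis
  have YX: "Y n \<in> X" for n using Y BX by blast
  have Yn: "8 ^ n < nrm (Y n)" for n
    unfolding nrm_def using Y(2)[of n] by (rule real_less_rsqrt)
  have Ypos: "0 < nrm (Y n)" for n using Yn[of n] by (rule less_trans[rotated]) simp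
  define r where "r n = (1 / 4 :: real) ^ n" for n
  have r0: "0 < r n" for n unfolding r_def by simp
  define h where "h n = (r n / nrm (Y n)) *\<^sub>R Y n" for n
  have hX: "h n \<in> X" for n unfolding h_def using YX by simp
  have nh: "nrm (h n) = r n" for n
    unfolding h_def using Ypos[of n] r0[of n] YX by (simp add: nrm_scale)
  have ih: "ip (Y n) (h n) = r n * nrm (Y n)" for n
    unfolding h_def using Ypos[of n] YX nrm_sq[OF YX, of n] by (simp add: scale_right power2_eq_square field_simps)
  define x where "x = rec_nat 0 (\<lambda>n z. if r n * nrm (Y n) \<le> \<bar>ip (Y n) (z + h n)\<bar> then z + h n else z - h n)"
  have x0: "x 0 = 0" and xS: "x (Suc n) = (if r n * nrm (Y n) \<le> \<bar>ip (Y n) (x n + h n)\<bar> then x n + h n else x n - h n)" for n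
    unfolding x_def by simp_all
  have xX: "x n \<in> X" for n by (induction n) (simp_all add: x0 xS hX)
  have big: "r n * nrm (Y n) \<le> \<bar>ip (Y n) (x (Suc n))\<bar>" for n
  proof (cases "r n * nrm (Y n) \<le> \<bar>ip (Y n) (x n + h n)\<bar>")
    case False
    then have "\<bar>ip (Y n) (x n) + r n * nrm (Y n)\<bar> < r n * nrm (Y n)"
      using YX xX hX by (simp add: add_right ih)
    then have "r n * nrm (Y n) \<le> \<bar>ip (Y n) (x n) - r n * nrm (Y n)\<bar>" by linarith
    then show ?thesis using False YX xX hX by (simp add: xS diff_right ih)
  qed (simp add: xS)
  have step: "nrm (x (Suc n) - x n) = r n" for n
    using nh[of n] nrm_scale[OF hX, of "-1" n] by (simp add: xS)
  have dist: "nrm (x (n + k) - x n) \<le> 4 / 3 * (r n - r (n + k))" for n k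
  proof (induction k)
    case (Suc k)
    have "nrm (x (n + Suc k) - x n) \<le> nrm (x (Suc (n + k)) - x (n + k)) + nrm (x (n + k) - x n)"
      using nrm_triangle[of "x (Suc (n + k)) - x (n + k)" "x (n + k) - x n"] xX by simp
    also have "\<dots> \<le> r (n + k) + 4 / 3 * (r n - r (n + k))" using Suc step by simp
    also have "\<dots> = 4 / 3 * (r n - r (n + Suc k))" unfolding r_def by (simp add: field_simps)
    finally show ?case .
  qed (simp add: nrm_def)
  have dist': "nrm (x m - x n) \<le> 4 / 3 * r n" if "n \<le> m" for m n
    using dist[of n "m - n"] r0[of m] that by simp
  have "\<exists>l\<in>X. (\<lambda>i. ip (x i - l) (x i - l)) \<longlonglongrightarrow> 0"
  proof (rule complete)
    show "\<forall>i. x i \<in> X" using xX by blast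
    show "\<forall>e>0. \<exists>N. \<forall>i\<ge>N. \<forall>j\<ge>N. ip (x i - x j) (x i - x j) < e"
    proof (intro allI impI)
      fix e :: real assume e: "0 < e"
      then obtain N where N: "r N < sqrt e * 3 / 8"
        using real_arch_pow_inv[of "sqrt e * 3 / 8" "1/4"] unfolding r_def by auto
      have "ip (x i - x j) (x i - x j) < e" if "N \<le> i" "N \<le> j" for i j
      proof -
        have "nrm (x i - x j) \<le> nrm (x i - x N) + nrm (x N - x j)"
          using nrm_triangle[of "x i - x N" "x N - x j"] xX by simp
        also have "\<dots> \<le> 8 / 3 * r N"
          using dist'[OF that(1)] dist'[OF that(2)] nrm_minus_commute[OF xX xX, of N j] by simp
        also have "\<dots> < sqrt e" using N by simp
        finally show ?thesis unfolding nrm_def by simp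
      qed
      then show "\<exists>N. \<forall>i\<ge>N. \<forall>j\<ge>N. ip (x i - x j) (x i - x j) < e" by blast
    qed
  qed
  then obtain l where l: "l \<in> X" "(\<lambda>i. ip (x i - l) (x i - l)) \<longlonglongrightarrow> 0" by blast
  have near: "nrm (l - x n) \<le> 4 / 3 * r n" for n
  proof -
    have "(\<lambda>i. nrm (x i - l) + 4 / 3 * r n) \<longlonglongrightarrow> 0 + 4 / 3 * r n"
      by (intro tendsto_add tendsto_const tendsto_nrm l(2))
    moreover have "nrm (l - x n) \<le> nrm (x i - l) + 4 / 3 * r n" if "n \<le> i" for i
    proof -
      have "nrm (l - x n) \<le> nrm (l - x i) + nrm (x i - x n)"
        using nrm_triangle[of "l - x i" "x i - x n"] xX l by simp
      then show ?thesis
        using dist'[OF that] nrm_minus_commute[OF xX l(1), of i] by simp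
    qed
    ultimately have "nrm (l - x n) \<le> 0 + 4 / 3 * r n" by (blast intro: LIMSEQ_le_const)
    then show ?thesis by simp
  qed
  obtain K where K: "\<And>y. y \<in> B \<Longrightarrow> \<bar>ip y l\<bar> \<le> K" using bd[OF l(1)] by blast
  obtain n where n: "3 / 2 * K < 2 ^ n" using real_arch_pow[of 2 "3/2 * K"] by auto
  have "r n * nrm (Y n) \<le> \<bar>ip (Y n) l\<bar> + \<bar>ip (Y n) (l - x (Suc n))\<bar>"
    using big[of n] YX[of n] xX[of "Suc n"] l(1) by (simp add: diff_right)
  also have "\<dots> \<le> K + nrm (Y n) * (4 / 3 * r (Suc n))"
    using K[OF Y(1)] ip_le[OF YX, of "l - x (Suc n)" n] l(1) xX
      mult_left_mono[OF near[of "Suc n"] less_imp_le[OF Ypos[of n]]] by (simp add: add_mono)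
  finally have "r n * nrm (Y n) \<le> K + nrm (Y n) * (4 / 3 * r (Suc n))" .
  moreover have rS: "r (Suc n) = r n / 4" unfolding r_def by simp
  ultimately have "2 / 3 * (r n * nrm (Y n)) \<le> K" unfolding rS by (simp add: algebra_simps)
  moreover have "r n * 8 ^ n \<le> r n * nrm (Y n)" using Yn[of n] r0[of n] by simp
  moreover have "r n * 8 ^ n = 2 ^ n" unfolding r_def power_mult_distrib[symmetric] by simp
  ultimately show False using n by simp
qed

text \<open>
  Gram--Schmidt: \<open>w\<close> is the component of the new vector \<open>v\<close> orthogonal to the space \<open>C\<close> reached so
  far.
\<close>

lemma finite_dim_decomposition:
  assumes "fincodim {0} C n" and "C \<subseteq> X"
  shows "ssum C (perp C) = X"
proof -
  have "fincodim U C n \<Longrightarrow> U = {0} \<Longrightarrow> C \<subseteq> X \<Longrightarrow> ssum C (perp C) = X" for U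
  proof (induction rule: fincodim.induct)
    case (refl U)
    have "perp {0} = X" unfolding perp_def by auto
    then show ?case using refl ssum_zero ssum_commute by metis
  next
    case (step U C n v)
    have C: "rsub C" using step fincodim_subspace real_vector.subspace_single_0 by blast
    have sub: "insert v C \<subseteq> rspan (insert v C)" using real_vector.span_superset by blast
    then have vX: "v \<in> X" and CX: "C \<subseteq> X" using step.prems by auto
    have IH: "ssum C (perp C) = X" using step CX by blast
    then obtain c w where cw: "c \<in> C" "w \<in> perp C" "v = c + w" using vX by (metis ssumE)
    have wX: "w \<in> X" using cw perp_subset by blast
    have w0: "w \<noteq> 0" using cw step.hyps by auto
    have w: "w \<in> rspan (insert v C)"
      unfolding span_insert_subspace[OF C]
      by (rule CollectI, intro exI[of _ "- c"] exI[of _ 1]) (use cw C in \<open>simp add: rsub_simps\<close>)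
    have "x \<in> ssum (rspan (insert v C)) (perp (rspan (insert v C)))" if x: "x \<in> X" for x
    proof -
      obtain a p where ap: "a \<in> C" "p \<in> perp C" "x = a + p" using x IH by (metis ssumE)
      have pX: "p \<in> X" using ap perp_subset by blast
      define t where "t = ip p w / ip w w"
      have "p - t *\<^sub>R w \<in> perp (rspan (insert v C))"
        unfolding perp_def span_insert_subspace[OF C]
      proof (intro CollectI conjI ballI)
        show "p - t *\<^sub>R w \<in> X" using pX wX by simp
        fix m assume "m \<in> {w + r *\<^sub>R v |w r. w \<in> C}"
        then obtain d r where m: "m = d + r *\<^sub>R v" "d \<in> C" by blast
        define g where "g = d + r *\<^sub>R c"
        have e: "m = g + r *\<^sub>R w" unfolding g_def using m cw by (simp add: algebra_simps)
        have gC: "g \<in> C" unfolding g_def using m cw C by (simp add: rsub_simps)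
        have "ip p g = 0" "ip w g = 0" using ap cw gC unfolding perp_def by blast+
        moreover have "ip p w - t * ip w w = 0" unfolding t_def using eq_0[OF wX] w0 by simp
        moreover have "g \<in> X" using gC CX by blast
        ultimately show "ip (p - t *\<^sub>R w) m = 0"
          unfolding e using pX wX by (simp add: add_right diff_left scale_left scale_right)
      qed
      moreover have "a + t *\<^sub>R w \<in> rspan (insert v C)"
        using w ap sub by (intro real_vector.span_add real_vector.span_scale) auto
      moreover have "x = (a + t *\<^sub>R w) + (p - t *\<^sub>R w)" using ap by simp
      ultimately show ?thesis using ssumI by metis
    qed
    moreover have "ssum (rspan (insert v C)) (perp (rspan (insert v C))) \<subseteq> X"
      using ssum_subset[OF real_hilbert.sub[OF real_hilbert_axioms] step.prems(2) perp_subset] .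
    ultimately show ?case by blast
  qed
  then show ?thesis using assms by blast
qed

lemma fincodim_perp:
  assumes "fincodim {0} C n" and "C \<subseteq> X"
  shows "fincodim (perp C) X n"
proof -
  have "rsub C" using assms fincodim_subspace real_vector.subspace_single_0 by blast
  then have "fincodim (perp C) (ssum (perp C) C) n"
    using fincodim_complement[OF rsub_perp[OF assms(2)] _ assms(1)] perp_Int[OF assms(2)] by blast
  then show ?thesis using finite_dim_decomposition[OF assms] ssum_commute by metis
qed

end

text \<open>
  Let \<open>C\<close> be an algebraic complement of the range of \<open>a\<close> and \<open>P\<close> its orthogonal complement in \<open>N\<close>.
  On \<open>P\<close> the map \<open>b\<close> is bounded below: for \<open>z = a x + u\<close> with \<open>u \<in> C\<close>, \<open>\<langle>y, z\<rangle> = \<langle>b y, x\<rangle>\<close> is bounded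
  over the \<open>y \<in> P\<close> with \<open>\<parallel>b y\<parallel> \<le> 1\<close>, and uniform boundedness applies since such \<open>z\<close> fill \<open>N\<close>. Hence
  \<open>b\<close> is injective on \<open>P\<close> and \<open>Q = b P\<close> is complete. A vector \<open>x\<close> is orthogonal to \<open>Q\<close> iff \<open>a x\<close> is
  orthogonal to \<open>P\<close>, that is, lies in \<open>C\<close>; being in the range as well, \<open>a x\<close> is then \<open>0\<close>. So the
  null space of \<open>a\<close> is the orthogonal complement of \<open>Q\<close>, \<open>b\<close> restricted to \<open>P\<close> has the
  index \<open>- dim (ker a)\<close>, and \<open>P\<close> has codimension \<open>dim C\<close> in \<open>N\<close>.
\<close>

lemma adjoint_fredholm:
  fixes a :: "'b::real_vector \<Rightarrow> 'c::real_vector" and b :: "'c \<Rightarrow> 'b"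
  assumes M: "real_hilbert M ipM" and N: "real_hilbert N ipN" and a: "linear a" and b: "linear b"
    and aM: "a ` M \<subseteq> N" and bN: "b ` N \<subseteq> M"
    and adj: "\<And>x y. x \<in> M \<Longrightarrow> y \<in> N \<Longrightarrow> ipN (a x) y = ipM x (b y)"
    and fred: "fredholm_pair a M N i"
  shows "fredholm_pair b N M (- i)"
proof -
  interpret M: real_hilbert M ipM by fact
  interpret N: real_hilbert N ipN by fact
  have aX: "a x \<in> N" if "x \<in> M" for x using aM that by blast
  have bY: "b y \<in> M" if "y \<in> N" for y using bN that by blast
  obtain k c where kc: "fincodim {0} (nullset a M) k" "fincodim (a ` M) N c" "i = int k - int c"
    using fred by (rule fredholm_pairE)
  obtain C where C: "rsub C" "C \<inter> a ` M \<subseteq> {0}" "ssum (a ` M) C = N" "fincodim {0} C c"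
    using complement_exists[OF rsub_image[OF a M.sub] N.sub aM] kc(2) by metis
  have CN: "C \<subseteq> N" using C(3) ssum_right[OF rsub_image[OF a M.sub]] by blast
  define P where "P = N.perp C"
  have PN: "P \<subseteq> N" unfolding P_def by (rule N.perp_subset)
  have P: "rsub P" unfolding P_def using N.rsub_perp CN by blast
  have dec: "ssum C P = N" unfolding P_def using N.finite_dim_decomposition[OF C(4) CN] .
  have Pc: "fincodim P N c" unfolding P_def using N.fincodim_perp[OF C(4) CN] .
  have "\<exists>K. \<forall>y\<in>{y\<in>P. ipM (b y) (b y) \<le> 1}. ipN y y \<le> K"
  proof (rule N.uniform_boundedness)
    fix z assume "z \<in> N"
    then obtain v u where vu: "v \<in> a ` M" "u \<in> C" "z = v + u" using C(3) by (metis ssumE)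
    then obtain x where "x \<in> M" "v = a x" by blast
    with vu have xu: "x \<in> M" "u \<in> C" "z = a x + u" by auto
    have "\<bar>ipN y z\<bar> \<le> M.nrm x" if y: "y \<in> P" "ipM (b y) (b y) \<le> 1" for y
    proof -
      have yN: "y \<in> N" using y PN by blast
      have "ipN y u = 0" using y xu unfolding P_def N.perp_def by blast
      then have "ipN y z = ipM x (b y)"
        using xu yN aX[OF xu(1)] CN adj[OF xu(1) yN] N.sym[OF yN aX[OF xu(1)]]
        by (simp add: N.add_right subset_iff)
      then have "\<bar>ipN y z\<bar> \<le> M.nrm x * M.nrm (b y)" using M.ip_le[OF xu(1) bY[OF yN]] by simp
      also have "\<dots> \<le> M.nrm x * 1"
        by (rule mult_left_mono) (use y xu in \<open>auto simp: M.nrm_def[of "b y"]\<close>)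
      finally show ?thesis by simp
    qed
    then show "\<exists>K. \<forall>y\<in>{y\<in>P. ipM (b y) (b y) \<le> 1}. \<bar>ipN y z\<bar> \<le> K" by blast
  qed (use PN in auto)
  then obtain K where K: "\<And>y. y \<in> P \<Longrightarrow> ipM (b y) (b y) \<le> 1 \<Longrightarrow> ipN y y \<le> K" by blast
  have below: "ipN y y \<le> K * ipM (b y) (b y)" if y: "y \<in> P" for y
  proof -
    have yN: "y \<in> N" using y PN by blast
    have sc: "t\<^sup>2 * ipN y y \<le> K" if "t\<^sup>2 * ipM (b y) (b y) \<le> 1" for t
      using K[of "t *\<^sub>R y"] that y yN bY[OF yN] b P
      by (simp add: M.sq_scale N.sq_scale linear_scale rsub_simps)
    show ?thesis
    proof (cases "ipM (b y) (b y) = 0")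
      case True
      have "ipN y y = 0"
      proof (rule ccontr)
        assume "ipN y y \<noteq> 0"
        then have p: "0 < ipN y y" using N.nonneg[OF yN] by simp
        have "0 \<le> K" using sc[of 0] True by simp
        then have "(sqrt ((K + 1) / ipN y y))\<^sup>2 = (K + 1) / ipN y y" using p by (subst real_sqrt_pow2) auto
        then show False using sc[of "sqrt ((K + 1) / ipN y y)"] True p by simp
      qed
      then show ?thesis using True by simp
    next
      case False
      then have p: "0 < ipM (b y) (b y)" using M.nonneg[OF bY[OF yN]] by simp
      then have "(sqrt (1 / ipM (b y) (b y)))\<^sup>2 = 1 / ipM (b y) (b y)" by (subst real_sqrt_pow2) auto
      then show ?thesis using sc[of "sqrt (1 / ipM (b y) (b y))"] p by (simp add: field_simps)
    qed
  qed
  have K0: "0 \<le> K" using K[of 0] P b M.zero_left[OF M.mem(1)] by (simp add: rsub_simps linear_0)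
  define Q where "Q = b ` P"
  have Q: "rsub Q" unfolding Q_def using rsub_image[OF b P] .
  have QM: "Q \<subseteq> M" unfolding Q_def using bN PN by blast
  have "real_hilbert Q ipM"
  proof
    fix f :: "nat \<Rightarrow> 'b"
    assume f: "\<forall>i. f i \<in> Q" and ca: "\<forall>e>0. \<exists>N. \<forall>i\<ge>N. \<forall>j\<ge>N. ipM (f i - f j) (f i - f j) < e"
    then have "\<forall>i. \<exists>p. p \<in> P \<and> f i = b p" unfolding Q_def by blast
    then obtain g where g: "\<And>i. g i \<in> P" "\<And>i. f i = b (g i)" by metis
    have gN: "g i \<in> N" and fM: "f i \<in> M" for i using g PN f QM by auto
    have "\<forall>e>0. \<exists>N. \<forall>i\<ge>N. \<forall>j\<ge>N. ipN (g i - g j) (g i - g j) < e"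
    proof (intro allI impI)
      fix e :: real assume "0 < e"
      then have "0 < e / (K + 1)" using K0 by simp
      then obtain n where n: "\<And>i j. i \<ge> n \<Longrightarrow> j \<ge> n \<Longrightarrow> ipM (f i - f j) (f i - f j) < e / (K + 1)"
        using ca by blast
      have "ipN (g i - g j) (g i - g j) < e" if "i \<ge> n" "j \<ge> n" for i j
      proof -
        have "g i - g j \<in> P" using g(1) P by (simp add: rsub_simps)
        then have "ipN (g i - g j) (g i - g j) \<le> K * ipM (f i - f j) (f i - f j)"
          using below[of "g i - g j"] b g(2) by (simp add: linear_diff)
        also have "\<dots> \<le> (K + 1) * ipM (f i - f j) (f i - f j)"
          using M.nonneg[OF M.mem(3)[OF fM fM]] by (intro mult_right_mono) auto
        also have "\<dots> < e" using n[OF that] K0 by (simp add: pos_less_divide_eq mult.commute)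
        finally show ?thesis .
      qed
      then show "\<exists>N. \<forall>i\<ge>N. \<forall>j\<ge>N. ipN (g i - g j) (g i - g j) < e" by blast
    qed
    then obtain y where y: "y \<in> P" "(\<lambda>i. ipN (g i - y) (g i - y)) \<longlonglongrightarrow> 0"
      using real_hilbert.complete[OF N.real_hilbert_perp[OF CN]] g(1) unfolding P_def by blast
    obtain l where l: "l \<in> M" "(\<lambda>i. ipM (f i - l) (f i - l)) \<longlonglongrightarrow> 0" using M.complete[OF _ ca] fM by blast
    have yN: "y \<in> N" using y PN by blast
    \<comment> \<open>The graph of \<open>b\<close> is closed because inner products with \<open>b y\<close> can be moved to \<open>a\<close>.\<close>
    have "l = b y"
    proof (rule M.eq_if_ip[OF l(1) bY[OF yN]])
      fix x assume x: "x \<in> M"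
      have "ipM (f i) x = ipN (g i) (a x)" for i
        using adj[OF x gN, of i] M.sym[OF fM x, of i] N.sym[OF gN aX[OF x], of i] g(2) by simp
      then have "(\<lambda>i. ipN (g i) (a x)) \<longlonglongrightarrow> ipM l x"
        using M.tendsto_ip[OF fM l(1) x l(2)] by simp
      moreover have "(\<lambda>i. ipN (g i) (a x)) \<longlonglongrightarrow> ipN y (a x)"
        using N.tendsto_ip[OF gN yN aX[OF x] y(2)] .
      ultimately have "ipM l x = ipN y (a x)" using LIMSEQ_unique by blast
      then show "ipM l x = ipM (b y) x"
        using adj[OF x yN] M.sym[OF bY[OF yN] x] N.sym[OF yN aX[OF x]] by simp
    qed
    then have "l \<in> Q" unfolding Q_def using y by blast
    then show "\<exists>l\<in>Q. (\<lambda>i. ipM (f i - l) (f i - l)) \<longlonglongrightarrow> 0" using l by blast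
  qed (use Q QM in \<open>auto simp: subset_iff M.ip_simps M.sym M.pos\<close>)
  note QM_dec = M.orthogonal_decomposition[OF this QM]
  have perpQ: "M.perp Q = nullset a M"
  proof (intro equalityI subsetI)
    fix x assume x: "x \<in> M.perp Q"
    then have xM: "x \<in> M" using M.perp_subset by blast
    obtain u p where up: "u \<in> C" "p \<in> P" "a x = u + p" using aX[OF xM] dec by (metis ssumE)
    have pN: "p \<in> N" and uN: "u \<in> N" using up PN CN by auto
    have "ipM x (b p) = 0" using x up unfolding M.perp_def Q_def by blast
    then have "ipN (a x) p = 0" using adj[OF xM pN] by simp
    moreover have "ipN u p = 0" using up N.sym[OF pN uN] unfolding P_def N.perp_def by auto
    ultimately have "ipN p p = 0" using up(3) pN uN by (simp add: N.add_left)
    then have "a x \<in> C \<inter> a ` M" using N.eq_0[OF pN] up xM by auto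
    then show "x \<in> nullset a M" using C(2) xM by blast
  next
    fix x assume x: "x \<in> nullset a M"
    have "ipM x (b y) = 0" if "y \<in> P" for y
      using adj[of x y] x PN that by (metis (mono_tags, lifting) N.zero_left mem_Collect_eq subsetD)
    then show "x \<in> M.perp Q" using x unfolding M.perp_def Q_def by blast
  qed
  have "fincodim Q (ssum Q (nullset a M)) k"
    using fincodim_complement[OF Q rsub_nullset[OF a M.sub] kc(1)] M.perp_Int[OF QM] unfolding perpQ by blast
  then have "fincodim Q M k" unfolding QM_dec[unfolded perpQ] .
  then have "fincodim (b ` P) M k" unfolding Q_def .
  moreover have "nullset b P = {0}"
  proof (intro equalityI subsetI)
    fix y assume y: "y \<in> nullset b P"
    then have "ipN y y \<le> 0" using below[of y] M.zero_left[OF M.mem(1)] by simp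
    then show "y \<in> {0}" using N.nonneg[of y] N.eq_0[of y] y PN by force
  qed (use P b in \<open>auto simp: rsub_simps linear_0\<close>)
  ultimately have "fredholm_pair b P M (0 - int k)"
    unfolding fredholm_pair_def by (intro exI[of _ 0] exI[of _ k]) (simp add: fincodim.refl)
  then have "fredholm_pair b P M (- i - int c)" using kc(3) by simp
  then show ?thesis using fredholm_pair_restrict[OF b P Pc M.sub bN] by blast
qed

lemma adjoint_fredholm_iff:
  assumes "real_hilbert M ipM" "real_hilbert N ipN" "linear a" "linear b" "a ` M \<subseteq> N" "b ` N \<subseteq> M"
    and adj: "\<And>x y. x \<in> M \<Longrightarrow> y \<in> N \<Longrightarrow> ipN (a x) y = ipM x (b y)"
  shows "fredholm_pair b N M i \<longleftrightarrow> fredholm_pair a M N (- i)"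
proof
  have adj': "ipM (b y) x = ipN y (a x)" if "x \<in> M" "y \<in> N" for x y
    using adj[OF that] real_hilbert.sym[OF assms(1)] real_hilbert.sym[OF assms(2)] that assms(5,6)
    by (metis image_subset_iff)
  show "fredholm_pair b N M i \<Longrightarrow> fredholm_pair a M N (- i)"
    by (rule adjoint_fredholm[OF assms(2,1,4,3,6,5)]) (use adj' in auto)
  show "fredholm_pair a M N (- i) \<Longrightarrow> fredholm_pair b N M i"
    using adjoint_fredholm[OF assms, of "- i"] by simp
qed

text \<open>
  The theorem of Hellinger and Toeplitz: the images of unit vectors are weakly bounded, since
  \<open>\<langle>a x, z\<rangle> = \<langle>x, b z\<rangle>\<close>.
\<close>

lemma adjoint_bounded:
  fixes a :: "'b::real_vector \<Rightarrow> 'c::real_vector" and b :: "'c \<Rightarrow> 'b"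
  assumes M: "real_hilbert M ipM" and N: "real_hilbert N ipN" and a: "linear a"
    and aM: "a ` M \<subseteq> N" and bN: "b ` N \<subseteq> M"
    and adj: "\<And>x y. x \<in> M \<Longrightarrow> y \<in> N \<Longrightarrow> ipN (a x) y = ipM x (b y)"
  shows "\<exists>C. \<forall>x\<in>M. ipN (a x) (a x) \<le> C * ipM x x"
proof -
  interpret M: real_hilbert M ipM by fact
  interpret N: real_hilbert N ipN by fact
  have aX: "a x \<in> N" if "x \<in> M" for x using aM that by blast
  have "\<exists>K. \<forall>y\<in>a ` {x\<in>M. ipM x x \<le> 1}. ipN y y \<le> K"
  proof (rule N.uniform_boundedness)
    fix z assume z: "z \<in> N"
    then have bz: "b z \<in> M" using bN by blast
    have "\<bar>ipN (a x) z\<bar> \<le> M.nrm (b z)" if x: "x \<in> M" "ipM x x \<le> 1" for x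
    proof -
      have "\<bar>ipN (a x) z\<bar> \<le> M.nrm x * M.nrm (b z)" using adj[OF x(1) z] M.ip_le[OF x(1) bz] by simp
      also have "\<dots> \<le> 1 * M.nrm (b z)"
        by (rule mult_right_mono) (use x bz in \<open>auto simp: M.nrm_def[of x]\<close>)
      finally show ?thesis by simp
    qed
    then show "\<exists>K. \<forall>y\<in>a ` {x\<in>M. ipM x x \<le> 1}. \<bar>ipN y z\<bar> \<le> K" by blast
  qed (use aM in auto)
  then obtain K where K: "\<And>x. x \<in> M \<Longrightarrow> ipM x x \<le> 1 \<Longrightarrow> ipN (a x) (a x) \<le> K" by blast
  have "ipN (a x) (a x) \<le> K * ipM x x" if x: "x \<in> M" for x
  proof (cases "x = 0")
    case True
    then show ?thesis using a M.zero_left[OF M.mem(1)] N.zero_left[OF N.mem(1)] by (simp add: linear_0)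
  next
    case False
    then have p: "0 < ipM x x" using M.pos x by blast
    define t where "t = sqrt (1 / ipM x x)"
    have t: "t\<^sup>2 = 1 / ipM x x" unfolding t_def using p by (subst real_sqrt_pow2) auto
    have "ipN (a (t *\<^sub>R x)) (a (t *\<^sub>R x)) \<le> K" using K[of "t *\<^sub>R x"] x t p by (simp add: M.sq_scale)
    then have "t\<^sup>2 * ipN (a x) (a x) \<le> K" using a aX[OF x] by (simp add: linear_scale N.sq_scale)
    then show ?thesis using t p by (simp add: field_simps)
  qed
  then show ?thesis by blast
qed

section \<open>Two maps whose products have finite rank\<close>

text \<open>
  The sequence folded to two spaces: \<open>d0\<close>, \<open>d1\<close> play the role of \<open>\<delta>\<close> on even and odd degrees,
  \<open>e0\<close>, \<open>e1\<close> that of the adjoints. Everything about \<open>d1\<close> is obtained from the facts about \<open>d0\<close> by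
  exchanging the two spaces (\<open>swap\<close>).
\<close>

locale adjoint_cycle =
  X: real_hilbert X ipX + Y: real_hilbert Y ipY
  for X :: "'b::real_vector set" and ipX and Y :: "'c::real_vector set" and ipY +
  fixes d0 :: "'b \<Rightarrow> 'c" and d1 :: "'c \<Rightarrow> 'b" and e0 :: "'c \<Rightarrow> 'b" and e1 :: "'b \<Rightarrow> 'c"
  assumes lin: "linear d0" "linear d1" "linear e0" "linear e1"
    and maps: "d0 ` X \<subseteq> Y" "d1 ` Y \<subseteq> X" "e0 ` Y \<subseteq> X" "e1 ` X \<subseteq> Y"
    and adj0: "\<lbrakk>x \<in> X; y \<in> Y\<rbrakk> \<Longrightarrow> ipY (d0 x) y = ipX x (e0 y)"
    and adj1: "\<lbrakk>x \<in> X; y \<in> Y\<rbrakk> \<Longrightarrow> ipX (d1 y) x = ipY y (e1 x)"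
    and fin0: "\<exists>r. fincodim {0} (d1 ` d0 ` X) r"
    and fin1: "\<exists>r. fincodim {0} (d0 ` d1 ` Y) r"
begin

lemma swap: "adjoint_cycle Y ipY X ipX d1 d0 e1 e0"
  by (intro adjoint_cycle.intro adjoint_cycle_axioms.intro X.real_hilbert_axioms Y.real_hilbert_axioms
      lin maps fin0 fin1 adj0 adj1)

lemma in_maps [simp]: "x \<in> X \<Longrightarrow> d0 x \<in> Y" "y \<in> Y \<Longrightarrow> d1 y \<in> X" "y \<in> Y \<Longrightarrow> e0 y \<in> X" "x \<in> X \<Longrightarrow> e1 x \<in> Y"
  using maps by auto

definition "N = nullset d0 X"

definition "M = X.perp N"

lemma N_sub: "N \<subseteq> X" and M_sub: "M \<subseteq> X"
  unfolding N_def M_def using X.perp_subset by auto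

lemma N_rsub: "rsub N"
  unfolding N_def using rsub_nullset lin(1) X.sub .

lemma M_rsub: "rsub M"
  unfolding M_def using X.rsub_perp[OF N_sub] .

lemma real_hilbert_N: "real_hilbert N ipX"
proof (rule X.closed_subspace[OF N_rsub N_sub])
  fix f l assume f: "\<And>i. f i \<in> N" "l \<in> X" "(\<lambda>i. ipX (f i - l) (f i - l)) \<longlonglongrightarrow> 0"
  have "ipY (d0 l) y = ipY 0 y" if y: "y \<in> Y" for y
  proof -
    have 0: "ipX (f i) (e0 y) = 0" for i
      using f(1)[of i] y adj0[of "f i" y] Y.zero_left[OF y] unfolding N_def by auto
    have "(\<lambda>i. ipX (f i) (e0 y)) \<longlonglongrightarrow> ipX l (e0 y)"
      using f(1) N_sub y by (intro X.tendsto_ip f(2,3)) auto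
    then have "(\<lambda>i. 0) \<longlonglongrightarrow> ipX l (e0 y)" unfolding 0 .
    then have "ipX l (e0 y) = 0" using LIMSEQ_unique tendsto_const by blast
    then show ?thesis using adj0 f(2) y by simp
  qed
  then have "d0 l = 0" using Y.eq_if_ip[of "d0 l" 0] f(2) by simp
  then show "l \<in> N" unfolding N_def using f(2) by simp
qed

lemma real_hilbert_M: "real_hilbert M ipX"
  unfolding M_def using X.real_hilbert_perp[OF N_sub] .

lemma decomposition: "ssum N M = X"
  unfolding M_def using X.orthogonal_decomposition[OF real_hilbert_N N_sub] .

lemma N_Int_M: "N \<inter> M \<subseteq> {0}"
  unfolding M_def using X.perp_Int[OF N_sub] .

lemma ip_N_M: "\<lbrakk>x \<in> N; y \<in> M\<rbrakk> \<Longrightarrow> ipX x y = 0" "\<lbrakk>x \<in> N; y \<in> M\<rbrakk> \<Longrightarrow> ipX y x = 0"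
proof -
  assume *: "x \<in> N" "y \<in> M"
  then show "ipX y x = 0" unfolding M_def X.perp_def by blast
  moreover have "x \<in> X" "y \<in> X" using * N_sub M_sub by auto
  ultimately show "ipX x y = 0" using X.sym[of x y] by simp
qed

lemma d0_inj: "nullset d0 M = {0}"
  using N_Int_M M_sub X.mem(1) real_vector.subspace_0[OF M_rsub] lin(1) unfolding N_def
  by (auto simp: linear_0)

definition "P = (SOME P. linear P \<and> (\<forall>x\<in>N. P x = x) \<and> (\<forall>x\<in>M. P x = 0))"

lemma P: "linear P" "\<And>x. x \<in> N \<Longrightarrow> P x = x" "\<And>x. x \<in> M \<Longrightarrow> P x = 0"
proof -
  have "\<exists>P. linear P \<and> (\<forall>x\<in>N. P x = x) \<and> (\<forall>x\<in>M. P x = 0)"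
    using projection_exists[OF N_rsub M_rsub N_Int_M] by metis
  from someI_ex[OF this] show "linear P" "\<And>x. x \<in> N \<Longrightarrow> P x = x" "\<And>x. x \<in> M \<Longrightarrow> P x = 0"
    unfolding P_def by blast+
qed

lemma P_in: assumes "x \<in> X" shows "P x \<in> N" "x - P x \<in> M" "d0 (P x) = 0"
proof -
  obtain n m where nm: "n \<in> N" "m \<in> M" "x = n + m" using assms decomposition by (metis ssumE)
  then have "P x = n" using P by (simp add: linear_add)
  then show "P x \<in> N" "x - P x \<in> M" using nm by auto
  then show "d0 (P x) = 0" unfolding N_def by auto
qed

lemma e0_in_M: "e0 ` Y \<subseteq> M"
proof clarify
  fix y assume y: "y \<in> Y"
  have "ipX (e0 y) x = 0" if x: "x \<in> N" for x
  proof -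
    have "x \<in> X" "d0 x = 0" using x unfolding N_def by auto
    then show ?thesis using adj0[of x y] X.sym[of x "e0 y"] Y.zero_left[OF y] y by simp
  qed
  then show "e0 y \<in> M" unfolding M_def X.perp_def using y by simp
qed

text \<open>
  The component of \<open>d1\<close> orthogonal to \<open>N\<close>. On the complement of \<open>N\<close> the map \<open>d0\<close> is injective, and
  it takes the range of this component onto the range of \<open>d0 d1\<close>.
\<close>

lemma residual_finite: "\<exists>r. fincodim {0} ((\<lambda>y. d1 y - P (d1 y)) ` Y) r"
proof -
  define F where "F = (\<lambda>y. d1 y - P (d1 y)) ` Y"
  have "linear (\<lambda>y. d1 y - P (d1 y))"
    using linear_compose_sub[OF lin(2) linear_compose[OF lin(2) P(1)]] by (simp add: o_def)
  then have F: "rsub F" unfolding F_def using rsub_image Y.sub by blast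
  have FM: "F \<subseteq> M" unfolding F_def using P_in by auto
  have "d0 ` F = d0 ` d1 ` Y"
    unfolding F_def image_image using P_in(3) lin(1) by (intro image_cong) (auto simp: linear_diff)
  then obtain r where "fincodim (d0 ` {0}) (d0 ` F) r" using fin1 lin(1) by (auto simp: linear_0)
  moreover have "nullset d0 F \<subseteq> {0}" using FM d0_inj by blast
  ultimately have "fincodim {0} F r"
    using fincodim_preimage[OF lin(1) real_vector.subspace_single_0 F] real_vector.subspace_0[OF F] by simp
  then show ?thesis unfolding F_def by blast
qed

text \<open>
  The map in question is the adjoint of the one of \<open>residual_finite\<close>, so it vanishes on the
  orthogonal complement of that finite-dimensional range.
\<close>

lemma adjoint_residual_finite: "\<exists>r. fincodim {0} ((\<lambda>x. e1 (x - P x)) ` X) r"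
proof -
  define F where "F = (\<lambda>y. d1 y - P (d1 y)) ` Y"
  obtain r where r: "fincodim {0} F r" using residual_finite unfolding F_def by blast
  have FX: "F \<subseteq> X" unfolding F_def using P_in M_sub by auto
  define T where "T = (\<lambda>x. e1 (x - P x))"
  have T: "linear T"
    unfolding T_def using linear_compose[OF linear_compose_sub[OF linear_ident P(1)] lin(4)] by (simp add: o_def)
  have "T x = 0" if x: "x \<in> X.perp F" for x
  proof -
    have xX: "x \<in> X" using x X.perp_subset by blast
    then have m: "x - P x \<in> M" "x - P x \<in> X" "P x \<in> X" "P x \<in> N" using P_in M_sub N_sub by auto
    have "ipY (T x) y = ipY 0 y" if y: "y \<in> Y" for y
    proof -
      have d: "d1 y \<in> X" "P (d1 y) \<in> N" "d1 y - P (d1 y) \<in> M" "P (d1 y) \<in> X" "d1 y - P (d1 y) \<in> X"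
        using y P_in[of "d1 y"] N_sub M_sub by auto
      have "ipY (T x) y = ipX (d1 y) (x - P x)"
        unfolding T_def using adj1[OF m(2) y] Y.sym[of "e1 (x - P x)" y] m y by simp
      also have "\<dots> = ipX (d1 y - P (d1 y)) (x - P x) + ipX (P (d1 y)) (x - P x)"
        using d m by (simp add: X.diff_left)
      also have "\<dots> = ipX (d1 y - P (d1 y)) x - ipX (d1 y - P (d1 y)) (P x)"
        using d m xX ip_N_M(1)[OF d(2) m(1)] X.diff_right[OF xX m(3) d(5)] by simp
      also have "\<dots> = ipX x (d1 y - P (d1 y))"
        using ip_N_M(2)[OF m(4) d(3)] X.sym[OF xX d(5)] by simp
      also have "\<dots> = 0" using x y unfolding X.perp_def F_def by blast
      finally show ?thesis using y by simp
    qed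
    moreover have "T x \<in> Y" unfolding T_def using m by simp
    ultimately show ?thesis using Y.eq_if_ip[of "T x" 0] by simp
  qed
  then have "T ` X.perp F = {0}" using X.rsub_perp[OF FX] by (intro image_zero) auto
  moreover obtain j where "fincodim (T ` X.perp F) (T ` X) j"
    using fincodim_image[OF T X.rsub_perp[OF FX] X.fincodim_perp[OF r FX]] by blast
  ultimately show ?thesis unfolding T_def by auto
qed

lemma range_mod_null_finite: "\<exists>b. fincodim (N \<inter> d1 ` Y) (d1 ` Y) b"
proof -
  have R: "rsub (d1 ` Y)" using rsub_image lin(2) Y.sub .
  have I: "rsub (N \<inter> d1 ` Y)" using N_rsub R by (rule real_vector.subspace_inter)
  have "d0 ` (N \<inter> d1 ` Y) = {0}" using I by (intro image_zero) (auto simp: N_def)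
  then obtain b where b: "fincodim (d0 ` (N \<inter> d1 ` Y)) (d0 ` d1 ` Y) b" using fin1 by metis
  have "nullset d0 (d1 ` Y) \<subseteq> N \<inter> d1 ` Y" unfolding N_def by auto
  then show ?thesis using fincodim_preimage[OF lin(1) I R Int_lower2 _ b] by blast
qed

text \<open>
  \<open>e1 : N \<rightarrow> M1\<close> is adjoint to the compression \<open>A = P d1 : M1 \<rightarrow> N\<close>. On the vectors \<open>Z\<close> which \<open>d1\<close>
  takes into \<open>N\<close>, \<open>A\<close> is just \<open>d1\<close>: injective, with range \<open>N \<inter> R(d1)\<close>. Since \<open>d1\<close> identifies \<open>M1\<close>
  with \<open>R(d1)\<close>, the codimension of \<open>Z\<close> is that of \<open>N \<inter> R(d1)\<close> in \<open>R(d1)\<close>.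
\<close>

lemma e1_fredholm:
  assumes b: "fincodim (N \<inter> d1 ` Y) (d1 ` Y) b" and M1: "M1 = adjoint_cycle.M Y ipY d1"
  shows "fredholm_pair e1 N M1 i \<longleftrightarrow> (\<exists>a. fincodim (N \<inter> d1 ` Y) N a \<and> i = int a - int b)"
proof -
  interpret S: adjoint_cycle Y ipY X ipX d1 d0 e1 e0 by (rule swap)
  have M1: "M1 = S.M" using M1 by simp
  define A where "A = P \<circ> d1"
  have A: "linear A" unfolding A_def using linear_compose lin(2) P(1) by blast
  have AM: "A ` S.M \<subseteq> N" unfolding A_def using S.M_sub P_in(1) by auto
  have eN: "e1 ` N \<subseteq> S.M" using S.e0_in_M N_sub by blast
  have "fredholm_pair e1 N S.M i \<longleftrightarrow> fredholm_pair A S.M N (- i)"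
  proof (rule adjoint_fredholm_iff[OF S.real_hilbert_M real_hilbert_N A lin(4) AM eN])
    fix y x assume y: "y \<in> S.M" and x: "x \<in> N"
    have yY: "y \<in> Y" and xX: "x \<in> X" using y x S.M_sub N_sub by auto
    have d: "d1 y \<in> X" "P (d1 y) \<in> X" "d1 y - P (d1 y) \<in> M" using yY P_in[of "d1 y"] N_sub by auto
    have "ipX (d1 y) x - ipX (P (d1 y)) x = 0"
      using ip_N_M(2)[OF x d(3)] d xX by (simp add: X.diff_left)
    then show "ipX (A y) x = ipY y (e1 x)" unfolding A_def using adj1[OF xX yY] by simp
  qed
  also have "\<dots> \<longleftrightarrow> (\<exists>a. fincodim (N \<inter> d1 ` Y) N a \<and> i = int a - int b)"
  proof -
    define Z where "Z = {m\<in>S.M. d1 m \<in> N}"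
    have Z: "rsub Z" unfolding Z_def using S.M_rsub N_rsub lin(2)
      by (auto simp: real_vector.subspace_def linear_add linear_scale linear_0)
    have ZM: "Z \<subseteq> S.M" unfolding Z_def by blast
    have dM: "d1 ` S.M = d1 ` Y"
    proof
      show "d1 ` S.M \<subseteq> d1 ` Y" using S.M_sub by blast
      show "d1 ` Y \<subseteq> d1 ` S.M"
      proof clarify
        fix y assume y: "y \<in> Y"
        have "d1 y = d1 (y - S.P y)" using S.P_in(3)[OF y] lin(2) by (simp add: linear_diff)
        then show "d1 y \<in> d1 ` S.M" using S.P_in(2)[OF y] by blast
      qed
    qed
    have dZ: "d1 ` Z = N \<inter> d1 ` Y" unfolding dM[symmetric] Z_def by blast
    have "fincodim Z S.M b"
      by (rule fincodim_preimage[OF lin(2) Z S.M_rsub ZM])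
        (use S.d0_inj real_vector.subspace_0[OF Z] b in \<open>simp_all add: dZ dM\<close>)
    then have "fredholm_pair A S.M N (- i) \<longleftrightarrow> fredholm_pair A Z N (- i - int b)"
      using fredholm_pair_restrict[OF A Z _ N_rsub AM] by blast
    also have "\<dots> \<longleftrightarrow> fredholm_pair d1 Z N (- i - int b)"
      by (rule fredholm_pair_cong) (auto simp: A_def Z_def P(2))
    also have "\<dots> \<longleftrightarrow> (\<exists>a. fincodim (N \<inter> d1 ` Y) N a \<and> i = int a - int b)"
    proof -
      have "nullset d1 Z = {0}" using S.d0_inj ZM real_vector.subspace_0[OF Z] lin(2) by (auto simp: linear_0)
      moreover have "fincodim ({0} :: 'c set) {0} k \<longleftrightarrow> k = 0" for k
        using fincodim_self fincodim.refl by blast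
      ultimately show ?thesis unfolding fredholm_pair_def dZ
        by (auto intro: exI[of _ "0 :: nat"])
    qed
    finally show ?thesis .
  qed
  finally show ?thesis unfolding M1 .
qed

text \<open>
  \<open>B\<close> is the block diagonal part of \<open>d0 + e1\<close>. The first block is expressed through its adjoint
  \<open>e0\<close>, so that \<open>e1_fredholm\<close> applies to both blocks.
\<close>

lemma fredholm_iff_blocks:
  assumes M1: "M1 = adjoint_cycle.M Y ipY d1" and N1: "N1 = adjoint_cycle.N Y d1"
  shows "fredholm_pair (\<lambda>x. d0 x + e1 x) X Y i \<longleftrightarrow>
    (\<exists>i1 i2. fredholm_pair e0 N1 M (- i1) \<and> fredholm_pair e1 N M1 i2 \<and> i = i1 + i2)"
proof -
  interpret S: adjoint_cycle Y ipY X ipX d1 d0 e1 e0 by (rule swap)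
  have M1: "M1 = S.M" and N1: "N1 = S.N" using M1 N1 by auto
  define D where "D = (\<lambda>x. d0 x + e1 x)"
  define B where "B = (\<lambda>x. S.P (d0 x) + e1 (P x))"
  have D: "linear D" unfolding D_def using linear_compose_add lin(1,4) by blast
  have B: "linear B" unfolding B_def
    using linear_compose_add[OF linear_compose[OF lin(1) S.P(1)] linear_compose[OF P(1) lin(4)]]
    by (simp add: o_def)
  have DX: "D ` X \<subseteq> Y" unfolding D_def by auto
  have BX: "B ` X \<subseteq> Y" unfolding B_def using S.P_in(1) P_in(1) S.N_sub N_sub by (auto simp: subset_iff)
  have BM: "B ` M \<subseteq> S.N" unfolding B_def using S.P_in(1) M_sub P(3) lin(4) by (auto simp: linear_0 subset_iff)
  obtain r s where r: "fincodim {0} ((\<lambda>x. d0 x - S.P (d0 x)) ` X) r"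
    and s: "fincodim {0} ((\<lambda>x. e1 (x - P x)) ` X) s"
    using S.residual_finite adjoint_residual_finite by blast
  define F where "F = (\<lambda>x. d0 x - S.P (d0 x)) ` X"
  define G where "G = (\<lambda>x. e1 (x - P x)) ` X"
  have z: "rsub {0}" by (rule real_vector.subspace_single_0)
  have F: "rsub F" and G: "rsub G" using r s z fincodim_subspace unfolding F_def G_def by blast+
  have "\<exists>n. fincodim {0} (ssum F G) n"
  proof -
    have GF: "rsub (G \<inter> F)" using G F by (rule real_vector.subspace_inter)
    have "{0} \<subseteq> G \<inter> F" using real_vector.subspace_0[OF GF] by blast
    then obtain j where "fincodim (G \<inter> F) G j"
      using fincodim_between[OF s[folded G_def] z GF] by blast
    then have "fincodim (ssum F (G \<inter> F)) (ssum F G) j" by (rule fincodim_ssum[OF _ F GF]) blast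
    moreover have "ssum F (G \<inter> F) = F"
      using ssum_left[OF GF, of F] ssum_subset[OF F, of F "G \<inter> F"] by blast
    ultimately show ?thesis using fincodim_trans[OF _ r[folded F_def]] by auto
  qed
  then obtain n where n: "fincodim {0} (ssum F G) n" by blast
  have "(\<lambda>x. D x - B x) ` X \<subseteq> ssum F G"
  proof clarify
    fix x assume x: "x \<in> X"
    have "D x - B x = (d0 x - S.P (d0 x)) + e1 (x - P x)"
      unfolding D_def B_def using lin(4) by (simp add: linear_diff)
    also have "\<dots> \<in> ssum F G" unfolding F_def G_def using x by (intro ssumI) auto
    finally show "D x - B x \<in> ssum F G" .
  qed
  moreover have DB: "rsub ((\<lambda>x. D x - B x) ` X)"
    using rsub_image[OF linear_compose_sub[OF D B] X.sub] .
  moreover have "{0} \<subseteq> (\<lambda>x. D x - B x) ` X" using real_vector.subspace_0[OF DB] by blast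
  ultimately obtain k where "fincodim {0} ((\<lambda>x. D x - B x) ` X) k"
    using fincodim_between[OF n z DB] by blast
  then have "fredholm_pair D X Y i \<longleftrightarrow> fredholm_pair B X Y i"
    by (rule fredholm_pair_perturb[OF D B X.sub Y.sub DX BX])
  also have "\<dots> \<longleftrightarrow> fredholm_pair B (ssum M N) (ssum S.N S.M) i"
    unfolding S.decomposition ssum_commute[of M N] decomposition ..
  also have "\<dots> \<longleftrightarrow> (\<exists>i1 i2. fredholm_pair B M S.N i1 \<and> fredholm_pair B N S.M i2 \<and> i = i1 + i2)"
  proof (rule fredholm_pair_block[OF B M_rsub N_rsub S.N_rsub S.M_rsub _ S.N_Int_M])
    show "M \<inter> N \<subseteq> {0}" using N_Int_M by blast
    show "B ` M \<subseteq> S.N" by (rule BM)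
    show "B ` N \<subseteq> S.M"
      unfolding B_def using S.e0_in_M P(2) S.P(1) by (auto simp: N_def linear_0)
  qed
  also have "\<dots> \<longleftrightarrow> (\<exists>i1 i2. fredholm_pair e0 S.N M (- i1) \<and> fredholm_pair e1 N S.M i2 \<and> i = i1 + i2)"
  proof -
    have 1: "fredholm_pair B N S.M j \<longleftrightarrow> fredholm_pair e1 N S.M j" for j
      by (rule fredholm_pair_cong) (use P(2) S.P(1) in \<open>auto simp: B_def N_def linear_0\<close>)
    have eN: "e0 ` S.N \<subseteq> M" using e0_in_M S.N_sub by blast
    have "fredholm_pair e0 S.N M (- j) \<longleftrightarrow> fredholm_pair B M S.N (- (- j))" for j
    proof (rule adjoint_fredholm_iff[OF real_hilbert_M S.real_hilbert_N B lin(3) BM eN])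
      fix x y assume x: "x \<in> M" and y: "y \<in> S.N"
      have xX: "x \<in> X" and yY: "y \<in> Y" using x y M_sub S.N_sub by auto
      have "ipY (d0 x) y - ipY (S.P (d0 x)) y = 0"
        using S.ip_N_M(2)[OF y S.P_in(2)[of "d0 x"]] xX yY S.P_in(1)[of "d0 x"] S.N_sub
        by (simp add: Y.diff_left subset_iff)
      then show "ipY (B x) y = ipX x (e0 y)"
        unfolding B_def using P(3)[OF x] lin(4) adj0[OF xX yY] by (simp add: linear_0)
    qed
    then show ?thesis using 1 by simp
  qed
  finally show ?thesis unfolding D_def M1 N1 .
qed

text \<open>
  The numbers \<open>a0\<close>, \<open>b0\<close> are the null and range parts of the index on the even side, \<open>a1\<close>, \<open>b1\<close>
  those on the odd side. The range parts are always finite.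
\<close>

theorem fredholm_sum:
  shows "(\<exists>i. fredholm_pair (\<lambda>x. d0 x + e1 x) X Y i) \<longleftrightarrow>
      (\<exists>a. fincodim (nullset d0 X \<inter> d1 ` Y) (nullset d0 X) a) \<and>
      (\<exists>a. fincodim (nullset d1 Y \<inter> d0 ` X) (nullset d1 Y) a)"
    and "\<exists>b. fincodim (nullset d0 X \<inter> d1 ` Y) (d1 ` Y) b"
    and "\<exists>b. fincodim (nullset d1 Y \<inter> d0 ` X) (d0 ` X) b"
    and "\<lbrakk>fincodim (nullset d0 X \<inter> d1 ` Y) (nullset d0 X) a0;
      fincodim (nullset d0 X \<inter> d1 ` Y) (d1 ` Y) b0;
      fincodim (nullset d1 Y \<inter> d0 ` X) (nullset d1 Y) a1;
      fincodim (nullset d1 Y \<inter> d0 ` X) (d0 ` X) b1\<rbrakk>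
    \<Longrightarrow> fredholm_pair (\<lambda>x. d0 x + e1 x) X Y ((int a0 - int b0) - (int a1 - int b1))"
proof -
  interpret S: adjoint_cycle Y ipY X ipX d1 d0 e1 e0 by (rule swap)
  note blocks = fredholm_iff_blocks[OF HOL.refl HOL.refl]
  show b0: "\<exists>b. fincodim (nullset d0 X \<inter> d1 ` Y) (d1 ` Y) b"
    using range_mod_null_finite unfolding N_def .
  show b1: "\<exists>b. fincodim (nullset d1 Y \<inter> d0 ` X) (d0 ` X) b"
    using S.range_mod_null_finite unfolding S.N_def .
  obtain b0 b1 where b: "fincodim (N \<inter> d1 ` Y) (d1 ` Y) b0" "fincodim (S.N \<inter> d0 ` X) (d0 ` X) b1"
    using b0 b1 unfolding N_def S.N_def by blast
  show "(\<exists>i. fredholm_pair (\<lambda>x. d0 x + e1 x) X Y i) \<longleftrightarrow>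
      (\<exists>a. fincodim (nullset d0 X \<inter> d1 ` Y) (nullset d0 X) a) \<and>
      (\<exists>a. fincodim (nullset d1 Y \<inter> d0 ` X) (nullset d1 Y) a)"
    unfolding blocks e1_fredholm[OF b(1) HOL.refl] S.e1_fredholm[OF b(2) HOL.refl] N_def[symmetric] S.N_def[symmetric]
    by (auto, metis add.inverse_inverse)
  show "fredholm_pair (\<lambda>x. d0 x + e1 x) X Y ((int a0 - int b0) - (int a1 - int b1))"
    if "fincodim (nullset d0 X \<inter> d1 ` Y) (nullset d0 X) a0"
      "fincodim (nullset d0 X \<inter> d1 ` Y) (d1 ` Y) b0"
      "fincodim (nullset d1 Y \<inter> d0 ` X) (nullset d1 Y) a1"
      "fincodim (nullset d1 Y \<inter> d0 ` X) (d0 ` X) b1" for a0 b0 a1 b1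
    unfolding blocks using that
      e1_fredholm[OF that(2)[folded N_def] HOL.refl] S.e1_fredholm[OF that(4)[folded S.N_def] HOL.refl]
    unfolding N_def[symmetric] S.N_def[symmetric]
    by (intro exI[of _ "int b1 - int a1"] exI[of _ "int a0 - int b0"]) auto
qed

end

section \<open>Real dimension of spaces with explicit carriers\<close>

instantiation "fun" :: (type, real_vector) real_vector
begin

definition scaleR_fun :: "real \<Rightarrow> ('a \<Rightarrow> 'b) \<Rightarrow> 'a \<Rightarrow> 'b" where
  "scaleR_fun r f = (\<lambda>x. r *\<^sub>R f x)"

instance
  by standard (simp_all add: scaleR_fun_def fun_eq_iff scaleR_add_right scaleR_add_left)

end

text \<open>
  The dimension of the field of scalars over \<open>\<real>\<close>.
\<close>

definition scalar_dim :: "complex set \<Rightarrow> nat" where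
  "scalar_dim K = (if K = \<real> then 1 else 2)"

lemma scalar_dim_pos: "0 < scalar_dim K"
  unfolding scalar_dim_def by simp

text \<open>
  A vector space over the real or the complex numbers, without inner product. Null spaces,
  ranges and their quotients are of this kind.
\<close>

locale kspace = vectorspace "scalars K" V
  for K :: "complex set" and V :: "(complex, 'a, 'm) module_scheme" (structure) +
  assumes K_cases: "K = \<real> \<or> K = UNIV"

lemma scalars_simps [simp]:
  "carrier (scalars K) = K" "mult (scalars K) = (*)" "one (scalars K) = 1"
  "zero (scalars K) = 0" "add (scalars K) = (+)"
  unfolding scalars_def by simp_all

text \<open>
  Only real linearity is asked for, so the target need not carry complex scalars, and a
  quotient can be embedded by a real complement.
\<close>

definition real_embedding :: "(complex, 'a, 'm) module_scheme \<Rightarrow> ('a \<Rightarrow> 'b::real_vector) \<Rightarrow> bool" where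
  "real_embedding V \<phi> \<longleftrightarrow>
    (\<forall>x\<in>carrier V. \<forall>y\<in>carrier V. \<phi> (x \<oplus>\<^bsub>V\<^esub> y) = \<phi> x + \<phi> y) \<and>
    (\<forall>r. \<forall>x\<in>carrier V. \<phi> (complex_of_real r \<odot>\<^bsub>V\<^esub> x) = r *\<^sub>R \<phi> x) \<and>
    inj_on \<phi> (carrier V)"

lemma real_embeddingD:
  assumes "real_embedding V \<phi>"
  shows "\<lbrakk>x \<in> carrier V; y \<in> carrier V\<rbrakk> \<Longrightarrow> \<phi> (x \<oplus>\<^bsub>V\<^esub> y) = \<phi> x + \<phi> y"
    and "x \<in> carrier V \<Longrightarrow> \<phi> (complex_of_real r \<odot>\<^bsub>V\<^esub> x) = r *\<^sub>R \<phi> x"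
    and "inj_on \<phi> (carrier V)"
    and "\<lbrakk>x \<in> carrier V; y \<in> carrier V\<rbrakk> \<Longrightarrow> \<phi> x = \<phi> y \<longleftrightarrow> x = y"
  using assms unfolding real_embedding_def inj_on_def by auto

lemma real_embedding_subspace:
  "real_embedding V \<phi> \<Longrightarrow> U \<subseteq> carrier V \<Longrightarrow> real_embedding (V\<lparr>carrier := U\<rparr>) \<phi>"
  unfolding real_embedding_def by (auto simp: inj_on_subset subset_iff)

context kspace
begin

lemma K_of_real [simp, intro]: "complex_of_real r \<in> K"
  using K_cases by auto

lemma kspace_submodule:
  assumes "submodule (scalars K) U V" shows "kspace K (V\<lparr>carrier := U\<rparr>)"
  by (intro kspace.intro vectorspace.intro kspace_axioms.intro submodule_is_module assms K_cases field_axioms)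

lemma embed_zero: "real_embedding V \<phi> \<Longrightarrow> \<phi> \<zero> = 0"
  using real_embeddingD(1)[of V \<phi> \<zero> \<zero>] by simp

lemma embed_minus:
  assumes "real_embedding V \<phi>" "x \<in> carrier V" "y \<in> carrier V"
  shows "\<phi> (x \<ominus> y) = \<phi> x - \<phi> y"
proof -
  have "\<phi> ((x \<ominus> y) \<oplus> y) = \<phi> (x \<ominus> y) + \<phi> y" using assms by (intro real_embeddingD) auto
  moreover have "(x \<ominus> y) \<oplus> y = x" using assms by (simp add: a_minus_def a_assoc l_neg)
  ultimately show ?thesis by simp
qed

lemma rsub_submodule:
  assumes \<phi>: "real_embedding V \<phi>" and U: "submodule (scalars K) U V"
  shows "rsub (\<phi> ` U)"
proof -
  interpret U: submodule "scalars K" U V by fact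
  have UV: "U \<subseteq> carrier V" by (rule U.subset)
  show ?thesis
    unfolding real_vector.subspace_def
  proof (intro conjI ballI allI)
    show "0 \<in> \<phi> ` U" using embed_zero[OF \<phi>] U.zero_closed by (metis imageI)
    fix x assume "x \<in> \<phi> ` U"
    then obtain u where u: "u \<in> U" "x = \<phi> u" by blast
    show "r *\<^sub>R x \<in> \<phi> ` U" for r
    proof -
      have "r *\<^sub>R x = \<phi> (complex_of_real r \<odot> u)" "complex_of_real r \<odot> u \<in> U"
        using u UV real_embeddingD(2)[OF \<phi>, of u r] U.smult_closed[of "complex_of_real r" u] by auto
      then show ?thesis by blast
    qed
    fix y assume "y \<in> \<phi> ` U"
    then obtain v where v: "v \<in> U" "y = \<phi> v" by blast
    have "u \<in> carrier V" "v \<in> carrier V" using u v UV by blast+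
    then have "x + y = \<phi> (u \<oplus> v)" using u(2) v(2) real_embeddingD(1)[OF \<phi>] by simp
    moreover have "u \<oplus> v \<in> U" using u(1) v(1) by (rule U.m_closed)
    ultimately show "x + y \<in> \<phi> ` U" by blast
  qed
qed

lemma carrier_submodule: "submodule (scalars K) (carrier V) V"
  by (simp add: LinearCombinations.submodule_def smult_closed module_axioms)

lemma rsub_carrier: "real_embedding V \<phi> \<Longrightarrow> rsub (\<phi> ` carrier V)"
  using rsub_submodule carrier_submodule by blast

lemma span_insert_eq:
  assumes A: "A \<subseteq> carrier V" and b: "b \<in> carrier V"
  shows "span (insert b A) = {s \<oplus> k \<odot> b | s k. s \<in> span A \<and> k \<in> K}"
proof -
  have "span {b} = {k \<odot> b | k. k \<in> K}"
  proof -
    have 1: "lincomb a {b} = a b \<odot> b" if "a b \<in> K" for a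
      unfolding lincomb_def using that b by simp
    show ?thesis
      unfolding finite_span[of "{b}", simplified, OF b]
    proof (intro equalityI subsetI)
      fix x assume "x \<in> {lincomb a {b} |a. a b \<in> K}"
      then show "x \<in> {k \<odot> b |k. k \<in> K}" using 1 by blast
    next
      fix x assume "x \<in> {k \<odot> b |k. k \<in> K}"
      then obtain k where "k \<in> K" "x = k \<odot> b" by blast
      then show "x \<in> {lincomb a {b} |a. a b \<in> K}" using 1[of "\<lambda>_. k"] by (intro CollectI exI[of _ "\<lambda>_. k"]) simp
    qed
  qed
  moreover have "insert b A = A \<union> {b}" by simp
  ultimately show ?thesis
    using span_union_is_sum[OF A, of "{b}"] b unfolding submodule_sum_def by auto
qed

lemma embed_adjoin:
  assumes \<phi>: "real_embedding V \<phi>" and U: "U \<subseteq> carrier V" "rsub (\<phi> ` U)" and c: "c \<in> carrier V"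
  shows "\<phi> ` {s \<oplus> complex_of_real r \<odot> c | s r. s \<in> U} = rspan (insert (\<phi> c) (\<phi> ` U))"
proof -
  have e: "\<phi> (s \<oplus> complex_of_real r \<odot> c) = \<phi> s + r *\<^sub>R \<phi> c" if "s \<in> U" for s r
    using that U(1) c real_embeddingD(1)[OF \<phi>, of s "complex_of_real r \<odot> c"] real_embeddingD(2)[OF \<phi> c, of r]
    by (simp add: smult_closed subset_iff)
  show ?thesis
    unfolding span_insert_subspace[OF U(2)]
  proof (intro equalityI subsetI)
    fix x assume "x \<in> \<phi> ` {s \<oplus> complex_of_real r \<odot> c | s r. s \<in> U}"
    then obtain s r where "s \<in> U" "x = \<phi> (s \<oplus> complex_of_real r \<odot> c)" by blast
    then show "x \<in> {w + r *\<^sub>R \<phi> c |w r. w \<in> \<phi> ` U}" using e by blast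
  next
    fix x assume "x \<in> {w + r *\<^sub>R \<phi> c |w r. w \<in> \<phi> ` U}"
    then obtain s r where "s \<in> U" "x = \<phi> (s \<oplus> complex_of_real r \<odot> c)" using e by auto
    then show "x \<in> \<phi> ` {s \<oplus> complex_of_real r \<odot> c | s r. s \<in> U}" by blast
  qed
qed

text \<open>
  Each basis vector \<open>b\<close> contributes \<open>b\<close> alone over the reals, and \<open>b\<close> and \<open>\<i>b\<close> over the complex
  numbers. In the latter case \<open>\<i>b\<close> is really independent of \<open>b\<close> and the previous vectors,
  because the nonzero multiple \<open>(\<i> - r) b\<close> of \<open>b\<close>, with \<open>r\<close> real, is not in the span of the
  previous vectors.
\<close>

lemma embed_span:
  assumes \<phi>: "real_embedding V \<phi>" and "finite A" and "A \<subseteq> carrier V" and "lin_indpt A"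
  shows "fincodim {0} (\<phi> ` span A) (scalar_dim K * card A)"
  using assms(2-4)
proof (induction A)
  case empty
  have "span {} = {\<zero>}" by (auto simp: span_def lincomb_def)
  then show ?case using embed_zero[OF \<phi>] fincodim.refl by simp
next
  case (insert b A)
  have A: "A \<subseteq> carrier V" and b: "b \<in> carrier V" using insert by auto
  have li: "lin_indpt A" using subset_li_is_li[OF insert.prems(2)] by blast
  have nb: "b \<notin> span A"
    using lin_dep_iff_in_span[OF A li b insert.hyps(2)] insert.prems(2) by simp
  have IH: "fincodim {0} (\<phi> ` span A) (scalar_dim K * card A)" using insert A li by blast
  have sm: "submodule (scalars K) (span A) V" using span_is_submodule[OF A] .
  have sc: "span A \<subseteq> carrier V" using sm submodule.subset by blast
  define T where "T = {s \<oplus> complex_of_real r \<odot> b | s r. s \<in> span A}"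
  have TV: "T \<subseteq> carrier V" unfolding T_def using sc b by (auto simp: smult_closed)
  have phiT: "\<phi> ` T = rspan (insert (\<phi> b) (\<phi> ` span A))"
    unfolding T_def by (rule embed_adjoin[OF \<phi> sc rsub_submodule[OF \<phi> sm] b])
  have "\<phi> b \<notin> \<phi> ` span A" using nb sc b real_embeddingD(3)[OF \<phi>] by (auto simp: inj_on_def)
  then have 1: "fincodim {0} (\<phi> ` T) (Suc (scalar_dim K * card A))"
    unfolding phiT by (rule fincodim.step[OF IH])
  show ?case
  proof (cases "K = \<real>")
    case True
    have "span (insert b A) = T"
      unfolding span_insert_eq[OF A b] T_def
    proof (intro equalityI subsetI)
      fix x assume "x \<in> {s \<oplus> k \<odot> b |s k. s \<in> span A \<and> k \<in> K}"
      then obtain s k where sk: "s \<in> span A" "k \<in> K" "x = s \<oplus> k \<odot> b" by blast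
      then obtain r where "k = complex_of_real r" using True by (auto elim: Reals_cases)
      then show "x \<in> {s \<oplus> complex_of_real r \<odot> b |s r. s \<in> span A}" using sk by blast
    qed (use K_of_real in blast)
    then show ?thesis using 1 True insert.hyps by (simp add: scalar_dim_def)
  next
    case False
    then have KU: "K = UNIV" using K_cases by blast
    have ib: "\<i> \<odot> b \<in> carrier V" using b KU by (simp add: smult_closed)
    have split: "s \<oplus> k \<odot> b = (s \<oplus> complex_of_real (Re k) \<odot> b) \<oplus> complex_of_real (Im k) \<odot> (\<i> \<odot> b)"
      if s: "s \<in> span A" for s k
    proof -
      have "k = complex_of_real (Re k) + complex_of_real (Im k) * \<i>"
        by (simp add: complex_eq_iff)
      then have "k \<odot> b = complex_of_real (Re k) \<odot> b \<oplus> complex_of_real (Im k) \<odot> (\<i> \<odot> b)"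
        using smult_l_distr[of "complex_of_real (Re k)" "complex_of_real (Im k) * \<i>" b]
          smult_assoc1[of "complex_of_real (Im k)" \<i> b] b KU by simp
      then show ?thesis using s sc b ib by (simp add: a_assoc smult_closed subset_iff)
    qed
    have span: "span (insert b A) = {t \<oplus> complex_of_real r \<odot> (\<i> \<odot> b) | t r. t \<in> T}"
      unfolding span_insert_eq[OF A b]
    proof (intro equalityI subsetI)
      fix x assume "x \<in> {s \<oplus> k \<odot> b |s k. s \<in> span A \<and> k \<in> K}"
      then show "x \<in> {t \<oplus> complex_of_real r \<odot> (\<i> \<odot> b) | t r. t \<in> T}" unfolding T_def using split by blast
    next
      fix x assume "x \<in> {t \<oplus> complex_of_real r \<odot> (\<i> \<odot> b) | t r. t \<in> T}"
      then obtain s r r' where s: "s \<in> span A"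
        "x = (s \<oplus> complex_of_real r \<odot> b) \<oplus> complex_of_real r' \<odot> (\<i> \<odot> b)" unfolding T_def by blast
      then have "x = s \<oplus> Complex r r' \<odot> b" using split[OF s(1), of "Complex r r'"] by simp
      then show "x \<in> {s \<oplus> k \<odot> b |s k. s \<in> span A \<and> k \<in> K}" using s KU by blast
    qed
    have "\<i> \<odot> b \<notin> T"
    proof
      assume "\<i> \<odot> b \<in> T"
      then obtain s r where s: "s \<in> span A" and eq: "\<i> \<odot> b = s \<oplus> complex_of_real r \<odot> b"
        unfolding T_def by blast
      have sV: "s \<in> carrier V" using s sc by blast
      define c where "c = \<i> - complex_of_real r"
      have c0: "c \<noteq> 0" unfolding c_def by (simp add: complex_eq_iff)
      have "\<i> \<odot> b = c \<odot> b \<oplus> complex_of_real r \<odot> b"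
        using smult_l_distr[of c "complex_of_real r" b] b KU unfolding c_def by simp
      then have "s = c \<odot> b" using eq sV b KU by (simp add: smult_closed)
      then have "inverse c \<odot> s = b" using smult_assoc1[of "inverse c" c b] b KU c0 smult_one[OF b] by simp
      then have "b \<in> span A" using submodule.smult_closed[OF sm, of "inverse c" s] s KU by simp
      then show False using nb by blast
    qed
    then have "\<phi> (\<i> \<odot> b) \<notin> \<phi> ` T" using ib TV real_embeddingD(3)[OF \<phi>] by (auto simp: inj_on_def)
    from fincodim.step[OF 1 this] show ?thesis
      unfolding span embed_adjoin[OF \<phi> TV _ ib, unfolded phiT, OF real_vector.subspace_span] phiT
      using False insert.hyps by (simp add: scalar_dim_def)
  qed
qed

lemma embed_findim:
  assumes \<phi>: "real_embedding V \<phi>"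
  shows "fin_dim \<longleftrightarrow> (\<exists>n. fincodim {0} (\<phi> ` carrier V) n)"
    and "fin_dim \<Longrightarrow> fincodim {0} (\<phi> ` carrier V) (scalar_dim K * dim)"
proof -
  show 1: "fincodim {0} (\<phi> ` carrier V) (scalar_dim K * dim)" if f: fin_dim
  proof -
    obtain B where B: "finite B" "basis B" using finite_basis_exists[OF f] by blast
    then show ?thesis using embed_span[OF \<phi> B(1)] dim_basis[OF B] unfolding basis_def by auto
  qed
  have "fin_dim" if f: "fincodim {0} (\<phi> ` carrier V) n" for n
  proof -
    obtain B where B: "finite B" "rspan B = \<phi> ` carrier V" using fincodim_zero_basis[OF f] by blast
    then have "B \<subseteq> \<phi> ` carrier V" using real_vector.span_superset by blast
    then obtain A where A: "finite A" "A \<subseteq> carrier V" "B = \<phi> ` A"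
      using B(1) finite_subset_image by metis
    have sm: "submodule (scalars K) (span A) V" using span_is_submodule[OF A(2)] .
    have "B \<subseteq> \<phi> ` span A" using A in_own_span[OF A(2)] by blast
    then have "\<phi> ` carrier V \<subseteq> \<phi> ` span A"
      using real_vector.span_minimal[OF _ rsub_submodule[OF \<phi> sm]] B by metis
    then have "carrier V \<subseteq> span A"
      using real_embeddingD(3)[OF \<phi>] submodule.subset[OF sm] by (simp add: inj_on_image_subset_iff)
    then have "span A = carrier V" using submodule.subset[OF sm] by blast
    then show ?thesis unfolding fin_dim_def using A by blast
  qed
  then show "fin_dim \<longleftrightarrow> (\<exists>n. fincodim {0} (\<phi> ` carrier V) n)" using 1 by blast
qed

end

lemma (in kspace)
  assumes W: "submodule (scalars K) W V"
  shows quotient_kspace: "kspace K (quotient_space V W)"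
    and quotient_carrier: "carrier (quotient_space V W) = (\<lambda>x. W +> x) ` carrier V"
    and quotient_add: "\<lbrakk>x \<in> carrier V; y \<in> carrier V\<rbrakk> \<Longrightarrow>
      (W +> x) \<oplus>\<^bsub>quotient_space V W\<^esub> (W +> y) = W +> (x \<oplus> y)"
    and quotient_smult: "\<lbrakk>a \<in> K; x \<in> carrier V\<rbrakk> \<Longrightarrow>
      a \<odot>\<^bsub>quotient_space V W\<^esub> (W +> x) = W +> (a \<odot> x)"
    and coset_eq: "\<lbrakk>x \<in> carrier V; y \<in> carrier V\<rbrakk> \<Longrightarrow> W +> x = W +> y \<longleftrightarrow> x \<ominus> y \<in> W"
proof -
  interpret W: submodule "scalars K" W V by fact
  have WV: "W \<subseteq> carrier V" by (rule W.subset)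
  have neg: "\<ominus> x \<in> W" if "x \<in> W" for x
    using W.smult_closed[OF R.a_inv_closed[OF R.one_closed] that] smult_minus_1 that WV by (metis subsetD)
  have "additive_subgroup W V"
    by (intro additive_subgroupI subgroup.intro) (use WV neg in \<open>auto simp: a_inv_def\<close>)
  then interpret Ws: abelian_subgroup W V
    by (rule abelian_subgroupI3) (rule abelian_group_axioms)
  let ?Q = "quotient_space V W"
  show car: "carrier ?Q = (\<lambda>x. W +> x) ` carrier V"
    unfolding quotient_space_def A_RCOSETS_def' by auto
  show add: "(W +> x) \<oplus>\<^bsub>?Q\<^esub> (W +> y) = W +> (x \<oplus> y)" if "x \<in> carrier V" "y \<in> carrier V" for x y
    unfolding quotient_space_def using Ws.a_rcos_sum that by simp
  show eq: "W +> x = W +> y \<longleftrightarrow> x \<ominus> y \<in> W" if "x \<in> carrier V" "y \<in> carrier V" for x y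
  proof -
    have "W +> x = W +> y \<longleftrightarrow> x \<in> W +> y"
      using Ws.a_repr_independenceD[of x y] Ws.a_repr_independence'[of x y] that by auto
    then show ?thesis using Ws.a_rcos_module[OF that(2,1)] by (simp add: a_minus_def)
  qed
  show sm: "a \<odot>\<^bsub>?Q\<^esub> (W +> x) = W +> (a \<odot> x)" if a: "a \<in> K" and x: "x \<in> carrier V" for a x
  proof -
    have const: "W +> (a \<odot> z) = W +> (a \<odot> x)" if z: "z \<in> W +> x" for z
    proof -
      have zV: "z \<in> carrier V" using Ws.a_elemrcos_carrier[OF x z] .
      have "z \<oplus> \<ominus> x \<in> W" using Ws.a_rcos_module_imp[OF x z] .
      then have "a \<odot> (z \<oplus> \<ominus> x) \<in> W" using W.smult_closed a by simp
      then have "a \<odot> z \<ominus> a \<odot> x \<in> W"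
        using a x zV by (simp add: smult_r_distr smult_r_minus a_minus_def)
      then show ?thesis using eq[of "a \<odot> z" "a \<odot> x"] a x zV by (simp add: smult_closed)
    qed
    have "a \<odot>\<^bsub>?Q\<^esub> (W +> x) = (\<Union>z\<in>W +> x. W +> (a \<odot> z))"
      unfolding quotient_space_def by simp
    also have "\<dots> = W +> (a \<odot> x)"
    proof (rule SUP_eq_const)
      show "W +> x \<noteq> {}" using Ws.a_rcos_self[OF x] by blast
    qed (rule const)
    finally show ?thesis .
  qed
  have zero: "\<zero>\<^bsub>?Q\<^esub> = W +> \<zero>" unfolding quotient_space_def using WV by simp
  have "module (scalars K) ?Q"
  proof (rule module_criteria)
    show "cring (scalars K)" by (rule R.is_cring)
    show "\<forall>v\<in>carrier ?Q. \<exists>neg_v\<in>carrier ?Q. v \<oplus>\<^bsub>?Q\<^esub> neg_v = \<zero>\<^bsub>?Q\<^esub>"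
    proof
      fix v assume "v \<in> carrier ?Q"
      then obtain x where "x \<in> carrier V" "v = W +> x" unfolding car by blast
      then show "\<exists>neg_v\<in>carrier ?Q. v \<oplus>\<^bsub>?Q\<^esub> neg_v = \<zero>\<^bsub>?Q\<^esub>"
        by (intro bexI[of _ "W +> (\<ominus> x)"]) (simp_all add: zero add car r_neg)
    qed
    have Kc: "a + b \<in> K" "a * b \<in> K" if "a \<in> K" "b \<in> K" for a b
      using R.a_closed[of a b] R.m_closed[of a b] that by simp_all
    have l: "(a + b) \<odot> x = a \<odot> x \<oplus> b \<odot> x" "(a * b) \<odot> x = a \<odot> (b \<odot> x)" "1 \<odot> x = x"
      if "a \<in> K" "b \<in> K" "x \<in> carrier V" for a b x
      using smult_l_distr[of a b x] smult_assoc1[of a b x] smult_one[of x] that by simp_all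
    have "1 \<in> K" using R.one_closed by simp
    then show "\<forall>v\<in>carrier ?Q. \<one>\<^bsub>scalars K\<^esub> \<odot>\<^bsub>?Q\<^esub> v = v" using l(3) by (auto simp: car sm)
    show "\<forall>a b v. a \<in> carrier (scalars K) \<and> b \<in> carrier (scalars K) \<and> v \<in> carrier ?Q \<longrightarrow>
      (a \<otimes>\<^bsub>scalars K\<^esub> b) \<odot>\<^bsub>?Q\<^esub> v = a \<odot>\<^bsub>?Q\<^esub> (b \<odot>\<^bsub>?Q\<^esub> v)"
      using l(2) Kc by (auto simp: car sm smult_closed)
    show "\<forall>a b v. a \<in> carrier (scalars K) \<and> b \<in> carrier (scalars K) \<and> v \<in> carrier ?Q \<longrightarrow>
      (a \<oplus>\<^bsub>scalars K\<^esub> b) \<odot>\<^bsub>?Q\<^esub> v = a \<odot>\<^bsub>?Q\<^esub> v \<oplus>\<^bsub>?Q\<^esub> b \<odot>\<^bsub>?Q\<^esub> v"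
      using l(1) Kc by (auto simp: car sm add smult_closed)
  qed (auto simp: car add sm zero smult_closed a_ac smult_r_distr)
  then show "kspace K ?Q"
    by (intro kspace.intro vectorspace.intro kspace_axioms.intro field_axioms K_cases)
qed

context kspace
begin

lemma embed_subspace:
  assumes \<phi>: "real_embedding V \<phi>" and U: "submodule (scalars K) U V"
  shows "findim K (V\<lparr>carrier := U\<rparr>) \<longleftrightarrow> (\<exists>n. fincodim {0} (\<phi> ` U) n)"
    and "findim K (V\<lparr>carrier := U\<rparr>) \<Longrightarrow>
      fincodim {0} (\<phi> ` U) (scalar_dim K * vdim K (V\<lparr>carrier := U\<rparr>))"
  using kspace.embed_findim[OF kspace_submodule[OF U] real_embedding_subspace[OF \<phi> submodule.subset[OF U]]]
  by simp_all

text \<open>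
  Composing \<open>\<phi>\<close> with a quotient map by the image of \<open>W\<close> gives a real embedding of the space of
  cosets.
\<close>

lemma embed_quotient:
  fixes \<phi> :: "'a \<Rightarrow> 'b::real_vector"
  assumes \<phi>: "real_embedding V \<phi>" and W: "submodule (scalars K) W V"
  shows "findim K (quotient_space V W) \<longleftrightarrow> (\<exists>n. fincodim (\<phi> ` W) (\<phi> ` carrier V) n)"
    and "findim K (quotient_space V W) \<Longrightarrow>
      fincodim (\<phi> ` W) (\<phi> ` carrier V) (scalar_dim K * vdim K (quotient_space V W))"
proof -
  let ?Q = "quotient_space V W"
  have WV: "W \<subseteq> carrier V" using submodule.subset[OF W] .
  note car = quotient_carrier[OF W] and add = quotient_add[OF W] and sm = quotient_smult[OF W]
    and eq = coset_eq[OF W]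
  have rW: "rsub (\<phi> ` W)" and rV: "rsub (\<phi> ` carrier V)"
    using rsub_submodule[OF \<phi>] W carrier_submodule by blast+
  obtain q :: "'b \<Rightarrow> 'b" where q: "linear q" "\<And>x. q x = 0 \<longleftrightarrow> x \<in> \<phi> ` W"
    by (rule quotient_map_exists[OF rW]) blast
  define \<psi> where "\<psi> A = q (\<phi> (SOME x. x \<in> carrier V \<and> A = W +> x))" for A
  have q_eq: "q (\<phi> x) = q (\<phi> y) \<longleftrightarrow> x \<ominus> y \<in> W" if x: "x \<in> carrier V" and y: "y \<in> carrier V" for x y
  proof -
    have "q (\<phi> x) = q (\<phi> y) \<longleftrightarrow> q (\<phi> (x \<ominus> y)) = 0"
      using embed_minus[OF \<phi> x y] q(1) by (simp add: linear_diff)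
    also have "\<dots> \<longleftrightarrow> x \<ominus> y \<in> W"
      unfolding q(2) using inj_on_image_mem_iff[OF real_embeddingD(3)[OF \<phi>] minus_closed[OF x y] WV] .
    finally show ?thesis .
  qed
  have \<psi>: "\<psi> (W +> x) = q (\<phi> x)" if x: "x \<in> carrier V" for x
  proof -
    define y where "y = (SOME y. y \<in> carrier V \<and> W +> x = W +> y)"
    have "y \<in> carrier V \<and> W +> x = W +> y" unfolding y_def by (rule someI[of _ x]) (use x in simp)
    then have "q (\<phi> x) = q (\<phi> y)" using eq[OF x, of y] q_eq[OF x, of y] by blast
    then show ?thesis unfolding \<psi>_def y_def by simp
  qed
  have "real_embedding ?Q \<psi>"
    unfolding real_embedding_def
  proof (intro conjI ballI allI)
    fix A assume "A \<in> carrier ?Q"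
    then obtain x where x: "x \<in> carrier V" "A = W +> x" unfolding car by blast
    show "\<psi> (complex_of_real r \<odot>\<^bsub>?Q\<^esub> A) = r *\<^sub>R \<psi> A" for r
      using x real_embeddingD(2)[OF \<phi> x(1), of r] q(1) by (simp add: sm \<psi> smult_closed linear_scale)
    fix B assume "B \<in> carrier ?Q"
    then obtain y where y: "y \<in> carrier V" "B = W +> y" unfolding car by blast
    show "\<psi> (A \<oplus>\<^bsub>?Q\<^esub> B) = \<psi> A + \<psi> B"
      using x y real_embeddingD(1)[OF \<phi> x(1) y(1)] q(1) by (simp add: add \<psi> linear_add)
  next
    show "inj_on \<psi> (carrier ?Q)"
    proof (rule inj_onI)
      fix A B assume "A \<in> carrier ?Q" "B \<in> carrier ?Q" and e: "\<psi> A = \<psi> B"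
      then obtain x y where "x \<in> carrier V" "A = W +> x" "y \<in> carrier V" "B = W +> y" unfolding car by blast
      then show "A = B" using e eq[of x y] q_eq[of x y] by (simp add: \<psi>)
    qed
  qed
  note Q = kspace.embed_findim[OF quotient_kspace[OF W] this]
  have "\<psi> ` carrier ?Q = q ` \<phi> ` carrier V" unfolding car image_image using \<psi> by (rule image_cong[OF HOL.refl])
  then have "fincodim {0} (\<psi> ` carrier ?Q) n \<longleftrightarrow> fincodim (\<phi> ` W) (\<phi> ` carrier V) n" for n
    using fincodim_quotient_map[OF q rW rV image_mono[OF WV]] by simp
  then show "findim K ?Q \<longleftrightarrow> (\<exists>n. fincodim (\<phi> ` W) (\<phi> ` carrier V) n)"
    and "findim K ?Q \<Longrightarrow> fincodim (\<phi> ` W) (\<phi> ` carrier V) (scalar_dim K * vdim K ?Q)"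
    using Q by auto
qed

lemma embed_subquotient:
  assumes \<phi>: "real_embedding V \<phi>" and U: "submodule (scalars K) U V"
    and W: "submodule (scalars K) W V" and WU: "W \<subseteq> U"
  shows "findim K (quotient_space (V\<lparr>carrier := U\<rparr>) W) \<longleftrightarrow> (\<exists>n. fincodim (\<phi> ` W) (\<phi> ` U) n)"
    and "findim K (quotient_space (V\<lparr>carrier := U\<rparr>) W) \<Longrightarrow>
      fincodim (\<phi> ` W) (\<phi> ` U) (scalar_dim K * vdim K (quotient_space (V\<lparr>carrier := U\<rparr>) W))"
proof -
  have "submodule (scalars K) W (V\<lparr>carrier := U\<rparr>)"
    using submodule_is_module[OF U] W WU unfolding LinearCombinations.submodule_def by simp
  from kspace.embed_quotient[OF kspace_submodule[OF U] real_embedding_subspace[OF \<phi> submodule.subset[OF U]] this]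
  show "findim K (quotient_space (V\<lparr>carrier := U\<rparr>) W) \<longleftrightarrow> (\<exists>n. fincodim (\<phi> ` W) (\<phi> ` U) n)"
    and "findim K (quotient_space (V\<lparr>carrier := U\<rparr>) W) \<Longrightarrow>
      fincodim (\<phi> ` W) (\<phi> ` U) (scalar_dim K * vdim K (quotient_space (V\<lparr>carrier := U\<rparr>) W))"
    by simp_all
qed

end

lemma embed_hom:
  assumes X: "kspace K X" and A: "A \<in> module_hom (scalars K) X Y"
    and \<phi>: "real_embedding X \<phi>" and \<psi>: "real_embedding Y \<psi>"
  shows "\<exists>a. linear a \<and> (\<forall>x\<in>carrier X. a (\<phi> x) = \<psi> (A x))"
proof -
  interpret X: kspace K X by fact
  have AX: "A x \<in> carrier Y" if "x \<in> carrier X" for x using module_hom_closed[OF A] that by blast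
  define f where "f u = \<psi> (A (inv_into (carrier X) \<phi> u))" for u
  have f: "f (\<phi> x) = \<psi> (A x)" if "x \<in> carrier X" for x
    unfolding f_def using inv_into_f_f[OF real_embeddingD(3)[OF \<phi>] that] by simp
  have "\<exists>a. linear a \<and> (\<forall>u\<in>\<phi> ` carrier X. a u = f u)"
  proof (rule linear_extension[OF X.rsub_carrier[OF \<phi>]])
    fix u v assume "u \<in> \<phi> ` carrier X" "v \<in> \<phi> ` carrier X"
    then obtain x y where xy: "x \<in> carrier X" "y \<in> carrier X" "u = \<phi> x" "v = \<phi> y" by blast
    have "u + v = \<phi> (x \<oplus>\<^bsub>X\<^esub> y)" using real_embeddingD(1)[OF \<phi>] xy by simp
    then show "f (u + v) = f u + f v"
      using xy f AX module_hom_add[OF A] real_embeddingD(1)[OF \<psi>] by simp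
  next
    fix r u assume "u \<in> \<phi> ` carrier X"
    then obtain x where x: "x \<in> carrier X" "u = \<phi> x" by blast
    have "r *\<^sub>R u = \<phi> (complex_of_real r \<odot>\<^bsub>X\<^esub> x)" using real_embeddingD(2)[OF \<phi>] x by simp
    then show "f (r *\<^sub>R u) = r *\<^sub>R f u"
      using x f AX module_hom_smult[OF A, of "complex_of_real r" x] real_embeddingD(2)[OF \<psi>]
      by (simp add: X.smult_closed)
  qed
  then show ?thesis using f by auto
qed

lemma embed_fredholm:
  assumes X: "kspace K X" and Y: "kspace K Y" and A: "A \<in> module_hom (scalars K) X Y"
    and \<phi>: "real_embedding X \<phi>" and \<psi>: "real_embedding Y \<psi>"
    and a: "\<And>x. x \<in> carrier X \<Longrightarrow> a (\<phi> x) = \<psi> (A x)"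
  defines "ker \<equiv> subspace_of X (a_kernel X Y A)" and "coker \<equiv> quotient_space Y (A ` carrier X)"
  shows "findim K ker \<and> findim K coker \<longleftrightarrow> (\<exists>i. fredholm_pair a (\<phi> ` carrier X) (\<psi> ` carrier Y) i)"
    and "\<lbrakk>findim K ker; findim K coker\<rbrakk> \<Longrightarrow> fredholm_pair a (\<phi> ` carrier X) (\<psi> ` carrier Y)
      (int (scalar_dim K) * (int (vdim K ker) - int (vdim K coker)))"
proof -
  interpret X: kspace K X by fact
  interpret Y: kspace K Y by fact
  interpret A: mod_hom "scalars K" X Y A
    using A by (intro mod_hom.intro mod_hom_axioms.intro X.module_axioms Y.module_axioms)
  have ker: "submodule (scalars K) (a_kernel X Y A) X" "a_kernel X Y A = {x\<in>carrier X. A x = \<zero>\<^bsub>Y\<^esub>}"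
    using A.ker_is_submodule unfolding A.ker_def a_kernel_def' by auto
  have im: "submodule (scalars K) (A ` carrier X) Y"
    using A.im_is_submodule unfolding A.im_def .
  have "\<psi> (A x) = 0 \<longleftrightarrow> A x = \<zero>\<^bsub>Y\<^esub>" if "x \<in> carrier X" for x
    using real_embeddingD(4)[OF \<psi> A.f_im[OF that] Y.zero_closed] Y.embed_zero[OF \<psi>] by simp
  then have 1: "\<phi> ` a_kernel X Y A = nullset a (\<phi> ` carrier X)" unfolding ker(2) using a Y.embed_zero[OF \<psi>] by auto
  have 2: "\<psi> ` A ` carrier X = a ` \<phi> ` carrier X" unfolding image_image using a by auto
  note k = X.embed_subspace[OF \<phi> ker(1), unfolded 1, folded ker_def]
    and c = Y.embed_quotient[OF \<psi> im, unfolded 2, folded coker_def]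
  show "findim K ker \<and> findim K coker \<longleftrightarrow> (\<exists>i. fredholm_pair a (\<phi> ` carrier X) (\<psi> ` carrier Y) i)"
    unfolding k(1) c(1) fredholm_pair_def by blast
  show "fredholm_pair a (\<phi> ` carrier X) (\<psi> ` carrier Y)
      (int (scalar_dim K) * (int (vdim K ker) - int (vdim K coker)))" if "findim K ker" "findim K coker"
    by (rule fredholm_pairI[OF k(2)[OF that(1)] c(2)[OF that(2)]]) (simp add: right_diff_distrib)
qed

sublocale hilbert_space \<subseteq> kspace K X
  by unfold_locales (rule real_or_complex)

section \<open>Hilbert spaces as real subspaces\<close>

text \<open>
  Every Hilbert space with carrier in the type \<open>'a\<close> becomes a subspace of the one real vector
  space of functions \<open>'a \<Rightarrow> complex\<close>; the inner product is nondegenerate, so \<open>x \<mapsto> \<langle>x, \<cdot>\<rangle>\<close> is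
  injective.
\<close>

definition riesz_embedding :: "'a ipspace \<Rightarrow> 'a \<Rightarrow> 'a \<Rightarrow> complex" where
  "riesz_embedding X x = (\<lambda>y. if y \<in> carrier X then iprod X x y else 0)"

definition real_iprod :: "'a ipspace \<Rightarrow> ('a \<Rightarrow> complex) \<Rightarrow> ('a \<Rightarrow> complex) \<Rightarrow> real" where
  "real_iprod X u v = Re (iprod X (inv_into (carrier X) (riesz_embedding X) u)
    (inv_into (carrier X) (riesz_embedding X) v))"

context hilbert_space
begin

lemma iprod_zero_left [simp]: "y \<in> carrier X \<Longrightarrow> iprod X \<zero>\<^bsub>X\<^esub> y = 0"
  using iprod_add_left[of "\<zero>\<^bsub>X\<^esub>" "\<zero>\<^bsub>X\<^esub>" y] by simp

lemma iprod_zero_right [simp]: "y \<in> carrier X \<Longrightarrow> iprod X y \<zero>\<^bsub>X\<^esub> = 0"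
  using iprod_cnj[of "\<zero>\<^bsub>X\<^esub>" y] by simp

lemma iprod_minus_left:
  assumes "x \<in> carrier X" "y \<in> carrier X" "z \<in> carrier X"
  shows "iprod X (x \<ominus>\<^bsub>X\<^esub> y) z = iprod X x z - iprod X y z"
proof -
  have "(x \<ominus>\<^bsub>X\<^esub> y) \<oplus>\<^bsub>X\<^esub> y = x" using assms by (simp add: a_minus_def M.a_assoc M.l_neg)
  then show ?thesis using iprod_add_left[of "x \<ominus>\<^bsub>X\<^esub> y" y z] assms by simp
qed

lemma iprod_add_right:
  "\<lbrakk>x \<in> carrier X; y \<in> carrier X; z \<in> carrier X\<rbrakk>
    \<Longrightarrow> iprod X z (x \<oplus>\<^bsub>X\<^esub> y) = iprod X z x + iprod X z y"
  using iprod_cnj[of z "x \<oplus>\<^bsub>X\<^esub> y"] iprod_cnj[of x z] iprod_cnj[of y z] iprod_add_left[of x y z]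
    iprod_cnj[of "x \<oplus>\<^bsub>X\<^esub> y" z] by simp

lemma iprod_smult_right:
  "\<lbrakk>a \<in> K; x \<in> carrier X; y \<in> carrier X\<rbrakk> \<Longrightarrow> iprod X x (a \<odot>\<^bsub>X\<^esub> y) = cnj a * iprod X x y"
  using iprod_cnj[of "a \<odot>\<^bsub>X\<^esub> y" x] iprod_cnj[of y x] iprod_smult_left[of a y x] smult_closed[of a y]
  by simp

lemma iprod_eqI:
  assumes "x \<in> carrier X" "y \<in> carrier X" "\<And>z. z \<in> carrier X \<Longrightarrow> iprod X x z = iprod X y z"
  shows "x = y"
proof (rule ccontr)
  assume "x \<noteq> y"
  have "(x \<ominus>\<^bsub>X\<^esub> y) \<oplus>\<^bsub>X\<^esub> y = x" using assms by (simp add: a_minus_def M.a_assoc M.l_neg)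
  then have "x \<ominus>\<^bsub>X\<^esub> y \<noteq> \<zero>\<^bsub>X\<^esub>" using \<open>x \<noteq> y\<close> assms by auto
  then have "0 < Re (iprod X (x \<ominus>\<^bsub>X\<^esub> y) (x \<ominus>\<^bsub>X\<^esub> y))" using assms by (intro iprod_pos) auto
  then show False using assms by (simp add: iprod_minus_left)
qed

lemma riesz_embedding: "real_embedding X (riesz_embedding X)"
  unfolding real_embedding_def
proof (intro conjI ballI allI)
  fix x assume x: "x \<in> carrier X"
  show "riesz_embedding X (complex_of_real r \<odot>\<^bsub>X\<^esub> x) = r *\<^sub>R riesz_embedding X x" for r
    using x unfolding riesz_embedding_def
    by (auto simp: scaleR_fun_def fun_eq_iff iprod_smult_left scaleR_conv_of_real)
  fix y assume "y \<in> carrier X"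
  then show "riesz_embedding X (x \<oplus>\<^bsub>X\<^esub> y) = riesz_embedding X x + riesz_embedding X y"
    using x unfolding riesz_embedding_def by (auto simp: fun_eq_iff iprod_add_left)
next
  show "inj_on (riesz_embedding X) (carrier X)"
  proof (rule inj_onI)
    fix x y assume xy: "x \<in> carrier X" "y \<in> carrier X" "riesz_embedding X x = riesz_embedding X y"
    show "x = y"
      by (rule iprod_eqI[OF xy(1,2)]) (use fun_cong[OF xy(3)] in \<open>simp add: riesz_embedding_def, metis\<close>)
  qed
qed

lemma real_iprod:
  "\<lbrakk>x \<in> carrier X; y \<in> carrier X\<rbrakk> \<Longrightarrow>
    real_iprod X (riesz_embedding X x) (riesz_embedding X y) = Re (iprod X x y)"
  unfolding real_iprod_def using inv_into_f_f[OF real_embeddingD(3)[OF riesz_embedding]] by simp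

lemma real_hilbert: "real_hilbert (riesz_embedding X ` carrier X) (real_iprod X)"
proof -
  let ?R = "riesz_embedding X"
  note R = riesz_embedding
  note D = real_embeddingD[OF R]
  show ?thesis
  proof
    show "rsub (?R ` carrier X)" by (rule rsub_carrier[OF R])
    fix u v assume "u \<in> ?R ` carrier X" "v \<in> ?R ` carrier X"
    then obtain x y where xy: "x \<in> carrier X" "y \<in> carrier X" "u = ?R x" "v = ?R y" by blast
    show "real_iprod X u v = real_iprod X v u"
      using xy real_iprod iprod_cnj[OF xy(2,1)] by simp
    show "real_iprod X (r *\<^sub>R u) v = r * real_iprod X u v" for r
    proof -
      have "r *\<^sub>R u = ?R (complex_of_real r \<odot>\<^bsub>X\<^esub> x)" using D(2) xy by simp
      then show ?thesis using xy by (simp add: real_iprod smult_closed iprod_smult_left)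
    qed
    fix w assume "w \<in> ?R ` carrier X"
    then obtain z where z: "z \<in> carrier X" "w = ?R z" by blast
    have "u + v = ?R (x \<oplus>\<^bsub>X\<^esub> y)" using D(1) xy by simp
    then show "real_iprod X (u + v) w = real_iprod X u w + real_iprod X v w"
      using xy z by (simp add: real_iprod iprod_add_left)
  next
    fix u assume "u \<in> ?R ` carrier X" "u \<noteq> 0"
    then obtain x where x: "x \<in> carrier X" "u = ?R x" by blast
    then have "x \<noteq> \<zero>\<^bsub>X\<^esub>" using \<open>u \<noteq> 0\<close> embed_zero[OF R] by metis
    then show "0 < real_iprod X u u" using x iprod_pos by (simp add: real_iprod)
  next
    fix f :: "nat \<Rightarrow> 'a \<Rightarrow> complex"
    assume "\<forall>i. f i \<in> ?R ` carrier X"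
      and c: "\<forall>e>0. \<exists>N. \<forall>i\<ge>N. \<forall>j\<ge>N. real_iprod X (f i - f j) (f i - f j) < e"
    then have "\<forall>i. \<exists>x. x \<in> carrier X \<and> f i = ?R x" by blast
    then obtain g where g: "\<And>i. g i \<in> carrier X" "\<And>i. f i = ?R (g i)" by metis
    have sq: "real_iprod X (?R x - ?R y) (?R x - ?R y) = (hnorm X (x \<ominus>\<^bsub>X\<^esub> y))\<^sup>2"
      if "x \<in> carrier X" "y \<in> carrier X" for x y
    proof -
      have xy: "x \<ominus>\<^bsub>X\<^esub> y \<in> carrier X" using that by simp
      have "0 \<le> Re (iprod X (x \<ominus>\<^bsub>X\<^esub> y) (x \<ominus>\<^bsub>X\<^esub> y))"
        using iprod_pos[OF xy] iprod_zero_left[OF xy] by (cases "x \<ominus>\<^bsub>X\<^esub> y = \<zero>\<^bsub>X\<^esub>") auto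
      then show ?thesis
        unfolding embed_minus[OF R that, symmetric] hnorm_def using real_iprod[OF xy xy] by simp
    qed
    have "\<exists>l\<in>carrier X. (\<lambda>i. hnorm X (g i \<ominus>\<^bsub>X\<^esub> l)) \<longlonglongrightarrow> 0"
    proof (rule complete)
      show "\<forall>i. g i \<in> carrier X" using g by blast
      show "\<forall>e>0. \<exists>N. \<forall>i\<ge>N. \<forall>j\<ge>N. hnorm X (g i \<ominus>\<^bsub>X\<^esub> g j) < e"
      proof (intro allI impI)
        fix e :: real assume e: "0 < e"
        then have "0 < e\<^sup>2" by simp
        then obtain N where N: "\<And>i j. i \<ge> N \<Longrightarrow> j \<ge> N \<Longrightarrow> real_iprod X (f i - f j) (f i - f j) < e\<^sup>2"
          using c by blast
        have "hnorm X (g i \<ominus>\<^bsub>X\<^esub> g j) < e" if "i \<ge> N" "j \<ge> N" for i j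
          using N[OF that] sq[OF g(1) g(1), of i j] e g(2) by (auto intro: power2_less_imp_less)
        then show "\<exists>N. \<forall>i\<ge>N. \<forall>j\<ge>N. hnorm X (g i \<ominus>\<^bsub>X\<^esub> g j) < e" by blast
      qed
    qed
    then obtain l where l: "l \<in> carrier X" "(\<lambda>i. hnorm X (g i \<ominus>\<^bsub>X\<^esub> l)) \<longlonglongrightarrow> 0" by blast
    have "(\<lambda>i. (hnorm X (g i \<ominus>\<^bsub>X\<^esub> l))\<^sup>2) \<longlonglongrightarrow> 0\<^sup>2" by (rule tendsto_power[OF l(2)])
    then have "(\<lambda>i. real_iprod X (f i - ?R l) (f i - ?R l)) \<longlonglongrightarrow> 0"
      using sq[OF g(1) l(1)] g(2) by simp
    then show "\<exists>l\<in>?R ` carrier X. (\<lambda>i. real_iprod X (f i - l) (f i - l)) \<longlonglongrightarrow> 0"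
      using l(1) by blast
  qed
qed

end

section \<open>Adjoints and orthogonal direct sums\<close>

lemma (in hilbert_space) hnorm_nonneg [simp]: "x \<in> carrier X \<Longrightarrow> 0 \<le> hnorm X x"
  unfolding hnorm_def using iprod_pos[of x] by (cases "x = \<zero>\<^bsub>X\<^esub>") auto

lemma (in hilbert_space) hnorm_sq: "x \<in> carrier X \<Longrightarrow> (hnorm X x)\<^sup>2 = Re (iprod X x x)"
  unfolding hnorm_def using iprod_pos[of x] by (cases "x = \<zero>\<^bsub>X\<^esub>") auto

lemma (in hilbert_space) hnorm_zero [simp]: "hnorm X \<zero>\<^bsub>X\<^esub> = 0"
  unfolding hnorm_def by simp

lemma (in hilbert_space) nrm_embed: "x \<in> carrier X \<Longrightarrow> real_hilbert.nrm (real_iprod X) (riesz_embedding X x) = hnorm X x"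
  unfolding real_hilbert.nrm_def[OF real_hilbert] hnorm_def by (simp add: real_iprod)

lemma (in hilbert_space) iprod_eqI_right:
  assumes "x \<in> carrier X" "y \<in> carrier X" "\<And>z. z \<in> carrier X \<Longrightarrow> iprod X z x = iprod X z y"
  shows "x = y"
  by (rule iprod_eqI[OF assms(1,2)]) (use assms iprod_cnj in metis)

text \<open>
  The real form of the Riesz theorem represents the real part of \<open>\<langle>A u, y\<rangle>\<close>. Over the complex
  numbers the imaginary part follows by replacing \<open>u\<close> by \<open>\<i>u\<close>; over the reals it is zero.
\<close>

lemma hadjoint:
  assumes X: "hilbert_space K X" and Y: "hilbert_space K Y" and A: "A \<in> bounded_maps K X Y"
    and y: "y \<in> carrier Y"
  shows "hadjoint X Y A y \<in> carrier X"
    and "u \<in> carrier X \<Longrightarrow> iprod Y (A u) y = iprod X u (hadjoint X Y A y)"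
proof -
  interpret X: hilbert_space K X by fact
  interpret Y: hilbert_space K Y by fact
  let ?R = "riesz_embedding X"
  note R = X.riesz_embedding
  have hom: "A \<in> module_hom (scalars K) X Y" using A unfolding bounded_maps_def by blast
  obtain C where C: "\<And>x. x \<in> carrier X \<Longrightarrow> hnorm Y (A x) \<le> C * hnorm X x"
    using A unfolding bounded_maps_def by blast
  have AX: "A x \<in> carrier Y" if "x \<in> carrier X" for x using module_hom_closed[OF hom] that by blast
  define f where "f v = Re (iprod Y (A (inv_into (carrier X) ?R v)) y)" for v
  have f: "f (?R x) = Re (iprod Y (A x) y)" if "x \<in> carrier X" for x
    unfolding f_def using inv_into_f_f[OF real_embeddingD(3)[OF R] that] by simp
  have "\<exists>z\<in>?R ` carrier X. \<forall>x\<in>?R ` carrier X. f x = real_iprod X x z"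
  proof (rule real_hilbert.Riesz[OF X.real_hilbert])
    fix u v assume "u \<in> ?R ` carrier X" "v \<in> ?R ` carrier X"
    then obtain a b where ab: "a \<in> carrier X" "b \<in> carrier X" "u = ?R a" "v = ?R b" by blast
    have "u + v = ?R (a \<oplus>\<^bsub>X\<^esub> b)" using real_embeddingD(1)[OF R] ab by simp
    then show "f (u + v) = f u + f v"
      using ab f AX module_hom_add[OF hom] Y.iprod_add_left y by simp
  next
    fix r u assume "u \<in> ?R ` carrier X"
    then obtain a where a: "a \<in> carrier X" "u = ?R a" by blast
    have "r *\<^sub>R u = ?R (complex_of_real r \<odot>\<^bsub>X\<^esub> a)" using real_embeddingD(2)[OF R] a by simp
    then show "f (r *\<^sub>R u) = r * f u"
      using a f AX module_hom_smult[OF hom, of "complex_of_real r" a] y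
      by (simp add: X.smult_closed Y.iprod_smult_left)
  next
    fix u assume "u \<in> ?R ` carrier X"
    then obtain a where a: "a \<in> carrier X" "u = ?R a" by blast
    have "\<bar>f u\<bar> = \<bar>real_iprod Y (riesz_embedding Y (A a)) (riesz_embedding Y y)\<bar>"
      using f a AX y by (simp add: Y.real_iprod)
    also have "\<dots> \<le> hnorm Y (A a) * hnorm Y y"
      using real_hilbert.ip_le[OF Y.real_hilbert, of "riesz_embedding Y (A a)" "riesz_embedding Y y"] AX[OF a(1)] y
      by (simp add: Y.nrm_embed)
    also have "\<dots> \<le> (C * hnorm X a) * hnorm Y y"
      using C[OF a(1)] y by (intro mult_right_mono) auto
    finally show "\<bar>f u\<bar> \<le> (C * hnorm Y y) * real_hilbert.nrm (real_iprod X) u"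
      using a by (simp add: X.nrm_embed mult_ac)
  qed
  then obtain z where z: "z \<in> carrier X" "\<And>x. x \<in> carrier X \<Longrightarrow> f (?R x) = real_iprod X (?R x) (?R z)"
    by blast
  have re: "Re (iprod Y (A x) y) = Re (iprod X x z)" if "x \<in> carrier X" for x
    using z(2)[OF that] f[OF that] X.real_iprod[OF that z(1)] by simp
  have eq: "iprod Y (A x) y = iprod X x z" if x: "x \<in> carrier X" for x
  proof (cases "K = \<real>")
    case True
    then have "Im (iprod Y (A x) y) = 0" "Im (iprod X x z) = 0"
      using X.iprod_closed[OF x z(1)] Y.iprod_closed[OF AX[OF x] y] by (auto simp: complex_is_Real_iff)
    then show ?thesis using re[OF x] by (simp add: complex_eq_iff)
  next
    case False
    then have i: "\<i> \<in> K" using X.real_or_complex by auto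
    then have "Re (\<i> * iprod Y (A x) y) = Re (\<i> * iprod X x z)"
      using re[of "\<i> \<odot>\<^bsub>X\<^esub> x"] x z(1) y AX[OF x] module_hom_smult[OF hom, of \<i> x]
      by (simp add: X.smult_closed X.iprod_smult_left Y.iprod_smult_left)
    then show ?thesis using re[OF x] by (simp add: complex_eq_iff)
  qed
  have "hadjoint X Y A y = z"
    unfolding hadjoint_def
  proof (rule the_equality)
    show "z \<in> carrier X \<and> (\<forall>u\<in>carrier X. iprod Y (A u) y = iprod X u z)" using z eq by blast
    fix w assume "w \<in> carrier X \<and> (\<forall>u\<in>carrier X. iprod Y (A u) y = iprod X u w)"
    then show "w = z" using X.iprod_eqI_right[of w z] z eq by metis
  qed
  then show "hadjoint X Y A y \<in> carrier X"
    and "u \<in> carrier X \<Longrightarrow> iprod Y (A u) y = iprod X u (hadjoint X Y A y)"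
    using z eq by auto
qed

lemma hadjoint_hom:
  assumes X: "hilbert_space K X" and Y: "hilbert_space K Y" and A: "A \<in> bounded_maps K X Y"
  shows "hadjoint X Y A \<in> module_hom (scalars K) Y X"
proof -
  interpret X: hilbert_space K X by fact
  interpret Y: hilbert_space K Y by fact
  note adj = hadjoint[OF assms]
  have AX: "A x \<in> carrier Y" if "x \<in> carrier X" for x
    using A that unfolding bounded_maps_def module_hom_def by auto
  show ?thesis
    unfolding module_hom_def
  proof (intro CollectI conjI allI impI)
    show "hadjoint X Y A \<in> carrier Y \<rightarrow> carrier X" using adj(1) by blast
    fix x y assume "x \<in> carrier Y \<and> y \<in> carrier Y"
    then have xy: "x \<in> carrier Y" "y \<in> carrier Y" by auto
    show "hadjoint X Y A (x \<oplus>\<^bsub>Y\<^esub> y) = hadjoint X Y A x \<oplus>\<^bsub>X\<^esub> hadjoint X Y A y"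
      by (rule X.iprod_eqI_right)
        (use xy adj AX in \<open>simp_all add: adj(2)[symmetric] X.iprod_add_right Y.iprod_add_right\<close>)
  next
    fix a x assume "a \<in> carrier (scalars K) \<and> x \<in> carrier Y"
    then have a: "a \<in> K" "x \<in> carrier Y" by auto
    show "hadjoint X Y A (a \<odot>\<^bsub>Y\<^esub> x) = a \<odot>\<^bsub>X\<^esub> hadjoint X Y A x"
      by (rule X.iprod_eqI_right)
        (use a adj AX in \<open>simp_all add: X.smult_closed Y.smult_closed adj(2)[symmetric]
          X.iprod_smult_right Y.iprod_smult_right\<close>)
  qed
qed

locale hilbert_sequence =
  fixes K :: "complex set" and n :: nat and H :: "int \<Rightarrow> 'a ipspace" and \<delta> :: "int \<Rightarrow> 'a \<Rightarrow> 'a"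
  assumes seq: "spaces_and_maps K n H \<delta>"
begin

sublocale Hp: hilbert_space K "H p" for p
  using seq unfolding spaces_and_maps_def by blast

lemma \<delta>_bounded: "\<delta> p \<in> bounded_maps K (H p) (H (p - 1))"
  using seq unfolding spaces_and_maps_def by blast

lemma trivial: "p \<notin> {0..int n} \<Longrightarrow> carrier (H p) = {\<zero>\<^bsub>H p\<^esub>}"
  using seq unfolding spaces_and_maps_def by force

abbreviation "HS S \<equiv> hilbert_sum S H"

abbreviation "families S \<equiv> (\<Pi>\<^sub>E p\<in>S. carrier (H p))"

text \<open>
  Only finitely many of the spaces are nonzero, so square summability is automatic and infinite
  sums reduce to finite ones.
\<close>

lemma sum_carrier [simp]: "carrier (HS S) = families S"
proof -
  have "(\<lambda>p. (hnorm (H p) (x p))\<^sup>2) summable_on S" if x: "x \<in> families S" for x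
  proof -
    have "(\<lambda>p. (hnorm (H p) (x p))\<^sup>2) summable_on (S \<inter> {0..int n})"
      by (rule summable_on_finite) simp
    moreover have "(hnorm (H p) (x p))\<^sup>2 = 0" if "p \<in> S - {0..int n}" for p
    proof -
      have "x p \<in> carrier (H p)" using x that by auto
      then have "x p = \<zero>\<^bsub>H p\<^esub>" using trivial[of p] that by auto
      then show ?thesis by simp
    qed
    ultimately show ?thesis
      using summable_on_cong_neutral[of "S \<inter> {0..int n}" S "\<lambda>p. (hnorm (H p) (x p))\<^sup>2" "\<lambda>p. (hnorm (H p) (x p))\<^sup>2"]
      by auto
  qed
  then show ?thesis unfolding hilbert_sum_def by auto
qed

lemma sum_ops [simp]:
  "\<zero>\<^bsub>HS S\<^esub> = (\<lambda>p\<in>S. \<zero>\<^bsub>H p\<^esub>)"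
  "x \<oplus>\<^bsub>HS S\<^esub> y = (\<lambda>p\<in>S. x p \<oplus>\<^bsub>H p\<^esub> y p)"
  "a \<odot>\<^bsub>HS S\<^esub> x = (\<lambda>p\<in>S. a \<odot>\<^bsub>H p\<^esub> x p)"
  unfolding hilbert_sum_def by simp_all

lemma sum_iprod:
  assumes "x \<in> families S" "y \<in> families S"
  shows "iprod (HS S) x y = (\<Sum>p\<in>S \<inter> {0..int n}. iprod (H p) (x p) (y p))"
proof -
  have "iprod (HS S) x y = (\<Sum>\<^sub>\<infinity>p\<in>S. iprod (H p) (x p) (y p))"
    unfolding hilbert_sum_def by simp
  also have "\<dots> = (\<Sum>\<^sub>\<infinity>p\<in>S \<inter> {0..int n}. iprod (H p) (x p) (y p))"
  proof (rule infsum_cong_neutral)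
    fix p assume p: "p \<in> S - S \<inter> {0..int n}"
    then have "x p \<in> carrier (H p)" "y p \<in> carrier (H p)" using assms by auto
    then show "iprod (H p) (x p) (y p) = 0" using trivial[of p] p by auto
  qed auto
  finally show ?thesis by simp
qed

lemma sum_eqI:
  assumes "x \<in> (\<Pi>\<^sub>E p\<in>S. A p)" "y \<in> (\<Pi>\<^sub>E p\<in>S. B p)" "\<And>p. p \<in> S \<Longrightarrow> x p = y p" shows "x = y"
proof
  fix p show "x p = y p"
    using assms(3) PiE_arb[OF assms(1), of p] PiE_arb[OF assms(2), of p] by (cases "p \<in> S") simp_all
qed

lemma sum_kspace: "kspace K (HS S)"
proof -
  let ?X = "HS S"
  have r: "x p \<in> carrier (H p)" if "x \<in> families S" "p \<in> S" for x p using that by auto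
  have Kc: "a + b \<in> K" "a * b \<in> K" if "a \<in> K" "b \<in> K" for a b
    using Hp.R.a_closed[of a b] Hp.R.m_closed[of a b] that by simp_all
  have K1: "1 \<in> K" using Hp.R.one_closed by simp
  have l: "(a + b) \<odot>\<^bsub>H p\<^esub> x = a \<odot>\<^bsub>H p\<^esub> x \<oplus>\<^bsub>H p\<^esub> b \<odot>\<^bsub>H p\<^esub> x"
    "(a * b) \<odot>\<^bsub>H p\<^esub> x = a \<odot>\<^bsub>H p\<^esub> (b \<odot>\<^bsub>H p\<^esub> x)" "1 \<odot>\<^bsub>H p\<^esub> x = x"
    if "a \<in> K" "b \<in> K" "x \<in> carrier (H p)" for a b x p
    using Hp.smult_l_distr[of a b x] Hp.smult_assoc1[of a b x] Hp.smult_one[of x] that by simp_all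
  have "module (scalars K) ?X"
  proof (rule module_criteria)
    show "cring (scalars K)" by (rule Hp.R.is_cring)
    show "\<forall>v\<in>carrier ?X. \<exists>w\<in>carrier ?X. v \<oplus>\<^bsub>?X\<^esub> w = \<zero>\<^bsub>?X\<^esub>"
    proof
      fix v assume v: "v \<in> carrier ?X"
      then have "(\<lambda>p\<in>S. \<ominus>\<^bsub>H p\<^esub> v p) \<in> carrier ?X" by auto
      moreover have "v \<oplus>\<^bsub>?X\<^esub> (\<lambda>p\<in>S. \<ominus>\<^bsub>H p\<^esub> v p) = \<zero>\<^bsub>?X\<^esub>"
        using v r[of v] by (auto intro!: restrict_ext simp: Hp.M.r_neg)
      ultimately show "\<exists>w\<in>carrier ?X. v \<oplus>\<^bsub>?X\<^esub> w = \<zero>\<^bsub>?X\<^esub>" by blast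
    qed
    show "\<forall>v\<in>carrier ?X. v \<oplus>\<^bsub>?X\<^esub> \<zero>\<^bsub>?X\<^esub> = v"
    proof
      fix v assume v: "v \<in> carrier ?X"
      show "v \<oplus>\<^bsub>?X\<^esub> \<zero>\<^bsub>?X\<^esub> = v"
        by (rule sum_eqI[of _ S "\<lambda>p. carrier (H p)" _ "\<lambda>p. carrier (H p)"]) (use v r[of v] in auto)
    qed
    show "\<forall>v\<in>carrier ?X. \<one>\<^bsub>scalars K\<^esub> \<odot>\<^bsub>?X\<^esub> v = v"
    proof
      fix v assume v: "v \<in> carrier ?X"
      show "\<one>\<^bsub>scalars K\<^esub> \<odot>\<^bsub>?X\<^esub> v = v"
        by (rule sum_eqI[of _ S "\<lambda>p. carrier (H p)" _ "\<lambda>p. carrier (H p)"]) (use v r[of v] l(3) K1 in auto)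
    qed
    show "\<forall>a b v. a \<in> carrier (scalars K) \<and> b \<in> carrier (scalars K) \<and> v \<in> carrier ?X \<longrightarrow>
      (a \<otimes>\<^bsub>scalars K\<^esub> b) \<odot>\<^bsub>?X\<^esub> v = a \<odot>\<^bsub>?X\<^esub> (b \<odot>\<^bsub>?X\<^esub> v)"
      using l(2) r by (auto intro!: restrict_ext)
    show "\<forall>a b v. a \<in> carrier (scalars K) \<and> b \<in> carrier (scalars K) \<and> v \<in> carrier ?X \<longrightarrow>
      (a \<oplus>\<^bsub>scalars K\<^esub> b) \<odot>\<^bsub>?X\<^esub> v = a \<odot>\<^bsub>?X\<^esub> v \<oplus>\<^bsub>?X\<^esub> b \<odot>\<^bsub>?X\<^esub> v"
      using l(1) r by (auto intro!: restrict_ext)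
    show "\<forall>v w x. v \<in> carrier ?X \<and> w \<in> carrier ?X \<and> x \<in> carrier ?X \<longrightarrow>
      (v \<oplus>\<^bsub>?X\<^esub> w) \<oplus>\<^bsub>?X\<^esub> x = v \<oplus>\<^bsub>?X\<^esub> (w \<oplus>\<^bsub>?X\<^esub> x)"
      using r by (auto intro!: restrict_ext simp: Hp.a_assoc)
    show "\<forall>v w. v \<in> carrier ?X \<and> w \<in> carrier ?X \<longrightarrow> v \<oplus>\<^bsub>?X\<^esub> w = w \<oplus>\<^bsub>?X\<^esub> v"
      using r by (auto intro!: restrict_ext simp: Hp.a_comm)
    show "\<forall>a v w. a \<in> carrier (scalars K) \<and> v \<in> carrier ?X \<and> w \<in> carrier ?X \<longrightarrow>
      a \<odot>\<^bsub>?X\<^esub> (v \<oplus>\<^bsub>?X\<^esub> w) = a \<odot>\<^bsub>?X\<^esub> v \<oplus>\<^bsub>?X\<^esub> a \<odot>\<^bsub>?X\<^esub> w"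
      using r by (auto intro!: restrict_ext simp: Hp.smult_r_distr)
  qed (auto simp: Hp.smult_closed)
  then show ?thesis
    by (intro kspace.intro vectorspace.intro kspace_axioms.intro Hp.field_axioms Hp.real_or_complex)
qed

lemma sum_minus:
  assumes "x \<in> families S" "y \<in> families S" "p \<in> S"
  shows "(x \<ominus>\<^bsub>HS S\<^esub> y) p = x p \<ominus>\<^bsub>H p\<^esub> y p"
proof -
  interpret X: kspace K "HS S" by (rule sum_kspace)
  define z where "z = x \<ominus>\<^bsub>HS S\<^esub> y"
  have z: "z \<in> carrier (HS S)" unfolding z_def using assms by (intro X.minus_closed) auto
  have "z \<oplus>\<^bsub>HS S\<^esub> y = x"
    unfolding z_def a_minus_def using assms X.a_assoc[of x "\<ominus>\<^bsub>HS S\<^esub> y" y] X.l_neg[of y] X.r_zero[of x]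
      X.a_inv_closed[of y] unfolding sum_carrier by metis
  then have "z p \<oplus>\<^bsub>H p\<^esub> y p = x p" using assms(3) by (auto simp: fun_eq_iff split: if_splits)
  moreover have "z p \<in> carrier (H p)" "y p \<in> carrier (H p)" using z assms by auto
  ultimately show ?thesis unfolding z_def[symmetric]
    by (metis Hp.M.a_assoc Hp.M.a_inv_closed Hp.M.r_neg Hp.M.r_zero a_minus_def)
qed

lemma sum_hnorm:
  assumes "x \<in> families S"
  shows "hnorm (HS S) x = sqrt (\<Sum>p\<in>S \<inter> {0..int n}. (hnorm (H p) (x p))\<^sup>2)"
proof -
  have "x p \<in> carrier (H p)" if "p \<in> S" for p using assms that by auto
  then show ?thesis
    unfolding hnorm_def[of "HS S"] sum_iprod[OF assms assms]
    by (auto intro!: sum.cong simp: Hp.hnorm_sq)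
qed

lemma sum_hilbert: "hilbert_space K (HS S)"
proof -
  interpret X: kspace K "HS S" by (rule sum_kspace)
  let ?X = "HS S"
  let ?F = "S \<inter> {0..int n}"
  have r: "x p \<in> carrier (H p)" if "x \<in> families S" "p \<in> ?F" for x p using that by auto
  show ?thesis
  proof (intro hilbert_space.intro hilbert_space_axioms.intro X.vectorspace_axioms Hp.real_or_complex)
    fix x y z assume x: "x \<in> carrier ?X" and y: "y \<in> carrier ?X"
    then have x': "x \<in> families S" and y': "y \<in> families S" by auto
    have Ks: "(\<Sum>p\<in>F. f p) \<in> K" if "\<And>p. p \<in> F \<Longrightarrow> f p \<in> K" for F and f :: "int \<Rightarrow> complex"
      using that Hp.real_or_complex by (auto intro: sum_in_Reals)
    show "iprod ?X x y \<in> K"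
      unfolding sum_iprod[OF x' y'] by (rule Ks) (rule Hp.iprod_closed[OF r[OF x'] r[OF y']])
    show "iprod ?X y x = cnj (iprod ?X x y)"
      unfolding sum_iprod[OF x' y'] sum_iprod[OF y' x'] cnj_sum
      by (rule sum.cong[OF HOL.refl]) (rule Hp.iprod_cnj[OF r[OF x'] r[OF y']])
    show "iprod ?X (a \<odot>\<^bsub>?X\<^esub> x) y = a * iprod ?X x y" if "a \<in> K" for a
    proof -
      have ax: "a \<odot>\<^bsub>?X\<^esub> x \<in> families S" using X.smult_closed[of a x] that x by simp
      have "iprod (H p) ((a \<odot>\<^bsub>?X\<^esub> x) p) (y p) = a * iprod (H p) (x p) (y p)" if "p \<in> ?F" for p
        using Hp.iprod_smult_left[OF \<open>a \<in> K\<close> r[OF x' that] r[OF y' that]] that by simp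
      then show ?thesis unfolding sum_iprod[OF ax y'] sum_iprod[OF x' y'] sum_distrib_left
        by (rule sum.cong[OF HOL.refl])
    qed
    show "iprod ?X (x \<oplus>\<^bsub>?X\<^esub> y) z = iprod ?X x z + iprod ?X y z" if "z \<in> carrier ?X"
    proof -
      have z': "z \<in> families S" using that by simp
      have xy: "x \<oplus>\<^bsub>?X\<^esub> y \<in> families S" using X.a_closed[of x y] x y by simp
      have "iprod (H p) ((x \<oplus>\<^bsub>?X\<^esub> y) p) (z p) = iprod (H p) (x p) (z p) + iprod (H p) (y p) (z p)"
        if "p \<in> ?F" for p
        using Hp.iprod_add_left[OF r[OF x' that] r[OF y' that] r[OF z' that]] that by simp
      then show ?thesis
        unfolding sum_iprod[OF xy z'] sum_iprod[OF x' z'] sum_iprod[OF y' z'] sum.distrib[symmetric]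
        by (rule sum.cong[OF HOL.refl])
    qed
  next
    fix x assume x: "x \<in> carrier ?X" and x0: "x \<noteq> \<zero>\<^bsub>?X\<^esub>"
    have x': "x \<in> families S" using x by simp
    have "\<exists>p\<in>S. x p \<noteq> \<zero>\<^bsub>H p\<^esub>"
    proof (rule ccontr)
      assume "\<not> ?thesis"
      then have "x = \<zero>\<^bsub>?X\<^esub>"
        by (intro sum_eqI[of _ S "\<lambda>p. carrier (H p)" _ "\<lambda>p. carrier (H p)"]) (use x' in auto)
      then show False using x0 by blast
    qed
    then obtain p where p: "p \<in> S" "x p \<noteq> \<zero>\<^bsub>H p\<^esub>" by blast
    then have pF: "p \<in> ?F" using trivial[of p] x' by auto
    have "0 < (\<Sum>p\<in>?F. Re (iprod (H p) (x p) (x p)))"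
    proof (rule sum_pos2[OF _ pF])
      show "0 < Re (iprod (H p) (x p) (x p))" using p x' by (intro Hp.iprod_pos) auto
      show "0 \<le> Re (iprod (H i) (x i) (x i))" if "i \<in> ?F" for i
        using Hp.hnorm_sq[OF r[OF x' that]] by (metis zero_le_power2)
    qed simp
    then show "0 < Re (iprod ?X x x)" unfolding sum_iprod[OF x' x'] by simp
  next
    fix f :: "nat \<Rightarrow> int \<Rightarrow> 'a"
    assume f: "\<forall>i. f i \<in> carrier ?X"
      and c: "\<forall>e>0. \<exists>N. \<forall>i\<ge>N. \<forall>j\<ge>N. hnorm ?X (f i \<ominus>\<^bsub>?X\<^esub> f j) < e"
    have f': "f i \<in> families S" for i using f by simp
    have nrm: "hnorm ?X (x \<ominus>\<^bsub>?X\<^esub> y) = sqrt (\<Sum>p\<in>?F. (hnorm (H p) (x p \<ominus>\<^bsub>H p\<^esub> y p))\<^sup>2)"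
      if "x \<in> families S" "y \<in> families S" for x y
    proof -
      have m: "x \<ominus>\<^bsub>?X\<^esub> y \<in> families S" using X.minus_closed[of x y] that by simp
      show ?thesis
        unfolding sum_hnorm[OF m]
        by (rule arg_cong[where f = sqrt], rule sum.cong[OF HOL.refl]) (simp add: sum_minus[OF that])
    qed
    have "\<exists>l\<in>carrier (H p). (\<lambda>i. hnorm (H p) (f i p \<ominus>\<^bsub>H p\<^esub> l)) \<longlonglongrightarrow> 0" if p: "p \<in> S" for p
    proof (cases "p \<in> {0..int n}")
      case False
      then have "f i p = \<zero>\<^bsub>H p\<^esub>" for i using f'[of i] p trivial[OF False] by auto
      then show ?thesis by (intro bexI[of _ "\<zero>\<^bsub>H p\<^esub>"]) (simp_all add: a_minus_def Hp.M.r_neg)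
    next
      case True
      then have pF: "p \<in> ?F" using p by blast
      show ?thesis
      proof (rule Hp.complete)
        show "\<forall>i. f i p \<in> carrier (H p)" using f' p by auto
        have le: "hnorm (H p) (f i p \<ominus>\<^bsub>H p\<^esub> f j p) \<le> hnorm ?X (f i \<ominus>\<^bsub>?X\<^esub> f j)" for i j
        proof -
          have "(hnorm (H p) (f i p \<ominus>\<^bsub>H p\<^esub> f j p))\<^sup>2 \<le> (\<Sum>p\<in>?F. (hnorm (H p) (f i p \<ominus>\<^bsub>H p\<^esub> f j p))\<^sup>2)"
            by (rule member_le_sum[OF pF]) auto
          then show ?thesis unfolding nrm[OF f' f'] by (rule real_le_rsqrt)
        qed
        show "\<forall>e>0. \<exists>N. \<forall>i\<ge>N. \<forall>j\<ge>N. hnorm (H p) (f i p \<ominus>\<^bsub>H p\<^esub> f j p) < e"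
          using c le by (meson order.strict_trans1)
      qed
    qed
    then obtain l where l: "\<And>p. p \<in> S \<Longrightarrow> l p \<in> carrier (H p)"
      "\<And>p. p \<in> S \<Longrightarrow> (\<lambda>i. hnorm (H p) (f i p \<ominus>\<^bsub>H p\<^esub> l p)) \<longlonglongrightarrow> 0" by metis
    define L where "L = (\<lambda>p\<in>S. l p)"
    have L: "L \<in> families S" unfolding L_def using l(1) by auto
    have "(\<lambda>i. sqrt (\<Sum>p\<in>?F. (hnorm (H p) (f i p \<ominus>\<^bsub>H p\<^esub> L p))\<^sup>2)) \<longlonglongrightarrow> sqrt (\<Sum>p\<in>?F. 0\<^sup>2)"
      by (intro tendsto_real_sqrt tendsto_sum tendsto_power) (simp add: L_def l(2))
    then have "(\<lambda>i. hnorm ?X (f i \<ominus>\<^bsub>?X\<^esub> L)) \<longlonglongrightarrow> 0" unfolding nrm[OF f' L] by simp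
    then show "\<exists>l\<in>carrier ?X. (\<lambda>i. hnorm ?X (f i \<ominus>\<^bsub>?X\<^esub> l)) \<longlonglongrightarrow> 0" using L by auto
  qed
qed

end

section \<open>Componentwise subspaces and the shift maps\<close>

lemma module_hom_submodules:
  assumes X: "kspace K X" and Y: "kspace K Y" and A: "A \<in> module_hom (scalars K) X Y"
  shows "submodule (scalars K) (a_kernel X Y A) X"
    and "submodule (scalars K) U X \<Longrightarrow> submodule (scalars K) (A ` U) Y"
proof -
  interpret X: kspace K X by fact
  interpret Y: kspace K Y by fact
  interpret A: mod_hom "scalars K" X Y A
    using A by (intro mod_hom.intro mod_hom_axioms.intro X.module_axioms Y.module_axioms)
  show "submodule (scalars K) (a_kernel X Y A) X"
    using A.ker_is_submodule unfolding A.ker_def a_kernel_def' .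
  assume U: "submodule (scalars K) U X"
  interpret U: kspace K "X\<lparr>carrier := U\<rparr>" using X.kspace_submodule[OF U] .
  have UX: "U \<subseteq> carrier X" using submodule.subset[OF U] .
  have "A \<in> module_hom (scalars K) (X\<lparr>carrier := U\<rparr>) Y"
    using A UX unfolding module_hom_def by (auto simp: subset_iff)
  then interpret AU: mod_hom "scalars K" "X\<lparr>carrier := U\<rparr>" Y A
    by (intro mod_hom.intro mod_hom_axioms.intro U.module_axioms Y.module_axioms)
  show "submodule (scalars K) (A ` U) Y"
    using AU.im_is_submodule unfolding AU.im_def by simp
qed

context hilbert_sequence
begin

sublocale Hs: hilbert_space K "HS S" for S
  by (rule sum_hilbert)

abbreviation "emb S \<equiv> riesz_embedding (HS S)"

text \<open>
  The inclusion of \<open>H p\<close> into the direct sum.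
\<close>

definition "single S p x = (\<lambda>q\<in>S. if q = p then x else \<zero>\<^bsub>H q\<^esub>)"

abbreviation "emb1 S p x \<equiv> emb S (single S p x)"

definition "submodules A \<longleftrightarrow> (\<forall>p. submodule (scalars K) (A p) (H p))"

lemma submodulesD:
  assumes "submodules A"
  shows "A p \<subseteq> carrier (H p)" "\<lbrakk>x \<in> A p; y \<in> A p\<rbrakk> \<Longrightarrow> x \<oplus>\<^bsub>H p\<^esub> y \<in> A p" "\<zero>\<^bsub>H p\<^esub> \<in> A p"
    "\<lbrakk>a \<in> K; x \<in> A p\<rbrakk> \<Longrightarrow> a \<odot>\<^bsub>H p\<^esub> x \<in> A p" "x \<in> A p \<Longrightarrow> x \<in> carrier (H p)"
proof -
  have *: "submodule (scalars K) (A p) (H p)" using assms unfolding submodules_def by blast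
  show "A p \<subseteq> carrier (H p)" by (rule submodule.subset[OF *])
  then show "x \<in> A p \<Longrightarrow> x \<in> carrier (H p)" by blast
  show "\<lbrakk>x \<in> A p; y \<in> A p\<rbrakk> \<Longrightarrow> x \<oplus>\<^bsub>H p\<^esub> y \<in> A p" by (rule submodule.m_closed[OF *])
  show "\<zero>\<^bsub>H p\<^esub> \<in> A p" by (rule submodule.zero_closed[OF *])
  show "\<lbrakk>a \<in> K; x \<in> A p\<rbrakk> \<Longrightarrow> a \<odot>\<^bsub>H p\<^esub> x \<in> A p" using submodule.smult_closed[OF *] by simp
qed

lemma submodules_PiE:
  assumes A: "submodules A" shows "submodule (scalars K) (PiE S A) (HS S)"
  unfolding LinearCombinations.submodule_def
proof (intro conjI allI impI)
  show "module (scalars K) (HS S)" by (rule Hs.module_axioms)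
  show "PiE S A \<subseteq> carrier (HS S)" using submodulesD(1)[OF A] by (simp add: PiE_mono)
qed (auto simp: PiE_iff intro!: submodulesD(2-4)[OF A])

lemma PiE_sub: "submodules A \<Longrightarrow> x \<in> PiE S A \<Longrightarrow> x \<in> families S"
  using PiE_mono[of S A "\<lambda>p. carrier (H p)"] submodulesD(1) by blast

lemma emb_eq: "\<lbrakk>x \<in> families S; y \<in> families S\<rbrakk> \<Longrightarrow> emb S x = emb S y \<longleftrightarrow> x = y"
  using real_embeddingD(4)[OF Hs.riesz_embedding] by simp

lemma single_in: "\<lbrakk>submodules A; x \<in> A p\<rbrakk> \<Longrightarrow> single S p x \<in> PiE S A"
  unfolding single_def using submodulesD(3) by auto

lemma single_same [simp]: "p \<in> S \<Longrightarrow> single S p x p = x"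
  unfolding single_def by simp

lemma submodules_carrier: "submodules (\<lambda>p. carrier (H p))"
  unfolding submodules_def using Hp.carrier_submodule by blast

lemma single_carrier: "x \<in> carrier (H p) \<Longrightarrow> single S p x \<in> families S"
  using single_in[OF submodules_carrier] .

lemma single_hom: "p \<in> S \<Longrightarrow> single S p \<in> module_hom (scalars K) (H p) (HS S)"
  unfolding module_hom_def using single_carrier
  by (auto simp: single_def Hp.smult_r_null intro!: restrict_ext)

lemma emb1: assumes p: "p \<in> S" shows "real_embedding (H p) (emb1 S p)"
  unfolding real_embedding_def
proof (intro conjI ballI allI)
  note R = Hs.riesz_embedding[of S] and h = single_hom[OF p]
  fix x assume x: "x \<in> carrier (H p)"
  have sx: "single S p x \<in> carrier (HS S)" using single_carrier[OF x] by simp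
  show "emb1 S p (complex_of_real r \<odot>\<^bsub>H p\<^esub> x) = r *\<^sub>R emb1 S p x" for r
    using module_hom_smult[OF h _ x, of "complex_of_real r"] real_embeddingD(2)[OF R sx] by (simp del: sum_ops)
  fix y assume y: "y \<in> carrier (H p)"
  have sy: "single S p y \<in> carrier (HS S)" using single_carrier[OF y] by simp
  show "emb1 S p (x \<oplus>\<^bsub>H p\<^esub> y) = emb1 S p x + emb1 S p y"
    using module_hom_add[OF h x y] real_embeddingD(1)[OF R sx sy] by (simp del: sum_ops)
next
  show "inj_on (emb1 S p) (carrier (H p))"
  proof (rule inj_onI)
    fix x y assume xy: "x \<in> carrier (H p)" "y \<in> carrier (H p)" "emb1 S p x = emb1 S p y"
    then have "single S p x = single S p y"
      using emb_eq[OF single_carrier[OF xy(1)] single_carrier[OF xy(2)]] by simp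
    then have "single S p x p = single S p y p" by simp
    then show "x = y" using p by simp
  qed
qed

lemma emb1_subset:
  assumes "submodules C" and "U \<subseteq> C p" shows "emb1 S p ` U \<subseteq> emb S ` PiE S C"
proof (rule image_subsetI)
  fix x assume "x \<in> U"
  then show "emb1 S p x \<in> emb S ` PiE S C" by (intro imageI single_in[OF assms(1)] subsetD[OF assms(2)])
qed

lemma rsub_emb: "submodules A \<Longrightarrow> rsub (emb S ` PiE S A)"
  using Hs.rsub_submodule[OF Hs.riesz_embedding submodules_PiE] .

lemma rsub_emb1: "submodules A \<Longrightarrow> p \<in> S \<Longrightarrow> rsub (emb1 S p ` A p)"
  using Hp.rsub_submodule[OF emb1] unfolding submodules_def by blast

text \<open>
  The components are enlarged from \<open>A p\<close> to \<open>B p\<close> one after the other; outside the degrees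
  \<open>0..n\<close> both are zero.
\<close>

lemma family_fincodim:
  assumes A: "submodules A" and B: "submodules B" and AB: "\<And>p. A p \<subseteq> B p"
    and k: "\<And>p. p \<in> S \<inter> {0..int n} \<Longrightarrow> fincodim (emb1 S p ` A p) (emb1 S p ` B p) (k p)"
  shows "fincodim (emb S ` PiE S A) (emb S ` PiE S B) (\<Sum>p\<in>S \<inter> {0..int n}. k p)"
proof -
  define C where "C F = (\<lambda>p. if p \<in> F then B p else A p)" for F
  have C: "submodules (C F)" for F using A B unfolding submodules_def C_def by simp
  have "fincodim (emb S ` PiE S A) (emb S ` PiE S (C F)) (\<Sum>p\<in>F. k p)" if "finite F" "F \<subseteq> S \<inter> {0..int n}" for F
    using that
  proof (induction F)
    case empty
    then show ?case by (simp add: C_def fincodim.refl)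
  next
    case (insert p F)
    then have p: "p \<in> S" "p \<in> S \<inter> {0..int n}" by auto
    let ?V = "emb S ` PiE S (C F)"
    have V: "rsub ?V" using rsub_emb[OF C] .
    have Ap: "rsub (emb1 S p ` A p)" using rsub_emb1[OF A p(1)] .
    have 1: "emb1 S p ` B p \<inter> ?V \<subseteq> emb1 S p ` A p"
    proof
      fix u assume "u \<in> emb1 S p ` B p \<inter> ?V"
      then obtain x y where x: "x \<in> B p" "u = emb1 S p x" and y: "y \<in> PiE S (C F)" "u = emb S y" by blast
      have "single S p x = y"
        using emb_eq[OF single_carrier[OF submodulesD(5)[OF B x(1)]] PiE_sub[OF C y(1)]] x y by simp
      then have "x = y p" using single_same[OF p(1), of x] by simp
      then have "x \<in> A p" using PiE_mem[OF y(1) p(1)] insert.hyps unfolding C_def by simp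
      then show "u \<in> emb1 S p ` A p" using x by blast
    qed
    have 2: "ssum ?V (emb1 S p ` A p) = ?V"
    proof
      have "A p \<subseteq> C F p" unfolding C_def using AB by auto
      then have "emb1 S p ` A p \<subseteq> ?V" by (rule emb1_subset[OF C])
      then show "ssum ?V (emb1 S p ` A p) \<subseteq> ?V" by (rule ssum_subset[OF V subset_refl])
    qed (rule ssum_left[OF Ap])
    have 3: "ssum ?V (emb1 S p ` B p) = emb S ` PiE S (C (insert p F))" (is "_ = ?W")
    proof
      have "C F q \<subseteq> C (insert p F) q" for q unfolding C_def using AB by auto
      then have "?V \<subseteq> ?W" by (intro image_mono PiE_mono)
      moreover have "emb1 S p ` B p \<subseteq> ?W" by (rule emb1_subset[OF C]) (simp add: C_def)
      ultimately show "ssum ?V (emb1 S p ` B p) \<subseteq> ?W" by (rule ssum_subset[OF rsub_emb[OF C]])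
      show "?W \<subseteq> ssum ?V (emb1 S p ` B p)"
      proof clarify
        fix z assume z: "z \<in> PiE S (C (insert p F))"
        define y where "y = (\<lambda>q\<in>S. if q = p then \<zero>\<^bsub>H q\<^esub> else z q)"
        have y: "y \<in> PiE S (C F)"
        proof (rule PiE_I)
          fix q assume q: "q \<in> S"
          show "y q \<in> C F q"
          proof (cases "q = p")
            case True
            then show ?thesis using submodulesD(3)[OF C] q by (simp add: y_def)
          next
            case False
            then show ?thesis using PiE_mem[OF z q] q by (simp add: y_def C_def)
          qed
        qed (simp add: y_def)
        have zp: "z p \<in> B p" using PiE_mem[OF z p(1)] by (simp add: C_def)
        have zc: "z \<in> families S" using PiE_sub[OF C z] .
        have yc: "y \<in> families S" using PiE_sub[OF C y] .
        have sc: "single S p (z p) \<in> families S"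
          using single_carrier submodulesD(5)[OF B zp] .
        have "z = y \<oplus>\<^bsub>HS S\<^esub> single S p (z p)"
        proof (rule sum_eqI[OF zc])
          show "y \<oplus>\<^bsub>HS S\<^esub> single S p (z p) \<in> families S"
            using Hs.a_closed[of y S "single S p (z p)"] yc sc by simp
          fix q assume q: "q \<in> S"
          have "z q \<in> carrier (H q)" using PiE_mem[OF zc q] .
          then show "z q = (y \<oplus>\<^bsub>HS S\<^esub> single S p (z p)) q" using q by (auto simp: y_def single_def)
        qed
        then have "emb S z = emb S y + emb1 S p (z p)"
          using real_embeddingD(1)[OF Hs.riesz_embedding, of y S "single S p (z p)"] yc sc by (simp del: sum_ops)
        then show "emb S z \<in> ssum ?V (emb1 S p ` B p)" using y zp by (simp only:) (intro ssumI imageI)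
      qed
    qed
    have "fincodim ?V (emb S ` PiE S (C (insert p F))) (k p)"
      using fincodim_ssum[OF k[OF p(2)] V Ap 1] unfolding 2 3 .
    then have "fincodim (emb S ` PiE S A) (emb S ` PiE S (C (insert p F))) (sum k F + k p)"
      using fincodim_trans insert.IH insert.prems by blast
    then show ?case using insert.hyps by (simp add: add.commute)
  qed
  moreover have "PiE S (C (S \<inter> {0..int n})) = PiE S B"
  proof (rule PiE_cong)
    fix p assume p: "p \<in> S"
    have "A p = B p" if "p \<notin> {0..int n}"
      using submodulesD(1,3)[OF A, of p] submodulesD(1,3)[OF B, of p] trivial[OF that] by auto
    then show "C (S \<inter> {0..int n}) p = B p" unfolding C_def using p by auto
  qed
  ultimately show ?thesis by (metis finite_Int finite_atLeastAtMost_int subset_refl)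
qed

text \<open>
  The projection to a single degree maps the direct sums to their components.
\<close>

lemma family_fincodim_component:
  assumes A: "submodules A" and B: "submodules B" and p: "p \<in> S"
    and f: "fincodim (emb S ` PiE S A) (emb S ` PiE S B) k"
  shows "\<exists>j. fincodim (emb1 S p ` A p) (emb1 S p ` B p) j"
proof -
  have hom: "(\<lambda>x. single S p (x p)) \<in> module_hom (scalars K) (HS S) (HS S)"
  proof -
    have m: "x p \<in> carrier (H p)" if "x \<in> families S" for x using PiE_mem[OF that p] .
    show ?thesis
      using single_hom[OF p] p unfolding module_hom_def by (auto simp: m)
  qed
  obtain a where a: "linear a" "\<forall>x\<in>carrier (HS S). a (emb S x) = emb1 S p (x p)"
    using embed_hom[OF Hs.kspace_axioms hom Hs.riesz_embedding Hs.riesz_embedding] by blast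
  have im: "a ` emb S ` PiE S U = emb1 S p ` U p" if U: "submodules U" for U
  proof (intro equalityI subsetI)
    fix v assume "v \<in> a ` emb S ` PiE S U"
    then obtain x where x: "x \<in> PiE S U" "v = a (emb S x)" by blast
    then have "v = emb1 S p (x p)" using a PiE_sub[OF U] by simp
    then show "v \<in> emb1 S p ` U p" using PiE_mem[OF x(1) p] by blast
  next
    fix v assume "v \<in> emb1 S p ` U p"
    then obtain x where x: "x \<in> U p" "v = emb1 S p x" by blast
    then have s: "single S p x \<in> PiE S U" using single_in[OF U] by blast
    then have "v = a (emb S (single S p x))" using a PiE_sub[OF U s] x p by simp
    then show "v \<in> a ` emb S ` PiE S U" using s by blast
  qed
  show ?thesis using fincodim_image[OF a(1) rsub_emb[OF A] f] unfolding im[OF A] im[OF B] by blast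
qed

text \<open>
  This carries the quotients in the definition of a Fredholm chain over to quotients of
  subspaces of the direct sum.
\<close>

lemma family_findim:
  assumes A: "submodules A" and B: "submodules B" and AB: "\<And>p. A p \<subseteq> B p"
  defines "Q \<equiv> \<lambda>p. quotient_space (subspace_of (H p) (B p)) (A p)"
  shows "(\<forall>p\<in>S \<inter> {0..int n}. findim K (Q p)) \<longleftrightarrow>
      (\<exists>k. fincodim (emb S ` PiE S A) (emb S ` PiE S B) k)"
    and "\<forall>p\<in>S \<inter> {0..int n}. findim K (Q p) \<Longrightarrow>
      fincodim (emb S ` PiE S A) (emb S ` PiE S B)
        (scalar_dim K * (\<Sum>p\<in>S \<inter> {0..int n}. vdim K (Q p)))"
proof -
  have q: "findim K (Q p) \<longleftrightarrow> (\<exists>k. fincodim (emb1 S p ` A p) (emb1 S p ` B p) k)"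
    "findim K (Q p) \<Longrightarrow> fincodim (emb1 S p ` A p) (emb1 S p ` B p) (scalar_dim K * vdim K (Q p))"
    if "p \<in> S" for p
    unfolding Q_def using Hp.embed_subquotient[OF emb1[OF that] _ _ AB] A B unfolding submodules_def by blast+
  show 1: "fincodim (emb S ` PiE S A) (emb S ` PiE S B)
        (scalar_dim K * (\<Sum>p\<in>S \<inter> {0..int n}. vdim K (Q p)))" if "\<forall>p\<in>S \<inter> {0..int n}. findim K (Q p)"
    unfolding sum_distrib_left by (rule family_fincodim[OF A B AB]) (use q(2) that in auto)
  show "(\<forall>p\<in>S \<inter> {0..int n}. findim K (Q p)) \<longleftrightarrow>
      (\<exists>k. fincodim (emb S ` PiE S A) (emb S ` PiE S B) k)"
    using 1 family_fincodim_component[OF A B] q(1) by blast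
qed

text \<open>
  \<open>S\<close> and \<open>T\<close> are the even and the odd integers, in either order. The maps below are written for
  both parities at once.
\<close>

definition "opposite S T \<longleftrightarrow> (\<forall>q. q \<in> T \<longleftrightarrow> q + 1 \<in> S) \<and> (\<forall>q. q \<in> S \<longleftrightarrow> q + 1 \<in> (T :: int set))"

lemma opposite_sym: "opposite S T \<Longrightarrow> opposite T S"
  unfolding opposite_def by blast

lemma oppositeD: assumes "opposite S T"
  shows "q \<in> T \<Longrightarrow> q + 1 \<in> S" "q \<in> T \<Longrightarrow> q - 1 \<in> S" "q \<in> S \<Longrightarrow> q - 1 \<in> T" "q \<in> S \<Longrightarrow> q + 1 \<in> T"
proof -
  show "q \<in> T \<Longrightarrow> q + 1 \<in> S" "q \<in> S \<Longrightarrow> q + 1 \<in> T" using assms unfolding opposite_def by blast+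
  have "q - 1 \<in> S \<longleftrightarrow> q - 1 + 1 \<in> T" "q - 1 \<in> T \<longleftrightarrow> q - 1 + 1 \<in> S" using assms unfolding opposite_def by blast+
  then show "q \<in> T \<Longrightarrow> q - 1 \<in> S" "q \<in> S \<Longrightarrow> q - 1 \<in> T" by simp_all
qed

lemma \<delta>_hom: "\<delta> (q + 1) \<in> module_hom (scalars K) (H (q + 1)) (H q)"
  using \<delta>_bounded[of "q + 1"] unfolding bounded_maps_def by simp

abbreviation "\<delta>s p \<equiv> hadjoint (H p) (H (p - 1)) (\<delta> p)"

lemma \<delta>s_hom: "\<delta>s p \<in> module_hom (scalars K) (H (p - 1)) (H p)"
  using hadjoint_hom[OF Hp.hilbert_space_axioms Hp.hilbert_space_axioms \<delta>_bounded] .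

text \<open>
  The summands \<open>\<delta>\<close> and \<open>\<delta>\<^sup>*\<close> of the operators, as maps from degrees in \<open>S\<close> to degrees in \<open>T\<close>. The
  adjoint of \<open>down T\<close> is \<open>up S\<close>, in the opposite direction.
\<close>

definition "down T x = (\<lambda>q\<in>T. \<delta> (q + 1) (x (q + 1)))"

definition "up T x = (\<lambda>q\<in>T. \<delta>s q (x (q - 1)))"

lemma hom_restrict:
  assumes f: "\<And>q. q \<in> T \<Longrightarrow> f q \<in> module_hom (scalars K) (H (s q)) (H q)" and s: "\<And>q. q \<in> T \<Longrightarrow> s q \<in> S"
  shows "(\<lambda>x. \<lambda>q\<in>T. f q (x (s q))) \<in> module_hom (scalars K) (HS S) (HS T)"
  unfolding module_hom_def
proof (intro CollectI conjI allI impI)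
  have m: "x (s q) \<in> carrier (H (s q))" if "x \<in> families S" "q \<in> T" for x q
    using PiE_mem[OF that(1) s[OF that(2)]] .
  show "(\<lambda>x. \<lambda>q\<in>T. f q (x (s q))) \<in> carrier (HS S) \<rightarrow> carrier (HS T)"
  proof
    fix x assume "x \<in> carrier (HS S)"
    then have "f q (x (s q)) \<in> carrier (H q)" if "q \<in> T" for q
      using module_hom_closed[OF f[OF that]] m[OF _ that] by auto
    then show "(\<lambda>q\<in>T. f q (x (s q))) \<in> carrier (HS T)" by simp
  qed
  fix x y assume "x \<in> carrier (HS S) \<and> y \<in> carrier (HS S)"
  then have xy: "x \<in> families S" "y \<in> families S" by auto
  show "(\<lambda>q\<in>T. f q ((x \<oplus>\<^bsub>HS S\<^esub> y) (s q))) =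
    (\<lambda>q\<in>T. f q (x (s q))) \<oplus>\<^bsub>HS T\<^esub> (\<lambda>q\<in>T. f q (y (s q)))"
    using s module_hom_add[OF f m[OF xy(1)] m[OF xy(2)]] by (auto intro!: restrict_ext)
next
  fix a x assume "a \<in> carrier (scalars K) \<and> x \<in> carrier (HS S)"
  then have a: "a \<in> carrier (scalars K)" and x: "x \<in> families S" by auto
  have "x (s q) \<in> carrier (H (s q))" if "q \<in> T" for q using PiE_mem[OF x s[OF that]] .
  then show "(\<lambda>q\<in>T. f q ((a \<odot>\<^bsub>HS S\<^esub> x) (s q))) =
    a \<odot>\<^bsub>HS T\<^esub> (\<lambda>q\<in>T. f q (x (s q)))"
    using s module_hom_smult[OF f a] by (auto intro!: restrict_ext)
qed

lemma down_hom: "opposite S T \<Longrightarrow> down T \<in> module_hom (scalars K) (HS S) (HS T)"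
  unfolding down_def[abs_def] using \<delta>_hom oppositeD(1) by (intro hom_restrict)

lemma up_hom: "opposite S T \<Longrightarrow> up T \<in> module_hom (scalars K) (HS S) (HS T)"
  unfolding up_def[abs_def] using \<delta>s_hom oppositeD(2) by (intro hom_restrict)

lemma down_up_adjoint:
  assumes ST: "opposite S T" and x: "x \<in> carrier (HS S)" and y: "y \<in> carrier (HS T)"
  shows "iprod (HS T) (down T x) y = iprod (HS S) x (up S y)"
proof -
  have x': "x \<in> families S" and y': "y \<in> families T" using x y by auto
  define g where "g p = iprod (H (p - 1)) (\<delta> p (x p)) (y (p - 1))" for p
  have "iprod (HS T) (down T x) y = (\<Sum>\<^sub>\<infinity>q\<in>T. iprod (H q) (down T x q) (y q))"
    unfolding hilbert_sum_def by simp
  also have "\<dots> = (\<Sum>\<^sub>\<infinity>q\<in>T. (g \<circ> (\<lambda>q. q + 1)) q)"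
    by (rule infsum_cong) (simp add: g_def down_def)
  also have "\<dots> = infsum g ((\<lambda>q. q + 1) ` T)"
    by (rule infsum_reindex[symmetric]) (simp add: inj_on_def)
  also have "(\<lambda>q. q + 1) ` T = S"
  proof (intro equalityI subsetI)
    fix p assume "p \<in> S"
    then have "p = (p - 1) + 1" "p - 1 \<in> T" using oppositeD(3)[OF ST] by auto
    then show "p \<in> (\<lambda>q. q + 1) ` T" by blast
  qed (use oppositeD(1)[OF ST] in blast)
  also have "infsum g S = (\<Sum>\<^sub>\<infinity>p\<in>S. iprod (H p) (x p) (up S y p))"
  proof (rule infsum_cong)
    fix p assume p: "p \<in> S"
    have "x p \<in> carrier (H p)" "y (p - 1) \<in> carrier (H (p - 1))"
      using PiE_mem[OF x' p] PiE_mem[OF y' oppositeD(3)[OF ST p]] by auto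
    then show "g p = iprod (H p) (x p) (up S y p)"
      unfolding g_def up_def
      using hadjoint(2)[OF Hp.hilbert_space_axioms Hp.hilbert_space_axioms \<delta>_bounded] p by simp
  qed
  also have "\<dots> = iprod (HS S) x (up S y)"
    unfolding hilbert_sum_def by simp
  finally show ?thesis .
qed

lemma down_image:
  assumes ST: "opposite S T"
  shows "down T ` PiE S A = (\<Pi>\<^sub>E q\<in>T. \<delta> (q + 1) ` A (q + 1))"
proof (intro equalityI subsetI)
  fix z assume "z \<in> down T ` PiE S A"
  then show "z \<in> (\<Pi>\<^sub>E q\<in>T. \<delta> (q + 1) ` A (q + 1))"
    unfolding down_def using oppositeD(1)[OF ST] by (auto intro!: imageI dest: PiE_mem)
next
  fix z assume z: "z \<in> (\<Pi>\<^sub>E q\<in>T. \<delta> (q + 1) ` A (q + 1))"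
  then have "\<forall>q\<in>T. \<exists>a. a \<in> A (q + 1) \<and> z q = \<delta> (q + 1) a" by (auto dest!: PiE_mem)
  then obtain w where w: "\<And>q. q \<in> T \<Longrightarrow> w q \<in> A (q + 1)" "\<And>q. q \<in> T \<Longrightarrow> z q = \<delta> (q + 1) (w q)" by metis
  define x where "x = (\<lambda>p\<in>S. w (p - 1))"
  have "x \<in> PiE S A" unfolding x_def using w(1)[OF oppositeD(3)[OF ST]] by auto
  moreover have "z = down T x"
  proof
    fix q show "z q = down T x q"
      using PiE_arb[OF z, of q] w(2)[of q] oppositeD(1)[OF ST, of q] by (cases "q \<in> T") (simp_all add: down_def x_def)
  qed
  ultimately show "z \<in> down T ` PiE S A" by blast
qed

abbreviation "Nsp p \<equiv> nullsp H \<delta> p"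

abbreviation "Rsp p \<equiv> rangesp H \<delta> (p + 1)"

lemma submodules_range:
  assumes "submodules A" shows "submodules (\<lambda>q. \<delta> (q + 1) ` A (q + 1))"
  using assms module_hom_submodules(2)[OF Hp.kspace_axioms Hp.kspace_axioms \<delta>_hom] unfolding submodules_def by blast

lemma submodules_R: "submodules Rsp"
  using submodules_range[OF submodules_carrier] unfolding rangesp_def .

lemma submodules_N: "submodules Nsp"
  unfolding submodules_def nullsp_def
  using module_hom_submodules(1)[OF Hp.kspace_axioms Hp.kspace_axioms \<delta>_hom, of "_ - 1"] by simp

lemma submodules_Int: "submodules A \<Longrightarrow> submodules B \<Longrightarrow> submodules (\<lambda>p. A p \<inter> B p)"
  unfolding submodules_def LinearCombinations.submodule_def by auto

lemma submodules_zero: "submodules (\<lambda>p. {\<zero>\<^bsub>H p\<^esub>})"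
  unfolding submodules_def LinearCombinations.submodule_def using Hp.module_axioms
  by (auto simp: Hp.smult_r_null)

lemma down_null:
  assumes ST: "opposite S T" and x: "x \<in> families S"
  shows "down T x = \<zero>\<^bsub>HS T\<^esub> \<longleftrightarrow> x \<in> PiE S Nsp"
proof -
  have "down T x = \<zero>\<^bsub>HS T\<^esub> \<longleftrightarrow> (\<forall>q\<in>T. \<delta> (q + 1) (x (q + 1)) = \<zero>\<^bsub>H q\<^esub>)"
    unfolding down_def by (auto simp: fun_eq_iff restrict_def split: if_splits)
  also have "\<dots> \<longleftrightarrow> (\<forall>p\<in>S. \<delta> p (x p) = \<zero>\<^bsub>H (p - 1)\<^esub>)"
    using oppositeD[OF ST] by (metis add_diff_cancel_right' diff_add_cancel)
  also have "\<dots> \<longleftrightarrow> x \<in> PiE S Nsp"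
    using x unfolding nullsp_def a_kernel_def' PiE_iff by auto
  finally show ?thesis .
qed

end

section \<open>The Fredholm operators of a sequence\<close>

lemma module_hom_sum:
  assumes X: "kspace K X" and Y: "kspace K Y"
    and f: "f \<in> module_hom (scalars K) X Y" and g: "g \<in> module_hom (scalars K) X Y"
  shows "(\<lambda>x. f x \<oplus>\<^bsub>Y\<^esub> g x) \<in> module_hom (scalars K) X Y"
proof -
  interpret X: kspace K X by fact
  interpret Y: kspace K Y by fact
  have c: "f x \<in> carrier Y" "g x \<in> carrier Y" if "x \<in> carrier X" for x
    using module_hom_closed[OF f] module_hom_closed[OF g] that by auto
  show ?thesis
    unfolding module_hom_def
  proof (intro CollectI conjI allI impI)
    show "(\<lambda>x. f x \<oplus>\<^bsub>Y\<^esub> g x) \<in> carrier X \<rightarrow> carrier Y" using c by simp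
    fix x y assume "x \<in> carrier X \<and> y \<in> carrier X"
    then have xy: "x \<in> carrier X" "y \<in> carrier X" by auto
    show "f (x \<oplus>\<^bsub>X\<^esub> y) \<oplus>\<^bsub>Y\<^esub> g (x \<oplus>\<^bsub>X\<^esub> y) = (f x \<oplus>\<^bsub>Y\<^esub> g x) \<oplus>\<^bsub>Y\<^esub> (f y \<oplus>\<^bsub>Y\<^esub> g y)"
      using c xy by (simp add: module_hom_add[OF f] module_hom_add[OF g] Y.a_ac)
  next
    fix a x assume "a \<in> carrier (scalars K) \<and> x \<in> carrier X"
    then have a: "a \<in> carrier (scalars K)" "x \<in> carrier X" by auto
    show "f (a \<odot>\<^bsub>X\<^esub> x) \<oplus>\<^bsub>Y\<^esub> g (a \<odot>\<^bsub>X\<^esub> x) = a \<odot>\<^bsub>Y\<^esub> (f x \<oplus>\<^bsub>Y\<^esub> g x)"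
      using c[OF a(2)] module_hom_smult[OF f a] module_hom_smult[OF g a] Y.smult_r_distr[OF a(1)] by simp
  qed
qed

context hilbert_sequence
begin

abbreviation "X S \<equiv> emb S ` carrier (HS S)"

abbreviation "ip S \<equiv> real_iprod (HS S)"

lemma emb_zero: "emb S (\<zero>\<^bsub>HS S\<^esub>) = 0"
  using Hs.embed_zero[OF Hs.riesz_embedding] .

lemma null_image:
  assumes ST: "opposite S T" and d: "\<forall>x\<in>carrier (HS S). d (emb S x) = emb T (down T x)"
  shows "nullset d (X S) = emb S ` PiE S Nsp"
proof -
  have "d (emb S x) = 0 \<longleftrightarrow> x \<in> PiE S Nsp" if x: "x \<in> carrier (HS S)" for x
  proof -
    have "down T x \<in> carrier (HS T)" using module_hom_closed[OF down_hom[OF ST]] x by blast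
    then have "emb T (down T x) = emb T (\<zero>\<^bsub>HS T\<^esub>) \<longleftrightarrow> down T x = \<zero>\<^bsub>HS T\<^esub>"
      using real_embeddingD(4)[OF Hs.riesz_embedding, of "down T x" T "\<zero>\<^bsub>HS T\<^esub>"] Hs.zero_closed[of T] by blast
    then show ?thesis using d x down_null[OF ST, of x] unfolding emb_zero by simp
  qed
  moreover have "PiE S Nsp \<subseteq> carrier (HS S)" using PiE_sub[OF submodules_N] by auto
  ultimately show ?thesis by auto
qed

lemma range_image:
  assumes ST: "opposite S T" and d: "\<forall>x\<in>carrier (HS S). d (emb S x) = emb T (down T x)"
    and A: "submodules A"
  shows "d ` emb S ` PiE S A = emb T ` (\<Pi>\<^sub>E q\<in>T. \<delta> (q + 1) ` A (q + 1))"
proof -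
  have "d ` emb S ` PiE S A = emb T ` down T ` PiE S A"
    unfolding image_image using d PiE_sub[OF A] by (intro image_cong[OF HOL.refl]) simp
  then show ?thesis unfolding down_image[OF ST] .
qed

lemma emb_Int:
  assumes "submodules A" "submodules B"
  shows "emb S ` PiE S A \<inter> emb S ` PiE S B = emb S ` (\<Pi>\<^sub>E p\<in>S. A p \<inter> B p)"
proof -
  have eq: "(\<Pi>\<^sub>E p\<in>S. A p \<inter> B p) = PiE S A \<inter> PiE S B" by (auto simp: PiE_iff)
  have "PiE S A \<subseteq> carrier (HS S)" "PiE S B \<subseteq> carrier (HS S)"
    using PiE_sub assms by auto
  then show ?thesis
    unfolding eq by (rule inj_on_image_Int[OF real_embeddingD(3)[OF Hs.riesz_embedding], symmetric])
qed

lemma operator_eq: "delta_plus_adjoint T H \<delta> x = down T x \<oplus>\<^bsub>HS T\<^esub> up T x"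
  unfolding delta_plus_adjoint_def by (auto simp: down_def up_def intro!: restrict_ext)

lemma operator_hom:
  "opposite S T \<Longrightarrow> delta_plus_adjoint T H \<delta> \<in> module_hom (scalars K) (HS S) (HS T)"
  using module_hom_sum[OF Hs.kspace_axioms Hs.kspace_axioms down_hom up_hom]
  unfolding operator_eq[abs_def, symmetric] operator_eq[symmetric] by simp

text \<open>
  The operator is bounded because it has an everywhere defined adjoint \<open>b\<close>.
\<close>

lemma operator_fredholm:
  assumes ST: "opposite S T"
    and d: "linear d" "\<forall>x\<in>carrier (HS S). d (emb S x) = emb T (down T x)"
    and e: "linear e" "\<forall>x\<in>carrier (HS S). e (emb S x) = emb T (up T x)"
    and b: "b ` X T \<subseteq> X S"
    and adj: "\<And>x y. \<lbrakk>x \<in> X S; y \<in> X T\<rbrakk> \<Longrightarrow> ip T (d x + e x) y = ip S x (b y)"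
  defines "Op \<equiv> delta_plus_adjoint T H \<delta>"
  shows "fredholm K (HS S) (HS T) Op \<longleftrightarrow>
      (\<exists>i. fredholm_pair (\<lambda>x. d x + e x) (X S) (X T) i)"
    and "fredholm K (HS S) (HS T) Op \<Longrightarrow>
      fredholm_pair (\<lambda>x. d x + e x) (X S) (X T)
        (int (scalar_dim K) * fredholm_index K (HS S) (HS T) Op)"
proof -
  have hom: "Op \<in> module_hom (scalars K) (HS S) (HS T)"
    unfolding Op_def by (rule operator_hom[OF ST])
  have D: "linear (\<lambda>x. d x + e x)" using linear_compose_add d(1) e(1) by blast
  have eq: "d (emb S x) + e (emb S x) = emb T (Op x)" if x: "x \<in> carrier (HS S)" for x
  proof -
    have "down T x \<in> carrier (HS T)" "up T x \<in> carrier (HS T)"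
      using module_hom_closed[OF down_hom[OF ST]] module_hom_closed[OF up_hom[OF ST]] x by blast+
    then show ?thesis
      unfolding Op_def operator_eq using real_embeddingD(1)[OF Hs.riesz_embedding, of "down T x" T "up T x"] d(2) e(2) x
      by (simp del: sum_ops sum_carrier)
  qed
  have OpX: "Op x \<in> carrier (HS T)" if "x \<in> carrier (HS S)" for x
    using module_hom_closed[OF hom] that by blast
  then have DX: "(\<lambda>x. d x + e x) ` X S \<subseteq> X T" using eq by (auto simp del: sum_carrier)
  have "\<exists>C. \<forall>u\<in>X S. ip T (d u + e u) (d u + e u) \<le> C * ip S u u"
    by (rule adjoint_bounded[OF Hs.real_hilbert[of S] Hs.real_hilbert[of T] D DX b]) (rule adj)
  then obtain C where C: "\<And>u. u \<in> X S \<Longrightarrow> ip T (d u + e u) (d u + e u) \<le> C * ip S u u" by blast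
  have "hnorm (HS T) (Op x) \<le> sqrt C * hnorm (HS S) x"
    if x: "x \<in> carrier (HS S)" for x
    using C[OF imageI[OF x]] x OpX[OF x] unfolding eq[OF x] hnorm_def real_sqrt_mult[symmetric]
    by (simp add: Hs.real_iprod del: sum_carrier)
  then have "Op \<in> bounded_maps K (HS S) (HS T)"
    using hom unfolding bounded_maps_def by blast
  moreover note embed_fredholm[where a = "\<lambda>x. d x + e x" and A = Op and \<phi> = "emb S" and \<psi> = "emb T", OF Hs.kspace_axioms[of S] Hs.kspace_axioms[of T] hom
      Hs.riesz_embedding[of S] Hs.riesz_embedding[of T] eq]
  ultimately show "fredholm K (HS S) (HS T) Op \<longleftrightarrow>
      (\<exists>i. fredholm_pair (\<lambda>x. d x + e x) (X S) (X T) i)"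
    and "fredholm K (HS S) (HS T) Op \<Longrightarrow>
      fredholm_pair (\<lambda>x. d x + e x) (X S) (X T)
        (int (scalar_dim K) * fredholm_index K (HS S) (HS T) Op)"
    unfolding fredholm_def fredholm_index_def by blast+
qed

text \<open>
  In each degree the range of the product of the two shifts is that of some \<open>\<delta>\<^sub>p \<delta>\<^sub>p\<^sub>+\<^sub>1\<close>.
\<close>

lemma finite_rank_square:
  assumes ST: "opposite S T"
    and fin: "\<And>p. findim K (subspace_of (H (p - 1)) ((\<delta> p \<circ> \<delta> (p + 1)) ` carrier (H (p + 1))))"
    and d0: "\<forall>x\<in>carrier (HS S). d0 (emb S x) = emb T (down T x)"
    and d1: "\<forall>y\<in>carrier (HS T). d1 (emb T y) = emb S (down S y)"
  shows "\<exists>r. fincodim {0} (d1 ` d0 ` X S) r"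
proof -
  define A where "A q = \<delta> (q + 1) ` carrier (H (q + 1))" for q
  define B where "B q = \<delta> (q + 1) ` A (q + 1)" for q
  have A: "submodules A" unfolding A_def using submodules_range[OF submodules_carrier] .
  have B: "submodules B" unfolding B_def using submodules_range[OF A] .
  have im: "d1 ` d0 ` X S = emb S ` PiE S B"
    using range_image[OF ST d0 submodules_carrier] range_image[OF opposite_sym[OF ST] d1 A]
    unfolding A_def[symmetric] B_def[symmetric] by simp
  have "\<exists>k. fincodim (emb1 S p ` {\<zero>\<^bsub>H p\<^esub>}) (emb1 S p ` B p) k" if p: "p \<in> S" for p
  proof -
    have "B p = (\<delta> (p + 1) \<circ> \<delta> (p + 1 + 1)) ` carrier (H (p + 1 + 1))"
      unfolding B_def A_def by (simp add: image_comp)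
    then have "findim K (subspace_of (H p) (B p))" using fin[of "p + 1"] by simp
    then show ?thesis
      using Hp.embed_subspace(1)[OF emb1[OF p], of "B p"] B Hp.embed_zero[OF emb1[OF p]] unfolding submodules_def by simp
  qed
  then obtain k where k: "\<And>p. p \<in> S \<Longrightarrow> fincodim (emb1 S p ` {\<zero>\<^bsub>H p\<^esub>}) (emb1 S p ` B p) (k p)" by metis
  have "fincodim (emb S ` (\<Pi>\<^sub>E p\<in>S. {\<zero>\<^bsub>H p\<^esub>})) (emb S ` PiE S B) (\<Sum>p\<in>S \<inter> {0..int n}. k p)"
    by (rule family_fincodim[OF submodules_zero B]) (use submodulesD(3)[OF B] k in auto)
  moreover have "(\<Pi>\<^sub>E p\<in>S. {\<zero>\<^bsub>H p\<^esub>}) = {\<zero>\<^bsub>HS S\<^esub>}"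
    by (simp add: PiE_singleton[of "\<lambda>p\<in>S. \<zero>\<^bsub>H p\<^esub>" S, symmetric] cong: PiE_cong)
  ultimately show ?thesis unfolding im using emb_zero by auto
qed

lemma cycle_exists:
  assumes ST: "opposite S T"
    and fin: "\<And>p. findim K (subspace_of (H (p - 1)) ((\<delta> p \<circ> \<delta> (p + 1)) ` carrier (H (p + 1))))"
  obtains d0 d1 e0 e1 where "adjoint_cycle (X S) (ip S) (X T) (ip T) d0 d1 e0 e1"
    "\<forall>x\<in>carrier (HS S). d0 (emb S x) = emb T (down T x)"
    "\<forall>y\<in>carrier (HS T). d1 (emb T y) = emb S (down S y)"
    "\<forall>y\<in>carrier (HS T). e0 (emb T y) = emb S (up S y)"
    "\<forall>x\<in>carrier (HS S). e1 (emb S x) = emb T (up T x)"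
proof -
  note TS = opposite_sym[OF ST]
  have ex: "\<exists>a. linear a \<and> (\<forall>x\<in>carrier (HS S'). a (emb S' x) = emb T' (f x))"
    if "f \<in> module_hom (scalars K) (HS S') (HS T')" for f S' T'
    by (rule embed_hom[OF Hs.kspace_axioms[of S'] that Hs.riesz_embedding[of S'] Hs.riesz_embedding[of T']])
  obtain d0 where d0: "linear d0" "\<forall>x\<in>carrier (HS S). d0 (emb S x) = emb T (down T x)"
    using ex[OF down_hom[OF ST]] by blast
  obtain d1 where d1: "linear d1" "\<forall>y\<in>carrier (HS T). d1 (emb T y) = emb S (down S y)"
    using ex[OF down_hom[OF TS]] by blast
  obtain e0 where e0: "linear e0" "\<forall>y\<in>carrier (HS T). e0 (emb T y) = emb S (up S y)"
    using ex[OF up_hom[OF TS]] by blast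
  obtain e1 where e1: "linear e1" "\<forall>x\<in>carrier (HS S). e1 (emb S x) = emb T (up T x)"
    using ex[OF up_hom[OF ST]] by blast
  note cl = module_hom_closed[OF down_hom, THEN funcset_mem] module_hom_closed[OF up_hom, THEN funcset_mem]
  have adj: "ip T' (d (emb S' x)) (emb T' y) = ip S' (emb S' x) (e (emb T' y))"
    if "opposite S' T'" "\<forall>x\<in>carrier (HS S'). d (emb S' x) = emb T' (down T' x)"
      "\<forall>y\<in>carrier (HS T'). e (emb T' y) = emb S' (up S' y)"
      "x \<in> carrier (HS S')" "y \<in> carrier (HS T')" for S' T' d e x y
    using that cl(1)[OF that(1,4)] cl(2)[OF opposite_sym[OF that(1)] that(5)] down_up_adjoint[OF that(1,4,5)]
    by (simp add: Hs.real_iprod del: sum_carrier)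
  have "adjoint_cycle (X S) (ip S) (X T) (ip T) d0 d1 e0 e1"
  proof (intro adjoint_cycle.intro adjoint_cycle_axioms.intro Hs.real_hilbert d0(1) d1(1) e0(1) e1(1))
    show "d0 ` X S \<subseteq> X T" "e1 ` X S \<subseteq> X T" using d0(2) e1(2) cl[OF ST] by (auto simp del: sum_carrier)
    show "d1 ` X T \<subseteq> X S" "e0 ` X T \<subseteq> X S" using d1(2) e0(2) cl[OF TS] by (auto simp del: sum_carrier)
    show "\<exists>r. fincodim {0} (d1 ` d0 ` X S) r" by (rule finite_rank_square[OF ST fin d0(2) d1(2)])
    show "\<exists>r. fincodim {0} (d0 ` d1 ` X T) r" by (rule finite_rank_square[OF TS fin d1(2) d0(2)])
    fix u v assume "u \<in> X S" "v \<in> X T"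
    then obtain x y where xy: "x \<in> carrier (HS S)" "y \<in> carrier (HS T)"
      "u = emb S x" "v = emb T y" by blast
    show "ip T (d0 u) v = ip S u (e0 v)" unfolding xy(3,4) by (rule adj[OF ST d0(2) e0(2) xy(1,2)])
    show "ip S (d1 v) u = ip T v (e1 u)" unfolding xy(3,4) by (rule adj[OF TS d1(2) e1(2) xy(2,1)])
  qed
  then show ?thesis using that d0(2) d1(2) e0(2) e1(2) by blast
qed

theorem fredholm_equivalence:
  assumes fin: "\<And>p. findim K (subspace_of (H (p - 1)) ((\<delta> p \<circ> \<delta> (p + 1)) ` carrier (H (p + 1))))"
  shows "fredholm_chain K n H \<delta> \<longleftrightarrow> fredholm K (even_sum H) (odd_sum H) (even_op H \<delta>)"
    and "fredholm K (even_sum H) (odd_sum H) (even_op H \<delta>) \<longleftrightarrow>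
      fredholm K (odd_sum H) (even_sum H) (odd_op H \<delta>)"
    and "fredholm_chain K n H \<delta> \<Longrightarrow>
      chain_index K n H \<delta> = fredholm_index K (even_sum H) (odd_sum H) (even_op H \<delta>)"
    and "fredholm_chain K n H \<delta> \<Longrightarrow>
      fredholm_index K (even_sum H) (odd_sum H) (even_op H \<delta>) =
        - fredholm_index K (odd_sum H) (even_sum H) (odd_op H \<delta>)"
proof -
  define E where "E = {p :: int. even p}"
  define D where "D = {p :: int. odd p}"
  note ED = E_def[symmetric] D_def[symmetric]
  have op: "opposite E D" unfolding opposite_def E_def D_def by auto
  have op': "opposite D E" using opposite_sym[OF op] .
  obtain d0 d1 e0 e1 where cyc: "adjoint_cycle (X E) (ip E) (X D) (ip D) d0 d1 e0 e1"
    and d0: "\<forall>x\<in>carrier (HS E). d0 (emb E x) = emb D (down D x)"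
    and d1: "\<forall>y\<in>carrier (HS D). d1 (emb D y) = emb E (down E y)"
    and e0: "\<forall>y\<in>carrier (HS D). e0 (emb D y) = emb E (up E y)"
    and e1: "\<forall>x\<in>carrier (HS E). e1 (emb E x) = emb D (up D x)"
    using cycle_exists[OF op fin] .
  interpret C: adjoint_cycle "X E" "ip E" "X D" "ip D" d0 d1 e0 e1 by (rule cyc)
  define a where "a = (\<lambda>x. d0 x + e1 x)"
  define b where "b = (\<lambda>y. d1 y + e0 y)"
  have lin: "linear a" "linear b" unfolding a_def b_def using linear_compose_add C.lin by blast+
  have aX: "a ` X E \<subseteq> X D" and bX: "b ` X D \<subseteq> X E"
    unfolding a_def b_def by (auto simp del: sum_carrier)
  have adj: "ip D (a x) y = ip E x (b y)" if "x \<in> X E" "y \<in> X D" for x y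
    unfolding a_def b_def using that C.adj0[OF that] C.adj1[OF that] C.X.sym[of x "d1 y"] C.Y.sym[of "e1 x" y]
    by (simp add: C.Y.add_left C.X.add_right del: sum_carrier)
  have adj': "ip E (b y) x = ip D y (a x)" if "y \<in> X D" "x \<in> X E" for x y
  proof -
    have "a x \<in> X D" "b y \<in> X E" using aX bX that by blast+
    then show ?thesis using adj[OF that(2,1)] C.X.sym[OF that(2)] C.Y.sym[OF _ that(1)] by metis
  qed
  \<comment> \<open>All real dimensions below are \<open>m\<close> times the dimensions over \<open>K\<close>.\<close>
  define m where "m = int (scalar_dim K)"
  have m0: "m \<noteq> 0" unfolding m_def using scalar_dim_pos[of K] by simp
  define ie where "ie = fredholm_index K (HS E) (HS D) (even_op H \<delta>)"
  define io where "io = fredholm_index K (HS D) (HS E) (odd_op H \<delta>)"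
  define Fe where "Fe \<longleftrightarrow> fredholm K (HS E) (HS D) (even_op H \<delta>)"
  define Fo where "Fo \<longleftrightarrow> fredholm K (HS D) (HS E) (odd_op H \<delta>)"
  have fe: "Fe \<longleftrightarrow> (\<exists>i. fredholm_pair a (X E) (X D) i)" "Fe \<Longrightarrow> fredholm_pair a (X E) (X D) (m * ie)"
    unfolding Fe_def ie_def m_def a_def
    using operator_fredholm[OF op C.lin(1) d0 C.lin(4) e1 bX adj[unfolded a_def]] unfolding ED by auto
  have fo: "Fo \<longleftrightarrow> (\<exists>i. fredholm_pair b (X D) (X E) i)" "Fo \<Longrightarrow> fredholm_pair b (X D) (X E) (m * io)"
    unfolding Fo_def io_def m_def b_def
    using operator_fredholm[OF op' C.lin(2) d1 C.lin(3) e0 aX adj'[unfolded b_def]] unfolding ED by auto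
  have dual: "fredholm_pair b (X D) (X E) i \<longleftrightarrow> fredholm_pair a (X E) (X D) (- i)" for i
    by (rule adjoint_fredholm_iff[OF Hs.real_hilbert[of E] Hs.real_hilbert[of D] lin aX bX]) (rule adj)
  have eo: "Fe \<longleftrightarrow> Fo" unfolding fe(1) fo(1) dual by (metis add.inverse_inverse)
  have index_eo: "ie = - io" if Fe
  proof -
    have "fredholm_pair a (X E) (X D) (- (m * io))" using fo(2) that eo dual by blast
    then have "m * ie = - (m * io)"
      using fredholm_pair_unique[OF lin(1) C.X.sub] fe(2)[OF that] by blast
    then have "m * ie = m * (- io)" by simp
    then show ?thesis using m0 mult_cancel_left by blast
  qed
  have R: "submodules Rsp" and N: "submodules Nsp" and I: "submodules (\<lambda>p. Nsp p \<inter> Rsp p)"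
    using submodules_R submodules_N submodules_Int by blast+
  have n0: "nullset d0 (X E) = emb E ` PiE E Nsp" and n1: "nullset d1 (X D) = emb D ` PiE D Nsp"
    using null_image[OF op d0] null_image[OF op' d1] by blast+
  have r0: "d0 ` X E = emb D ` PiE D Rsp" and r1: "d1 ` X D = emb E ` PiE E Rsp"
    using range_image[OF op d0 submodules_carrier] range_image[OF op' d1 submodules_carrier]
    unfolding rangesp_def by simp_all
  have i0: "nullset d0 (X E) \<inter> d1 ` X D = emb E ` (\<Pi>\<^sub>E p\<in>E. Nsp p \<inter> Rsp p)"
    and i1: "nullset d1 (X D) \<inter> d0 ` X E = emb D ` (\<Pi>\<^sub>E p\<in>D. Nsp p \<inter> Rsp p)"
    unfolding n0 n1 r0 r1 using emb_Int[OF N R] by blast+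
  note fs = C.fredholm_sum[unfolded i0 i1, unfolded n0 n1 r0 r1, folded a_def]
  note fN = family_findim[OF I N Int_lower1, folded null_quotient_def]
  note fR = family_findim[OF I R Int_lower2, folded range_quotient_def]
  have range_fin: "\<forall>p\<in>S \<inter> {0..int n}. findim K (range_quotient H \<delta> p)" if "S = E \<or> S = D" for S
    using that fR(1)[of E] fR(1)[of D] fs(2,3) by blast
  have split: "{0..int n} = (E \<inter> {0..int n}) \<union> (D \<inter> {0..int n})" unfolding E_def D_def by auto
  have chain: "fredholm_chain K n H \<delta> \<longleftrightarrow>
      (\<forall>p\<in>E \<inter> {0..int n}. findim K (null_quotient H \<delta> p)) \<and>
      (\<forall>p\<in>D \<inter> {0..int n}. findim K (null_quotient H \<delta> p))"
    unfolding fredholm_chain_def using seq range_fin[of E] range_fin[of D] by (subst split) blast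
  have ce: "fredholm_chain K n H \<delta> \<longleftrightarrow> Fe" unfolding chain fN(1) fe(1) fs(1) ..
  have index: "chain_index K n H \<delta> = ie" if ch: "fredholm_chain K n H \<delta>"
  proof -
    define \<nu> where "\<nu> S = (\<Sum>p\<in>S \<inter> {0..int n}. vdim K (null_quotient H \<delta> p))" for S
    define \<rho> where "\<rho> S = (\<Sum>p\<in>S \<inter> {0..int n}. vdim K (range_quotient H \<delta> p))" for S
    have "fredholm_pair a (X E) (X D)
      ((int (scalar_dim K * \<nu> E) - int (scalar_dim K * \<rho> E)) - (int (scalar_dim K * \<nu> D) - int (scalar_dim K * \<rho> D)))"
      unfolding \<nu>_def \<rho>_def using ch[unfolded chain] range_fin by (intro fs(4) fN(2) fR(2)) blast+
    then have "m * ie = m * ((int (\<nu> E) - int (\<rho> E)) - (int (\<nu> D) - int (\<rho> D)))"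
      using fredholm_pair_unique[OF lin(1) C.X.sub fe(2)] ch ce unfolding m_def by (simp add: algebra_simps)
    then have ie: "ie = (int (\<nu> E) - int (\<rho> E)) - (int (\<nu> D) - int (\<rho> D))"
      using m0 mult_cancel_left by blast
    define g where "g p = int (vdim K (null_quotient H \<delta> p)) - int (vdim K (range_quotient H \<delta> p))" for p
    have "chain_index K n H \<delta> = (\<Sum>p\<in>(E \<inter> {0..int n}) \<union> (D \<inter> {0..int n}). (-1) ^ nat p * g p)"
      unfolding chain_index_def g_def split[symmetric] ..
    also have "\<dots> = (\<Sum>p\<in>E \<inter> {0..int n}. (-1) ^ nat p * g p) + (\<Sum>p\<in>D \<inter> {0..int n}. (-1) ^ nat p * g p)"
      by (rule sum.union_disjoint) (auto simp: E_def D_def)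
    also have "(\<Sum>p\<in>E \<inter> {0..int n}. (-1) ^ nat p * g p) = (\<Sum>p\<in>E \<inter> {0..int n}. g p)"
      by (rule sum.cong) (auto simp: E_def even_nat_iff)
    also have "(\<Sum>p\<in>D \<inter> {0..int n}. (-1) ^ nat p * g p) = (\<Sum>p\<in>D \<inter> {0..int n}. - g p)"
      by (rule sum.cong) (auto simp: D_def even_nat_iff)
    also have "(\<Sum>p\<in>E \<inter> {0..int n}. g p) + (\<Sum>p\<in>D \<inter> {0..int n}. - g p) = ie"
      unfolding ie g_def \<nu>_def \<rho>_def by (simp add: sum_subtractf sum_negf)
    finally show ?thesis .
  qed
  show "fredholm_chain K n H \<delta> \<longleftrightarrow> fredholm K (even_sum H) (odd_sum H) (even_op H \<delta>)"
    using ce unfolding Fe_def ED .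
  show "fredholm K (even_sum H) (odd_sum H) (even_op H \<delta>) \<longleftrightarrow>
      fredholm K (odd_sum H) (even_sum H) (odd_op H \<delta>)"
    using eo unfolding Fe_def Fo_def ED .
  show "fredholm_chain K n H \<delta> \<Longrightarrow>
      chain_index K n H \<delta> = fredholm_index K (even_sum H) (odd_sum H) (even_op H \<delta>)"
    using index unfolding ie_def ED .
  show "fredholm_chain K n H \<delta> \<Longrightarrow>
      fredholm_index K (even_sum H) (odd_sum H) (even_op H \<delta>) =
        - fredholm_index K (odd_sum H) (even_sum H) (odd_op H \<delta>)"
    using index_eo ce unfolding ie_def io_def ED by blast
qed

end

theorem theorem6p2:
  fixes K :: "complex set" and n :: nat
    and H :: "int \<Rightarrow> 'a ipspace" and \<delta> :: "int \<Rightarrow> 'a \<Rightarrow> 'a"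
  assumes "spaces_and_maps K n H \<delta>"
    and "\<And>p. findim K (subspace_of (H (p - 1)) ((\<delta> p \<circ> \<delta> (p + 1)) ` carrier (H (p + 1))))"
  shows "(fredholm_chain K n H \<delta> \<longleftrightarrow> fredholm K (even_sum H) (odd_sum H) (even_op H \<delta>)) \<and>
    (fredholm K (even_sum H) (odd_sum H) (even_op H \<delta>) \<longleftrightarrow>
      fredholm K (odd_sum H) (even_sum H) (odd_op H \<delta>)) \<and>
    (fredholm_chain K n H \<delta> \<longrightarrow>
      chain_index K n H \<delta> = fredholm_index K (even_sum H) (odd_sum H) (even_op H \<delta>) \<and>
      fredholm_index K (even_sum H) (odd_sum H) (even_op H \<delta>) =
        - fredholm_index K (odd_sum H) (even_sum H) (odd_op H \<delta>))"
proof -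
  interpret hilbert_sequence K n H \<delta> by (rule hilbert_sequence.intro) (rule assms(1))
  show ?thesis using fredholm_equivalence[OF assms(2)] by blast
qed

end
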